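(* Suppose that $$Y_i(t)=\int_0^1\psi(t,s)X_i(s)\,ds+\varepsilon_i(t),\qquad 1\le i\le N,$$ where $\psi$ is the kernel of a Hilbert–Schmidt integral operator $\Psi$ on $L^2=L^2([0,1])$, the $X_i$ are i.i.d. mean zero random elements of $L^2$, the $\varepsilon_i$ are i.i.d. mean zero random elements of $L^2$ with $E\|\varepsilon_i\|^2<\infty$, and the $\varepsilon_i$ are independent of the $X_i$. Suppose that each of the sequences $\{X_i\}$ and $\{Y_i\}$ satisfies conditions (RV) and (Q) of the context, with index $\alpha\in(2,4)$. Suppose that the eigenvalues $\lambda_j$ of the covariance operator of $X$ and $\gamma_j$ of the covariance operator of $Y$ satisfy $$\lambda_1>\lambda_2>\cdots>0,\qquad\gamma_1>\gamma_2>\cdots>0.$$ Set $\alpha_1=\lambda_1-\lambda_2$, $\beta_1=\gamma_1-\gamma_2$, and for $j\ge2$, $\alpha_j=\min\{\lambda_j-\lambda_{j+1},\lambda_{j-1}-\lambda_j\}$, $\beta_j=\min\{\gamma_j-\gamma_{j+1},\gamma_{j-1}-\gamma_j\}$. Suppose that $K=K_N$ and $L=L_N$ tend to infinity with $N$ in such a way that for some $\gamma\in(1,\alpha/2)$, $$\limsup_{N\to\infty}\lambda_L^{-3/2}L^{1/2}N^{1/\gamma-1}<\infty,\qquad \limsup_{N\to\infty}\lambda_L^{-1}\Big(\sum_{j=1}^L\alpha_j^{-1}\Big)N^{1/\gamma-1}<\infty,$$ $$\limsup_{N\to\infty}\lambda_L^{-1}K^{1/2}N^{1/\gamma-1}<\infty,$$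 $$\limsup_{N\to\infty}\lambda_L^{-1}\Big\{\Big(\sum_{k=1}^K\beta_k^{-1}\Big)+\Big(\sum_{k=1}^K\beta_k^{-2}\Big)^{1/2}\Big\}N^{1/\gamma-1}<\infty.$$ Let $\widehat\Psi_{KL}$ be the integral operator with kernel $$\hat\psi_{KL}(t,s)=\sum_{k=1}^K\sum_{\ell=1}^L\frac{\hat\sigma_{\ell k}}{\hat\lambda_\ell}\hat u_k(t)\hat v_\ell(s),\qquad\hat\sigma_{\ell k}=\frac1N\sum_{i=1}^N\langle X_i,\hat v_\ell\rangle\langle Y_i,\hat u_k\rangle.$$ Then, with $\|\cdot\|_{\mathcal{L}}$ the operator norm, $\|\widehat\Psi_{KL}-\Psi\|_{\mathcal{L}}\to0$ almost surely as $N\to\infty$.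
   Context: For $y,z\in L^2$, $(y\otimes z)(x)=\langle y,x\rangle z$. Let $C=E[X\otimes X]$ with eigenvalues $\lambda_j$ and orthonormal eigenfunctions $v_j$, and $C_Y=E[Y\otimes Y]$ with eigenvalues $\gamma_j$ and orthonormal eigenfunctions $u_j$, eigenvalues in decreasing order; $X=\sum_i\xi_iv_i$, $Y=\sum_j\zeta_ju_j$ with $\lambda_i=E\xi_i^2$, $\gamma_j=E\zeta_j^2$. $\widehat C=N^{-1}\sum_{i=1}^NX_i\otimes X_i$ has eigenvalues $\hat\lambda_j$ (decreasing) and orthonormal eigenfunctions $\hat v_j$; $\widehat C_Y=N^{-1}\sum_{i=1}^NY_i\otimes Y_i$ has orthonormal eigenfunctions $\hat u_j$ (ordered by decreasing eigenvalues). Condition (RV) for an i.i.d. sequence distributed as $W$: $W$ is a mean zero random element of $L^2$ that is regularly varying with index $\alpha$, i.e. $P(\|W\|>u)=u^{-\alpha}\ell(u)$ for some slowly varying $\ell$ (meaning $\ell(cu)/\ell(u)\to1$ as $u\to\infty$ for all $c>0$) and $P(W/\|W\|\in\cdot\mid\|W\|>u)$ converges weakly, as $u\to\infty$, to a probability measure on the unit sphere. Condition (Q) for $W$: with $w_j$ the orthonormal eigenfunctions of $E[W\otimes W]$ (ordered by decreasing eigenvalues) and $\eta_j=\langle W,w_j\rangle$, for all $n,m\ge1$, $$\lim_{u\to\infty}\frac{P\left(\{\sum_{j=n}^\infty\eta_j^2\}^{1/2}\{\sum_{j=m}^\infty\eta_j^2\}^{1/2}>u\right)}{P\left(\sum_{j=1}^\infty\eta_j^2>u\right)}>0.$$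 *)

theory Defs
  imports "HOL-Probability.Probability"
begin

text \<open>
  The space \<open>L\<^sup>2([0,1])\<close>: Borel functions on the real line whose square is integrable
  over the unit interval, modulo equality almost everywhere on it. We make it a type and
  show that it is a separable Hilbert space, which is what the Bochner integral requires.
\<close>

definition unit_borel :: "real measure" where
  "unit_borel = restrict_space lborel {0..1}"

lemma space_unit_borel: "space unit_borel = {0..1}"
  by (simp add: unit_borel_def space_restrict_space)

lemma prob_space_unit_borel: "prob_space unit_borel"
  by (rule prob_spaceI)
    (simp add: unit_borel_def space_restrict_space emeasure_restrict_space)

interpretation unit_borel: prob_space unit_borel
  by (rule prob_space_unit_borel)

definition square_integrable :: "(real \<Rightarrow> real) \<Rightarrow> bool" where
  "square_integrable f \<longleftrightarrow>
     f \<in> borel_measurable unit_borel \<and> integrable unit_borel (\<lambda>t. (f t)\<^sup>2)"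

lemma square_integrable_cmult:
  "square_integrable f \<Longrightarrow> square_integrable (\<lambda>t. c * f t)"
  unfolding square_integrable_def power_mult_distrib by auto

lemma square_integrable_bounded:
  assumes [measurable]: "f \<in> borel_measurable unit_borel" and "\<And>t. \<bar>f t\<bar> \<le> B"
  shows "square_integrable f"
  unfolding square_integrable_def
proof
  show "integrable unit_borel (\<lambda>t. (f t)\<^sup>2)"
  proof (rule unit_borel.integrable_const_bound)
    have "(f t)\<^sup>2 \<le> B\<^sup>2" for t
      using power_mono[OF assms(2)[of t], of 2] by simp
    then show "AE t in unit_borel. norm ((f t)\<^sup>2) \<le> B\<^sup>2" by simp
  qed measurable
qed fact

lemma square_integrable_mult:
  assumes "square_integrable f" "square_integrable g"
  shows "integrable unit_borel (\<lambda>t. f t * g t)"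
proof (rule Bochner_Integration.integrable_bound)
  have [measurable]: "f \<in> borel_measurable unit_borel" "g \<in> borel_measurable unit_borel"
    using assms by (auto simp: square_integrable_def)
  show "integrable unit_borel (\<lambda>t. (f t)\<^sup>2 + (g t)\<^sup>2)"
    using assms by (auto simp: square_integrable_def)
  show "(\<lambda>t. f t * g t) \<in> borel_measurable unit_borel" by measurable
  have "norm (a * b) \<le> norm (a\<^sup>2 + b\<^sup>2)" for a b :: real
  proof -
    have "2 * (\<bar>a\<bar> * \<bar>b\<bar>) \<le> a\<^sup>2 + b\<^sup>2"
      using sum_squares_bound[of "\<bar>a\<bar>" "\<bar>b\<bar>"] by (simp add: mult.assoc)
    moreover have "0 \<le> \<bar>a\<bar> * \<bar>b\<bar>" by simp
    ultimately have "\<bar>a\<bar> * \<bar>b\<bar> \<le> a\<^sup>2 + b\<^sup>2" by linarith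
    then show ?thesis by (simp add: abs_mult)
  qed
  then show "AE t in unit_borel. norm (f t * g t) \<le> norm ((f t)\<^sup>2 + (g t)\<^sup>2)"
    by simp
qed

lemma square_integrable_add:
  assumes "square_integrable f" "square_integrable g"
  shows "square_integrable (\<lambda>t. f t + g t)"
proof -
  have "integrable unit_borel (\<lambda>t. (f t)\<^sup>2 + (g t)\<^sup>2 + 2 * (f t * g t))"
    using assms square_integrable_mult[OF assms] by (auto simp: square_integrable_def)
  moreover have "(f t)\<^sup>2 + (g t)\<^sup>2 + 2 * (f t * g t) = (f t + g t)\<^sup>2" for t
    by (simp add: power2_sum)
  ultimately show ?thesis
    using assms by (auto simp: square_integrable_def)
qed

lemma square_integrable_diff:
  assumes "square_integrable f" "square_integrable g"
  shows "square_integrable (\<lambda>t. f t - g t)"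
  using square_integrable_add[OF assms(1) square_integrable_cmult[OF assms(2), of "-1"]] by simp

lemma square_integrable_zero: "square_integrable (\<lambda>t. 0)"
  by (simp add: square_integrable_def)

quotient_type L2 = "real \<Rightarrow> real" / partial:
    "\<lambda>f g. square_integrable f \<and> square_integrable g \<and> (AE t in unit_borel. f t = g t)"
  morphisms rep_L2 abs_L2
proof (rule part_equivpI)
  show "\<exists>f. square_integrable f \<and> square_integrable f \<and> (AE t in unit_borel. f t = f t)"
    using square_integrable_zero by auto
  show "symp (\<lambda>f g. square_integrable f \<and> square_integrable g \<and> (AE t in unit_borel. f t = g t))"
    by (auto simp: symp_def eq_commute)
  show "transp (\<lambda>f g. square_integrable f \<and> square_integrable g \<and> (AE t in unit_borel. f t = g t))"
  proof (rule transpI, elim conjE, intro conjI)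
    fix f g h
    assume "AE t in unit_borel. f t = g t" "AE t in unit_borel. g t = (h t :: real)"
    then show "AE t in unit_borel. f t = h t" by eventually_elim simp
  qed
qed

lemma square_integrable_rep: "square_integrable (rep_L2 x)"
  using Quotient3_rep_reflp[OF Quotient3_L2] by blast

lemma abs_rep_L2: "abs_L2 (rep_L2 x) = x"
  by (rule Quotient3_abs_rep[OF Quotient3_L2])

lemma rep_abs_L2:
  assumes "square_integrable f"
  shows "AE t in unit_borel. rep_L2 (abs_L2 f) t = f t"
  using Quotient3_rep_abs[OF Quotient3_L2, of f] assms by simp

lemma l2_eqI: "(AE t in unit_borel. rep_L2 x t = rep_L2 y t) \<Longrightarrow> x = y"
  using Quotient3_rel_rep[OF Quotient3_L2, of x y] square_integrable_rep by blast

lemma rep_L2_measurable [measurable]: "rep_L2 x \<in> borel_measurable unit_borel"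
  using square_integrable_rep[of x] by (simp add: square_integrable_def)

instantiation L2 :: real_vector
begin

definition zero_L2 :: L2 where "0 = abs_L2 (\<lambda>t. 0)"
definition plus_L2 :: "L2 \<Rightarrow> L2 \<Rightarrow> L2" where
  "x + y = abs_L2 (\<lambda>t. rep_L2 x t + rep_L2 y t)"
definition minus_L2 :: "L2 \<Rightarrow> L2 \<Rightarrow> L2" where
  "x - y = abs_L2 (\<lambda>t. rep_L2 x t - rep_L2 y t)"
definition uminus_L2 :: "L2 \<Rightarrow> L2" where
  "- x = abs_L2 (\<lambda>t. - rep_L2 x t)"
definition scaleR_L2 :: "real \<Rightarrow> L2 \<Rightarrow> L2" where
  "c *\<^sub>R x = abs_L2 (\<lambda>t. c * rep_L2 x t)"

lemma rep_zero: "AE t in unit_borel. rep_L2 0 t = 0"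
  unfolding zero_L2_def by (rule rep_abs_L2) (rule square_integrable_zero)

lemma rep_plus: "AE t in unit_borel. rep_L2 (x + y) t = rep_L2 x t + rep_L2 y t"
  unfolding plus_L2_def
  by (rule rep_abs_L2) (intro square_integrable_add square_integrable_rep)

lemma rep_minus: "AE t in unit_borel. rep_L2 (x - y) t = rep_L2 x t - rep_L2 y t"
  unfolding minus_L2_def
  by (rule rep_abs_L2) (intro square_integrable_diff square_integrable_rep)

lemma rep_uminus: "AE t in unit_borel. rep_L2 (- x) t = - rep_L2 x t"
  unfolding uminus_L2_def
  using rep_abs_L2[OF square_integrable_cmult[OF square_integrable_rep[of x], of "-1"]] by simp

lemma rep_scaleR: "AE t in unit_borel. rep_L2 (c *\<^sub>R x) t = c * rep_L2 x t"
  unfolding scaleR_L2_def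
  by (rule rep_abs_L2) (intro square_integrable_cmult square_integrable_rep)

instance
proof
  fix x y z :: L2 and a b :: real
  show "x + y + z = x + (y + z)"
  proof (rule l2_eqI)
    show "AE t in unit_borel. rep_L2 (x + y + z) t = rep_L2 (x + (y + z)) t"
      using rep_plus[of "x + y" z] rep_plus[of x y] rep_plus[of x "y + z"] rep_plus[of y z]
      by eventually_elim simp
  qed
  show "x + y = y + x"
    by (simp add: plus_L2_def add.commute)
  show "0 + x = x"
  proof (rule l2_eqI)
    show "AE t in unit_borel. rep_L2 (0 + x) t = rep_L2 x t"
      using rep_plus[of 0 x] rep_zero by eventually_elim simp
  qed
  show "- x + x = 0"
  proof (rule l2_eqI)
    show "AE t in unit_borel. rep_L2 (- x + x) t = rep_L2 0 t"
      using rep_plus[of "- x" x] rep_uminus[of x] rep_zero by eventually_elim simp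
  qed
  show "x - y = x + - y"
  proof (rule l2_eqI)
    show "AE t in unit_borel. rep_L2 (x - y) t = rep_L2 (x + - y) t"
      using rep_plus[of x "- y"] rep_uminus[of y] rep_minus[of x y] by eventually_elim simp
  qed
  show "a *\<^sub>R (x + y) = a *\<^sub>R x + a *\<^sub>R y"
  proof (rule l2_eqI)
    show "AE t in unit_borel. rep_L2 (a *\<^sub>R (x + y)) t = rep_L2 (a *\<^sub>R x + a *\<^sub>R y) t"
      using rep_plus[of x y] rep_plus[of "a *\<^sub>R x" "a *\<^sub>R y"] rep_scaleR[of a x]
        rep_scaleR[of a y] rep_scaleR[of a "x + y"]
      by eventually_elim (simp add: algebra_simps)
  qed
  show "(a + b) *\<^sub>R x = a *\<^sub>R x + b *\<^sub>R x"
  proof (rule l2_eqI)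
    show "AE t in unit_borel. rep_L2 ((a + b) *\<^sub>R x) t = rep_L2 (a *\<^sub>R x + b *\<^sub>R x) t"
      using rep_plus[of "a *\<^sub>R x" "b *\<^sub>R x"] rep_scaleR[of a x]
        rep_scaleR[of b x] rep_scaleR[of "a + b" x]
      by eventually_elim (simp add: algebra_simps)
  qed
  show "a *\<^sub>R b *\<^sub>R x = (a * b) *\<^sub>R x"
  proof (rule l2_eqI)
    show "AE t in unit_borel. rep_L2 (a *\<^sub>R b *\<^sub>R x) t = rep_L2 ((a * b) *\<^sub>R x) t"
      using rep_scaleR[of a "b *\<^sub>R x"] rep_scaleR[of b x] rep_scaleR[of "a * b" x]
      by eventually_elim simp
  qed
  show "1 *\<^sub>R x = x"
    by (simp add: scaleR_L2_def abs_rep_L2)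
qed

end

instantiation L2 :: real_inner
begin

definition inner_L2 :: "L2 \<Rightarrow> L2 \<Rightarrow> real" where
  "inner x y = (\<integral>t. rep_L2 x t * rep_L2 y t \<partial>unit_borel)"
definition norm_L2 :: "L2 \<Rightarrow> real" where
  "norm_L2 x = sqrt (inner x x)"
definition dist_L2 :: "L2 \<Rightarrow> L2 \<Rightarrow> real" where
  "dist_L2 x y = norm (x - y)"
definition sgn_L2 :: "L2 \<Rightarrow> L2" where
  "sgn_L2 x = x /\<^sub>R norm x"
definition uniformity_L2 :: "(L2 \<times> L2) filter" where
  "uniformity_L2 = (INF e\<in>{0<..}. principal {(x, y). dist x y < e})"
definition open_L2 :: "L2 set \<Rightarrow> bool" where
  "open_L2 U \<longleftrightarrow> (\<forall>x\<in>U. eventually (\<lambda>(x', y). x' = x \<longrightarrow> y \<in> U) uniformity)"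

instance
proof
  fix x y z :: L2 and a :: real
  show "dist x y = norm (x - y)" by (rule dist_L2_def)
  show "sgn x = x /\<^sub>R norm x" by (rule sgn_L2_def)
  show "uniformity = (INF e\<in>{0<..}. principal {(x, y :: L2). dist x y < e})"
    by (rule uniformity_L2_def)
  show "open U \<longleftrightarrow> (\<forall>x\<in>U. eventually (\<lambda>(x', y). x' = x \<longrightarrow> y \<in> U) uniformity)" for U :: "L2 set"
    by (rule open_L2_def)
  show "inner x y = inner y x"
    by (simp add: inner_L2_def mult.commute)
  show "inner (x + y) z = inner x z + inner y z"
  proof -
    have "inner (x + y) z
      = (\<integral>t. rep_L2 x t * rep_L2 z t + rep_L2 y t * rep_L2 z t \<partial>unit_borel)"
      unfolding inner_L2_def
    proof (rule integral_cong_AE)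
      show "AE t in unit_borel. rep_L2 (x + y) t * rep_L2 z t
          = rep_L2 x t * rep_L2 z t + rep_L2 y t * rep_L2 z t"
        using rep_plus[of x y] by eventually_elim (simp add: algebra_simps)
    qed measurable
    also have "\<dots> = inner x z + inner y z"
      unfolding inner_L2_def
      by (intro Bochner_Integration.integral_add square_integrable_mult square_integrable_rep)
    finally show ?thesis .
  qed
  show "inner (a *\<^sub>R x) y = a * inner x y"
  proof -
    have "inner (a *\<^sub>R x) y = (\<integral>t. a * (rep_L2 x t * rep_L2 y t) \<partial>unit_borel)"
      unfolding inner_L2_def
    proof (rule integral_cong_AE)
      show "AE t in unit_borel. rep_L2 (a *\<^sub>R x) t * rep_L2 y t = a * (rep_L2 x t * rep_L2 y t)"
        using rep_scaleR[of a x] by eventually_elim simp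
    qed measurable
    then show ?thesis by (simp add: inner_L2_def)
  qed
  show "0 \<le> inner x x"
    unfolding inner_L2_def by (rule integral_nonneg_AE) simp
  show "inner x x = 0 \<longleftrightarrow> x = 0"
  proof
    assume "inner x x = 0"
    then have "AE t in unit_borel. rep_L2 x t * rep_L2 x t = 0"
      unfolding inner_L2_def
      by (subst (asm) integral_nonneg_eq_0_iff_AE)
        (auto intro: square_integrable_mult square_integrable_rep)
    then have "AE t in unit_borel. rep_L2 x t = rep_L2 0 t"
      using rep_zero by eventually_elim simp
    then show "x = 0" by (rule l2_eqI)
  next
    assume "x = 0"
    moreover have "(\<integral>t. rep_L2 0 t * rep_L2 0 t \<partial>unit_borel) = (\<integral>t. 0 \<partial>unit_borel)"
    proof (rule integral_cong_AE)
      show "AE t in unit_borel. rep_L2 0 t * rep_L2 0 t = 0"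
        using rep_zero by eventually_elim simp
    qed measurable
    ultimately show "inner x x = 0" by (simp add: inner_L2_def)
  qed
  show "norm x = sqrt (inner x x)" by (rule norm_L2_def)
qed

end

lemma nn_integral_rep_L2: "(\<integral>\<^sup>+t. (rep_L2 x t)\<^sup>2 \<partial>unit_borel) = (norm x)\<^sup>2"
proof -
  have "(\<integral>\<^sup>+t. (rep_L2 x t)\<^sup>2 \<partial>unit_borel) = (\<integral>t. (rep_L2 x t)\<^sup>2 \<partial>unit_borel)"
    using square_integrable_rep[of x]
    by (intro nn_integral_eq_integral) (auto simp: square_integrable_def)
  then show ?thesis
    by (simp add: power2_norm_eq_inner inner_L2_def flip: power2_eq_square)
qed

lemma nn_integral_diff_L2:
  "(\<integral>\<^sup>+t. (rep_L2 x t - rep_L2 y t)\<^sup>2 \<partial>unit_borel) = (dist x y)\<^sup>2"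
proof -
  have "(\<integral>\<^sup>+t. (rep_L2 x t - rep_L2 y t)\<^sup>2 \<partial>unit_borel)
      = (\<integral>\<^sup>+t. (rep_L2 (x - y) t)\<^sup>2 \<partial>unit_borel)"
  proof (rule nn_integral_cong_AE)
    show "AE t in unit_borel. ennreal ((rep_L2 x t - rep_L2 y t)\<^sup>2)
        = ennreal ((rep_L2 (x - y) t)\<^sup>2)"
      using rep_minus[of x y] by eventually_elim simp
  qed
  then show ?thesis by (simp add: nn_integral_rep_L2 dist_norm)
qed

lemma nn_integral_abs_diff_L2:
  assumes "dist x y \<le> a" "0 < a"
  shows "(\<integral>\<^sup>+t. \<bar>rep_L2 x t - rep_L2 y t\<bar> \<partial>unit_borel) \<le> a"
proof -
  have *: "\<bar>h\<bar> \<le> a / 2 + h\<^sup>2 / (2 * a)" for h :: real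
  proof -
    have "0 \<le> (\<bar>h\<bar> - a)\<^sup>2" by simp
    then have "2 * a * \<bar>h\<bar> \<le> a\<^sup>2 + h\<^sup>2" by (simp add: power2_diff algebra_simps)
    then show ?thesis using assms(2) by (simp add: field_simps power2_eq_square)
  qed
  have "(\<integral>\<^sup>+t. \<bar>rep_L2 x t - rep_L2 y t\<bar> \<partial>unit_borel)
      \<le> (\<integral>\<^sup>+t. ennreal (a / 2) + ennreal (1 / (2 * a)) * (rep_L2 x t - rep_L2 y t)\<^sup>2 \<partial>unit_borel)"
    by (intro nn_integral_mono)
      (use * assms(2) in \<open>simp flip: ennreal_plus ennreal_mult add: ennreal_leI\<close>)
  also have "\<dots> = ennreal (a / 2) + ennreal (1 / (2 * a)) * ennreal ((dist x y)\<^sup>2)"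
    by (simp add: nn_integral_add nn_integral_cmult nn_integral_diff_L2 unit_borel.emeasure_space_1)
  also have "\<dots> \<le> ennreal (a / 2) + ennreal (1 / (2 * a)) * ennreal (a\<^sup>2)"
    using assms by (intro add_left_mono mult_left_mono ennreal_leI power_mono) auto
  also have "\<dots> = ennreal (a / 2 + 1 / (2 * a) * a\<^sup>2)"
    using assms(2) by (simp flip: ennreal_plus ennreal_mult)
  also have "a / 2 + 1 / (2 * a) * a\<^sup>2 = a"
    using assms(2) by (simp add: field_simps power2_eq_square)
  finally show ?thesis .
qed

instance L2 :: complete_space
proof
  fix X :: "nat \<Rightarrow> L2"
  assume "Cauchy X"
  then have "\<forall>k. \<exists>N. \<forall>m\<ge>N. \<forall>n\<ge>N. dist (X m) (X n) < (1 / 2) ^ k"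
    unfolding Cauchy_def by simp
  then obtain N where N: "\<And>k m n. N k \<le> m \<Longrightarrow> N k \<le> n \<Longrightarrow> dist (X m) (X n) < (1 / 2) ^ k"
    by metis
  define r where "r k = (\<Sum>i\<le>k. N i)" for k
  have r: "N j \<le> r k" if "j \<le> k" for j k
    unfolding r_def using that by (intro member_le_sum) auto
  define g where "g k = rep_L2 (X (r k))" for k
  have [measurable]: "g k \<in> borel_measurable unit_borel" for k
    unfolding g_def by measurable
  have "(\<integral>\<^sup>+t. (\<Sum>k. ennreal \<bar>g (Suc k) t - g k t\<bar>) \<partial>unit_borel)
      = (\<Sum>k. \<integral>\<^sup>+t. \<bar>g (Suc k) t - g k t\<bar> \<partial>unit_borel)"
    by (intro nn_integral_suminf) measurable
  also have "\<dots> \<le> (\<Sum>k. ennreal ((1 / 2) ^ k))"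
    unfolding g_def using N[OF r r]
    by (intro suminf_le nn_integral_abs_diff_L2) (auto intro: less_imp_le)
  also have "\<dots> < \<infinity>"
    by (subst suminf_ennreal2) (auto intro: summable_geometric)
  finally have "AE t in unit_borel. (\<Sum>k. ennreal \<bar>g (Suc k) t - g k t\<bar>) \<noteq> \<infinity>"
    by (intro nn_integral_noteq_infinite) auto
  then have conv: "AE t in unit_borel. convergent (\<lambda>k. g k t)"
  proof eventually_elim
    case (elim t)
    then have "summable (\<lambda>k. \<bar>g (Suc k) t - g k t\<bar>)"
      by (intro summable_suminf_not_top) auto
    then have "summable (\<lambda>k. g (Suc k) t - g k t)"
      by (rule summable_rabs_cancel)
    then have "convergent (\<lambda>n. \<Sum>k<n. g (Suc k) t - g k t)"
      by (simp add: summable_iff_convergent)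
    then have "convergent (\<lambda>n. (g n t - g 0 t) + g 0 t)"
      by (intro convergent_add convergent_const) (simp only: sum_lessThan_telescope[of "\<lambda>k. g k t"])
    then show ?case by simp
  qed
  define f where "f t = lim (\<lambda>k. g k t)" for t
  have f_meas [measurable]: "f \<in> borel_measurable unit_borel"
    unfolding f_def by measurable
  have close: "(\<integral>\<^sup>+t. (rep_L2 (X n) t - f t)\<^sup>2 \<partial>unit_borel) \<le> ennreal (((1 / 2) ^ k)\<^sup>2)"
    if "N k \<le> n" for n k
  proof -
    have "(\<integral>\<^sup>+t. (rep_L2 (X n) t - f t)\<^sup>2 \<partial>unit_borel)
        = (\<integral>\<^sup>+t. liminf (\<lambda>m. ennreal ((rep_L2 (X n) t - g m t)\<^sup>2)) \<partial>unit_borel)"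
    proof (rule nn_integral_cong_AE)
      show "AE t in unit_borel. ennreal ((rep_L2 (X n) t - f t)\<^sup>2)
          = liminf (\<lambda>m. ennreal ((rep_L2 (X n) t - g m t)\<^sup>2))"
        using conv
      proof eventually_elim
        case (elim t)
        then have "(\<lambda>m. g m t) \<longlonglongrightarrow> f t"
          by (simp add: convergent_LIMSEQ_iff f_def)
        then have "(\<lambda>m. ennreal ((rep_L2 (X n) t - g m t)\<^sup>2)) \<longlonglongrightarrow> ennreal ((rep_L2 (X n) t - f t)\<^sup>2)"
          by (intro tendsto_ennrealI tendsto_intros)
        then show ?case
          using lim_imp_Liminf[OF sequentially_bot] by metis
      qed
    qed
    also have "\<dots> \<le> liminf (\<lambda>m. \<integral>\<^sup>+t. (rep_L2 (X n) t - g m t)\<^sup>2 \<partial>unit_borel)"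
      by (intro nn_integral_liminf) measurable
    also have "\<dots> = liminf (\<lambda>m. ennreal ((dist (X n) (X (r m)))\<^sup>2))"
      by (simp add: g_def nn_integral_diff_L2)
    also have "\<dots> \<le> limsup (\<lambda>m. ennreal ((dist (X n) (X (r m)))\<^sup>2))"
      by (rule Liminf_le_Limsup) simp
    also have "\<dots> \<le> ennreal (((1 / 2) ^ k)\<^sup>2)"
    proof (rule Limsup_bounded)
      show "\<forall>\<^sub>F m in sequentially. ennreal ((dist (X n) (X (r m)))\<^sup>2) \<le> ennreal (((1 / 2) ^ k)\<^sup>2)"
        using eventually_ge_at_top[of k]
      proof eventually_elim
        case (elim m)
        show ?case
          by (intro ennreal_leI power_mono less_imp_le[OF N[OF that r[OF elim]]]) auto
      qed
    qed
    finally show ?thesis .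
  qed
  have "square_integrable (\<lambda>t. rep_L2 (X (N 0)) t - f t)"
    unfolding square_integrable_def
  proof
    show "integrable unit_borel (\<lambda>t. (rep_L2 (X (N 0)) t - f t)\<^sup>2)"
      using close[of 0 "N 0"]
      by (intro integrableI_nonneg) (auto simp: less_top[symmetric] top_unique)
  qed measurable
  from square_integrable_diff[OF square_integrable_rep[of "X (N 0)"] this]
  have "square_integrable f" by simp
  then have f: "AE t in unit_borel. rep_L2 (abs_L2 f) t = f t"
    by (rule rep_abs_L2)
  have close': "dist (X n) (abs_L2 f) \<le> (1 / 2) ^ k" if "N k \<le> n" for n k
  proof -
    have "(\<integral>\<^sup>+t. (rep_L2 (X n) t - rep_L2 (abs_L2 f) t)\<^sup>2 \<partial>unit_borel)
        = (\<integral>\<^sup>+t. (rep_L2 (X n) t - f t)\<^sup>2 \<partial>unit_borel)"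
    proof (rule nn_integral_cong_AE)
      show "AE t in unit_borel. ennreal ((rep_L2 (X n) t - rep_L2 (abs_L2 f) t)\<^sup>2)
          = ennreal ((rep_L2 (X n) t - f t)\<^sup>2)"
        using f by eventually_elim simp
    qed
    with close[OF that] have "ennreal ((dist (X n) (abs_L2 f))\<^sup>2) \<le> ennreal (((1 / 2) ^ k)\<^sup>2)"
      by (simp add: nn_integral_diff_L2)
    then have "(dist (X n) (abs_L2 f))\<^sup>2 \<le> ((1 / 2) ^ k)\<^sup>2"
      by (subst (asm) ennreal_le_iff) simp_all
    then show ?thesis by (rule power2_le_imp_le) simp
  qed
  have "X \<longlonglongrightarrow> abs_L2 f"
  proof (rule metric_LIMSEQ_I)
    fix e :: real assume "0 < e"
    then obtain k where "(1 / 2) ^ k < e"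
      using real_arch_pow_inv[of e "1 / 2"] by auto
    then show "\<exists>no. \<forall>n\<ge>no. dist (X n) (abs_L2 f) < e"
      using close' by (meson le_less_trans)
  qed
  then show "convergent X" by (auto simp: convergent_def)
qed

instance L2 :: banach ..

lemma abs_L2_add:
  assumes "square_integrable f" "square_integrable g"
  shows "abs_L2 (\<lambda>t. f t + g t) = abs_L2 f + abs_L2 g"
proof (rule l2_eqI)
  show "AE t in unit_borel. rep_L2 (abs_L2 (\<lambda>t. f t + g t)) t = rep_L2 (abs_L2 f + abs_L2 g) t"
    using rep_abs_L2[OF assms(1)] rep_abs_L2[OF assms(2)]
      rep_abs_L2[OF square_integrable_add[OF assms]] rep_plus[of "abs_L2 f" "abs_L2 g"]
    by eventually_elim simp
qed

lemma abs_L2_cmult: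
  assumes "square_integrable f"
  shows "abs_L2 (\<lambda>t. c * f t) = c *\<^sub>R abs_L2 f"
proof (rule l2_eqI)
  show "AE t in unit_borel. rep_L2 (abs_L2 (\<lambda>t. c * f t)) t = rep_L2 (c *\<^sub>R abs_L2 f) t"
    using rep_abs_L2[OF assms] rep_abs_L2[OF square_integrable_cmult[OF assms, of c]]
      rep_scaleR[of c "abs_L2 f"]
    by eventually_elim simp
qed

lemma abs_L2_dominated_convergence:
  assumes w: "square_integrable w"
    and s [measurable]: "\<And>i. s i \<in> borel_measurable unit_borel"
    and bound: "\<And>i t. t \<in> {0..1} \<Longrightarrow> \<bar>s i t\<bar> \<le> w t"
    and lim: "\<And>t. t \<in> {0..1} \<Longrightarrow> (\<lambda>i. s i t) \<longlonglongrightarrow> f t"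
  shows "(\<lambda>i. abs_L2 (s i)) \<longlonglongrightarrow> abs_L2 f"
proof -
  have f [measurable]: "f \<in> borel_measurable unit_borel"
    using lim by (intro borel_measurable_LIMSEQ_real[OF _ s]) (simp add: space_unit_borel)
  have fbound: "\<bar>f t\<bar> \<le> w t" if "t \<in> {0..1}" for t
    using bound[OF that] lim[OF that]
    by (intro Lim_bounded[OF tendsto_rabs[OF lim[OF that]], of 0 "w t"]) auto
  have sq: "square_integrable h"
    if [measurable]: "h \<in> borel_measurable unit_borel"
      and "\<And>t. t \<in> {0..1} \<Longrightarrow> \<bar>h t\<bar> \<le> w t" for h
    unfolding square_integrable_def
  proof
    show "integrable unit_borel (\<lambda>t. (h t)\<^sup>2)"
    proof (rule Bochner_Integration.integrable_bound)
      show "integrable unit_borel (\<lambda>t. (w t)\<^sup>2)"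
        using w by (simp add: square_integrable_def)
      show "AE t in unit_borel. norm ((h t)\<^sup>2) \<le> norm ((w t)\<^sup>2)"
      proof (rule AE_I2)
        fix t assume "t \<in> space unit_borel"
        from that(2)[of t] this show "norm ((h t)\<^sup>2) \<le> norm ((w t)\<^sup>2)"
          using power_mono[of "\<bar>h t\<bar>" "w t" 2] by (simp add: space_unit_borel)
      qed
    qed measurable
  qed fact
  have sqs: "square_integrable (s i)" for i
    using bound by (intro sq) auto
  have sqf: "square_integrable f"
    using fbound by (intro sq) auto
  have "(\<lambda>i. \<integral>t. (s i t - f t)\<^sup>2 \<partial>unit_borel) \<longlonglongrightarrow> (\<integral>t. 0 \<partial>unit_borel)"
  proof (rule integral_dominated_convergence)
    show "integrable unit_borel (\<lambda>t. 4 * (w t)\<^sup>2)"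
      using w by (simp add: square_integrable_def)
    show "AE t in unit_borel. (\<lambda>i. (s i t - f t)\<^sup>2) \<longlonglongrightarrow> 0"
    proof (rule AE_I2)
      fix t assume "t \<in> space unit_borel"
      then have "(\<lambda>i. (s i t - f t)\<^sup>2) \<longlonglongrightarrow> (f t - f t)\<^sup>2"
        by (intro tendsto_intros lim) (simp add: space_unit_borel)
      then show "(\<lambda>i. (s i t - f t)\<^sup>2) \<longlonglongrightarrow> 0" by simp
    qed
    show "AE t in unit_borel. norm ((s i t - f t)\<^sup>2) \<le> 4 * (w t)\<^sup>2" for i
    proof (rule AE_I2)
      fix t assume "t \<in> space unit_borel"
      then have "\<bar>s i t - f t\<bar> \<le> 2 * w t"
        using bound[of t i] fbound[of t] by (auto simp: space_unit_borel)
      from power_mono[OF this, of 2] show "norm ((s i t - f t)\<^sup>2) \<le> 4 * (w t)\<^sup>2"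
        by (simp add: power_mult_distrib)
    qed
  qed measurable
  moreover have "(\<integral>t. (s i t - f t)\<^sup>2 \<partial>unit_borel) = (dist (abs_L2 (s i)) (abs_L2 f))\<^sup>2" for i
  proof -
    have "ennreal (\<integral>t. (s i t - f t)\<^sup>2 \<partial>unit_borel) = (\<integral>\<^sup>+t. (s i t - f t)\<^sup>2 \<partial>unit_borel)"
      using square_integrable_diff[OF sqs sqf]
      by (intro nn_integral_eq_integral[symmetric]) (auto simp: square_integrable_def)
    also have "\<dots> = (\<integral>\<^sup>+t. (rep_L2 (abs_L2 (s i)) t - rep_L2 (abs_L2 f) t)\<^sup>2 \<partial>unit_borel)"
    proof (rule nn_integral_cong_AE)
      show "AE t in unit_borel. ennreal ((s i t - f t)\<^sup>2)
          = ennreal ((rep_L2 (abs_L2 (s i)) t - rep_L2 (abs_L2 f) t)\<^sup>2)"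
        using rep_abs_L2[OF sqs[of i]] rep_abs_L2[OF sqf] by eventually_elim simp
    qed
    finally show ?thesis
      by (simp add: nn_integral_diff_L2)
  qed
  ultimately have "(\<lambda>i. sqrt ((dist (abs_L2 (s i)) (abs_L2 f))\<^sup>2)) \<longlonglongrightarrow> sqrt 0"
    by (intro tendsto_real_sqrt) simp
  then show ?thesis
    by (simp add: tendsto_dist_iff[of _ "abs_L2 f"])
qed

definition step_L2 :: "real \<Rightarrow> L2" where
  "step_L2 a = abs_L2 (indicator {..a})"

definition rat_steps :: "L2 set" where
  "rat_steps = range (\<lambda>xs :: (rat \<times> rat) list.
     \<Sum>(c, q)\<leftarrow>xs. of_rat c *\<^sub>R step_L2 (of_rat q))"

lemma countable_rat_steps: "countable rat_steps"
  unfolding rat_steps_def by simp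

lemma square_integrable_indicator:
  assumes "A \<in> sets borel"
  shows "square_integrable (indicator A)"
proof (rule square_integrable_bounded)
  show "indicator A \<in> borel_measurable unit_borel"
    using assms unfolding unit_borel_def
    by (intro measurable_restrict_space1) auto
qed (auto simp: indicator_def)

lemma rat_steps_add: "x \<in> rat_steps \<Longrightarrow> y \<in> rat_steps \<Longrightarrow> x + y \<in> rat_steps"
  unfolding rat_steps_def
proof (elim rangeE)
  fix xs ys :: "(rat \<times> rat) list"
  let ?f = "\<lambda>xs. \<Sum>(c, q)\<leftarrow>xs. of_rat c *\<^sub>R step_L2 (of_rat q)"
  assume "x = ?f xs" "y = ?f ys"
  then have "x + y = ?f (xs @ ys)" by simp
  then show "x + y \<in> range ?f" by blast
qed

lemma rat_steps_scaleR: "x \<in> rat_steps \<Longrightarrow> of_rat c *\<^sub>R x \<in> rat_steps"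
  unfolding rat_steps_def
proof (elim rangeE)
  fix xs :: "(rat \<times> rat) list"
  let ?f = "\<lambda>xs. \<Sum>(c, q)\<leftarrow>xs. of_rat c *\<^sub>R step_L2 (of_rat q)"
  have "of_rat c *\<^sub>R ?f xs = ?f (map (\<lambda>(d, q). (c * d, q)) xs)"
    by (induction xs) (auto simp: scaleR_add_right of_rat_mult)
  moreover assume "x = ?f xs"
  ultimately show "of_rat c *\<^sub>R x \<in> range ?f" by blast
qed

lemma closure_rat_stepsI:
  assumes "\<And>n. f n \<in> rat_steps" "f \<longlonglongrightarrow> x"
  shows "x \<in> closure rat_steps"
  unfolding closure_sequential using assms by (intro exI[of _ f] conjI allI)

lemma closure_rat_steps_add:
  assumes "x \<in> closure rat_steps" "y \<in> closure rat_steps"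
  shows "x + y \<in> closure rat_steps"
proof -
  obtain f g where "\<And>n. f n \<in> rat_steps" "f \<longlonglongrightarrow> x" "\<And>n. g n \<in> rat_steps" "g \<longlonglongrightarrow> y"
    using assms unfolding closure_sequential by blast
  then show ?thesis
    by (intro closure_rat_stepsI[of "\<lambda>n. f n + g n"] tendsto_add rat_steps_add)
qed

lemma rat_sequence_above:
  "\<exists>q :: nat \<Rightarrow> rat. (\<forall>n. a < of_rat (q n)) \<and> (\<lambda>n. of_rat (q n)) \<longlonglongrightarrow> (a :: real)"
proof -
  have "\<forall>n. \<exists>q. a < of_rat q \<and> of_rat q < a + 1 / real (Suc n)"
    by (intro allI of_rat_dense) simp
  then obtain q where q: "\<And>n. a < of_rat (q n)" "\<And>n. of_rat (q n) < a + 1 / real (Suc n)"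
    by metis
  have "(\<lambda>n. of_rat (q n)) \<longlonglongrightarrow> a"
  proof (rule tendsto_sandwich)
    show "(\<lambda>n. a) \<longlonglongrightarrow> a" by simp
    show "(\<lambda>n. a + 1 / real (Suc n)) \<longlonglongrightarrow> a"
      using tendsto_add[OF tendsto_const LIMSEQ_inverse_real_of_nat, of a]
      by (simp add: inverse_eq_divide)
  qed (use q in \<open>auto intro!: always_eventually less_imp_le simp del: of_nat_Suc\<close>)
  with q(1) show ?thesis by (intro exI[of _ q] conjI allI)
qed

lemma closure_rat_steps_scaleR:
  assumes "x \<in> closure rat_steps"
  shows "c *\<^sub>R x \<in> closure rat_steps"
proof -
  obtain f where "\<And>n. f n \<in> rat_steps" "f \<longlonglongrightarrow> x"
    using assms unfolding closure_sequential by blast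
  moreover obtain q where "(\<lambda>n. of_rat (q n)) \<longlonglongrightarrow> c"
    using rat_sequence_above[of c] by metis
  ultimately show ?thesis
    by (intro closure_rat_stepsI[of "\<lambda>n. of_rat (q n) *\<^sub>R f n"] tendsto_scaleR rat_steps_scaleR)
qed

lemma closure_rat_steps_limit:
  assumes "\<And>n. f n \<in> closure rat_steps" "f \<longlonglongrightarrow> x"
  shows "x \<in> closure rat_steps"
  by (rule closed_sequentially[OF closed_closure assms])

lemma closure_rat_steps_step: "step_L2 a \<in> closure rat_steps"
proof -
  obtain q where q: "\<And>n. a < of_rat (q n)" "(\<lambda>n. of_rat (q n)) \<longlonglongrightarrow> a"
    using rat_sequence_above[of a] by metis
  have mem: "step_L2 (of_rat p) \<in> closure rat_steps" for p
  proof -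
    have "step_L2 (of_rat p) = (\<Sum>(c, q)\<leftarrow>[(1, p)]. of_rat c *\<^sub>R step_L2 (of_rat q))"
      by simp
    then have "step_L2 (of_rat p) \<in> rat_steps" unfolding rat_steps_def by blast
    then show ?thesis using closure_subset by blast
  qed
  have "(\<lambda>n. abs_L2 (indicator {..of_rat (q n)})) \<longlonglongrightarrow> abs_L2 (indicator {..a})"
  proof (rule abs_L2_dominated_convergence[where w = "\<lambda>_. 1"])
    show "square_integrable (\<lambda>_. 1)" by (rule square_integrable_bounded[where B = 1]) auto
    show "(indicator {..real_of_rat (q n)} :: real \<Rightarrow> real) \<in> borel_measurable unit_borel" for n
      using square_integrable_indicator[of "{..real_of_rat (q n)}"]
      by (simp add: square_integrable_def)
    show "(\<lambda>n. indicator {..real_of_rat (q n)} t) \<longlonglongrightarrow> (indicator {..a} t :: real)" for t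
    proof (cases "t \<le> a")
      case True
      then have "t \<le> real_of_rat (q n)" for n using q(1)[of n] by simp
      then show ?thesis using True by simp
    next
      case False
      then have "eventually (\<lambda>n. real_of_rat (q n) < t) sequentially"
        using q(2) by (intro order_tendstoD) auto
      then have "eventually (\<lambda>n. indicator {..real_of_rat (q n)} t = (0 :: real)) sequentially"
        by eventually_elim simp
      then show ?thesis using False by (simp add: tendsto_eventually)
    qed
  qed (auto simp: indicator_def)
  then show ?thesis
    using mem unfolding step_L2_def[symmetric] by (rule closure_rat_steps_limit[rotated])
qed

lemma closure_rat_steps_indicator:
  assumes "A \<in> sets borel"
  shows "abs_L2 (indicator A) \<in> closure rat_steps"
proof -
  have sigma: "sets borel = sigma_sets UNIV (range (\<lambda>a::real. {..a}))"
    unfolding borel_eq_atMost by (rule sets_measure_of) simp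
  have zero: "0 \<in> closure rat_steps"
    using closure_rat_steps_scaleR[OF closure_rat_steps_step, of 0] by simp
  have "Int_stable (range (\<lambda>a::real. {..a}))"
    by (auto simp: Int_stable_def)
  moreover have "range (\<lambda>a::real. {..a}) \<subseteq> Pow UNIV" by simp
  moreover have "A \<in> sigma_sets UNIV (range (\<lambda>a::real. {..a}))"
    using assms by (simp add: sigma)
  ultimately show ?thesis
  proof (induction rule: sigma_sets_induct_disjoint)
    case (basic A)
    then show ?case using closure_rat_steps_step by (auto simp: step_L2_def)
  next
    case empty
    have "indicator {} = (\<lambda>t::real. 0 :: real)" by auto
    then show ?case using zero by (simp flip: zero_L2_def)
  next
    case (compl A)
    then have sq: "square_integrable (indicator A)" "square_integrable (indicator (UNIV - A))"
      by (auto intro!: square_integrable_indicator simp: sigma sigma_sets.Compl)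
    have one: "AE t in unit_borel. rep_L2 (step_L2 1) t = indicator {..1} t"
      unfolding step_L2_def by (intro rep_abs_L2 square_integrable_indicator) simp
    have "abs_L2 (indicator (UNIV - A)) = step_L2 1 + (-1) *\<^sub>R abs_L2 (indicator A)"
    proof (rule l2_eqI)
      have "AE t in unit_borel. t \<in> {0..1}"
        by (rule AE_I2) (simp add: space_unit_borel)
      then show "AE t in unit_borel. rep_L2 (abs_L2 (indicator (UNIV - A))) t
          = rep_L2 (step_L2 1 + (-1) *\<^sub>R abs_L2 (indicator A)) t"
        using rep_abs_L2[OF sq(1)] rep_abs_L2[OF sq(2)]
          one
          rep_plus[of "step_L2 1" "(-1) *\<^sub>R abs_L2 (indicator A)"]
          rep_scaleR[of "-1" "abs_L2 (indicator A)"]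
        by eventually_elim (auto simp: indicator_def)
    qed
    then show ?case
      using compl.IH by (simp only: closure_rat_steps_add closure_rat_steps_scaleR closure_rat_steps_step)
  next
    case (union A)
    have meas: "A i \<in> sets borel" for i using union(2) by (auto simp: sigma)
    have "abs_L2 (indicator (\<Union>i<n. A i)) \<in> closure rat_steps" for n
    proof (induction n)
      case 0
      have "indicator {} = (\<lambda>t::real. 0 :: real)" by auto
      then show ?case using zero by (simp flip: zero_L2_def)
    next
      case (Suc n)
      have "A i \<inter> A n = {}" if "i < n" for i
        using that by (intro disjoint_family_onD[OF union(1)]) auto
      then have "(\<Union>i<n. A i) \<inter> A n = {}" by blast
      then have "indicator (\<Union>i<Suc n. A i) = (\<lambda>t. indicator (\<Union>i<n. A i) t + indicator (A n) t :: real)"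
        by (intro ext) (auto simp: indicator_def less_Suc_eq)
      then have "abs_L2 (indicator (\<Union>i<Suc n. A i))
          = abs_L2 (indicator (\<Union>i<n. A i)) + abs_L2 (indicator (A n))"
        using meas by (simp add: abs_L2_add square_integrable_indicator)
      then show ?case using Suc.IH union(3)[of n] closure_rat_steps_add by simp
    qed
    moreover have "(\<lambda>n. abs_L2 (indicator (\<Union>i<n. A i))) \<longlonglongrightarrow> abs_L2 (indicator (\<Union>i. A i))"
    proof (rule abs_L2_dominated_convergence[where w = "\<lambda>_. 1"])
      show "square_integrable (\<lambda>_. 1)" by (rule square_integrable_bounded[where B = 1]) auto
      show "(indicator (\<Union>i<n. A i) :: real \<Rightarrow> real) \<in> borel_measurable unit_borel" for n
        using square_integrable_indicator[of "\<Union>i<n. A i"] meas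
        by (auto simp: square_integrable_def)
      show "(\<lambda>n. indicator (\<Union>i<n. A i) t) \<longlonglongrightarrow> (indicator (\<Union>i. A i) t :: real)" for t
        by (rule LIMSEQ_indicator_UN)
    qed (simp add: indicator_def)
    ultimately show ?case by (rule closure_rat_steps_limit)
  qed
qed

lemma closure_rat_steps: "closure rat_steps = UNIV"
proof (intro equalityI subset_UNIV subsetI)
  fix x :: L2
  have seq: "\<exists>s. (\<forall>i. simple_function unit_borel (s i)) \<and>
      (\<forall>t\<in>{0..1}. (\<lambda>i. s i t) \<longlonglongrightarrow> rep_L2 x t) \<and>
      (\<forall>i. \<forall>t\<in>{0..1}. \<bar>s i t\<bar> \<le> 2 * \<bar>rep_L2 x t\<bar>)"
    using borel_measurable_implies_sequence_metric[OF rep_L2_measurable, of x 0]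
    by (simp only: space_unit_borel dist_real_def diff_0_right)
  obtain s where simple: "\<And>i. simple_function unit_borel (s i)"
    and lim: "\<And>t. t \<in> {0..1} \<Longrightarrow> (\<lambda>i. s i t) \<longlonglongrightarrow> rep_L2 x t"
    and bound: "\<And>i t. t \<in> {0..1} \<Longrightarrow> \<bar>s i t\<bar> \<le> 2 * \<bar>rep_L2 x t\<bar>"
    using seq by blast
  have sum: "square_integrable (\<lambda>t. \<Sum>y\<in>F. indicator (A y) t * y) \<and>
      abs_L2 (\<lambda>t. \<Sum>y\<in>F. indicator (A y) t * y) \<in> closure rat_steps"
    if "finite F" "\<And>y. A y \<in> sets borel" for F :: "real set" and A
    using that(1)
  proof (induction F)
    case empty
    have "0 \<in> closure rat_steps"
      using closure_rat_steps_scaleR[OF closure_rat_steps_step, of 0] by simp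
    then show ?case by (simp add: square_integrable_zero flip: zero_L2_def)
  next
    case (insert y F)
    have sq: "square_integrable (\<lambda>t. y * indicator (A y) t)"
      by (intro square_integrable_cmult square_integrable_indicator that)
    have "abs_L2 (\<lambda>t. y * indicator (A y) t) \<in> closure rat_steps"
      unfolding abs_L2_cmult[OF square_integrable_indicator[OF that(2)]]
      by (intro closure_rat_steps_scaleR closure_rat_steps_indicator that)
    moreover have "(\<lambda>t. \<Sum>y\<in>insert y F. indicator (A y) t * y)
        = (\<lambda>t. y * indicator (A y) t + (\<Sum>y\<in>F. indicator (A y) t * y))"
      by (rule ext) (simp only: sum.insert[OF insert.hyps] mult.commute[of _ y])
    ultimately show ?case
      using insert.IH sq
      by (simp only: abs_L2_add closure_rat_steps_add square_integrable_add simp_thms)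
  qed
  have "abs_L2 (s i) \<in> closure rat_steps" for i
  proof -
    let ?A = "\<lambda>y. s i -` {y} \<inter> {0..1}"
    let ?S = "\<lambda>t. \<Sum>y\<in>s i ` {0..1}. indicator (?A y) t * y"
    have "?A y \<in> sets unit_borel" for y
      using simple_functionD(2)[OF simple, of i "{y}"] by (simp add: space_unit_borel)
    then have A: "?A y \<in> sets borel" for y
      unfolding unit_borel_def by (subst (asm) sets_restrict_space_iff) auto
    have "finite (s i ` {0..1})"
      using simple_functionD(1)[OF simple, of i] by (simp add: space_unit_borel)
    note S = sum[OF this, of ?A, OF A]
    have eq: "s i t = ?S t" if "t \<in> {0..1}" for t
      using simple_function_indicator_representation_banach[OF simple, of t i] that
      by (simp only: space_unit_borel real_scaleR_def)
    have "(\<lambda>n::nat. abs_L2 ?S) \<longlonglongrightarrow> abs_L2 (s i)"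
    proof (rule abs_L2_dominated_convergence)
      show "square_integrable (\<lambda>t. 2 * \<bar>rep_L2 x t\<bar>)"
        using square_integrable_cmult[OF square_integrable_rep[of x], of 2]
        by (auto simp: square_integrable_def power_mult_distrib)
      show "?S \<in> borel_measurable unit_borel"
        using S unfolding square_integrable_def by blast
      show "\<bar>?S t\<bar> \<le> 2 * \<bar>rep_L2 x t\<bar>" if "t \<in> {0..1}" for t
        unfolding eq[OF that, symmetric] by (rule bound[OF that])
      show "(\<lambda>n::nat. ?S t) \<longlonglongrightarrow> s i t" if "t \<in> {0..1}" for t
        unfolding eq[OF that] by (rule tendsto_const)
    qed
    then have "abs_L2 ?S = abs_L2 (s i)" by (rule LIMSEQ_unique[OF tendsto_const])
    with S show ?thesis by (simp only:)
  qed
  moreover have "(\<lambda>i. abs_L2 (s i)) \<longlonglongrightarrow> abs_L2 (rep_L2 x)"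
  proof (rule abs_L2_dominated_convergence[OF _ _ bound lim])
    show "square_integrable (\<lambda>t. 2 * \<bar>rep_L2 x t\<bar>)"
      using square_integrable_cmult[OF square_integrable_rep[of x], of 2]
      by (auto simp: square_integrable_def power_mult_distrib)
    show "s i \<in> borel_measurable unit_borel" for i
      by (rule borel_measurable_simple_function[OF simple])
  qed
  ultimately show "x \<in> closure rat_steps"
    unfolding abs_rep_L2 by (rule closure_rat_steps_limit)
qed

instance L2 :: second_countable_topology
proof
  let ?B = "(\<lambda>(d, q). ball d (of_rat q)) ` (rat_steps \<times> (UNIV :: rat set))"
  have "topological_basis ?B"
  proof (rule topological_basisI)
    fix U and x :: L2 assume "open U" "x \<in> U"
    then obtain e where e: "0 < e" "ball x e \<subseteq> U" by (auto simp: open_contains_ball)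
    obtain q where q: "0 < real_of_rat q" "real_of_rat q < e / 2"
      using of_rat_dense[of 0 "e / 2"] e(1) by auto
    have "x \<in> closure rat_steps" by (simp add: closure_rat_steps)
    then obtain d where d: "d \<in> rat_steps" "dist d x < of_rat q"
      using q(1) unfolding closure_approachable by blast
    have "ball d (of_rat q) \<subseteq> ball x e"
    proof
      fix y assume "y \<in> ball d (of_rat q)"
      then show "y \<in> ball x e"
        using d(2) q(2) dist_triangle[of x y d] by (simp add: dist_commute)
    qed
    with e(2) d show "\<exists>B'\<in>?B. x \<in> B' \<and> B' \<subseteq> U"
      by (intro bexI[of _ "ball d (of_rat q)"]) auto
  qed auto
  moreover have "countable ?B" by (intro countable_image countable_SIGMA countable_rat_steps) auto
  ultimately show "\<exists>B :: L2 set set. countable B \<and> open = generate_topology B"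
    using topological_basis_imp_subbasis by blast
qed


text \<open>
  Kernels are functions of two variables, with the argument of the output function first.
  For a Hilbert-Schmidt kernel the inner integral below exists for almost every \<open>t\<close> and is
  square integrable in \<open>t\<close>; neither value depends on the representatives chosen by \<open>rep_L2\<close>.
\<close>

definition hilbert_schmidt_kernel :: "(real \<Rightarrow> real \<Rightarrow> real) \<Rightarrow> bool" where
  "hilbert_schmidt_kernel \<psi> \<longleftrightarrow>
     (\<lambda>(t, s). \<psi> t s) \<in> borel_measurable (unit_borel \<Otimes>\<^sub>M unit_borel) \<and>
     integrable (unit_borel \<Otimes>\<^sub>M unit_borel) (\<lambda>(t, s). (\<psi> t s)\<^sup>2)"

definition integral_operator :: "(real \<Rightarrow> real \<Rightarrow> real) \<Rightarrow> L2 \<Rightarrow> L2" where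
  "integral_operator \<psi> x = abs_L2 (\<lambda>t. \<integral>s. \<psi> t s * rep_L2 x s \<partial>unit_borel)"

definition tensor :: "L2 \<Rightarrow> L2 \<Rightarrow> L2 \<Rightarrow> L2" where
  "tensor y z x = inner y x *\<^sub>R z"

definition mean_zero :: "'w measure \<Rightarrow> ('w \<Rightarrow> L2) \<Rightarrow> bool" where
  "mean_zero M W \<longleftrightarrow> integrable M W \<and> (\<integral>\<omega>. W \<omega> \<partial>M) = 0"

text \<open>The operator-valued expectation of \<open>W \<otimes> W\<close>, evaluated pointwise.\<close>

definition covariance_operator :: "'w measure \<Rightarrow> ('w \<Rightarrow> L2) \<Rightarrow> L2 \<Rightarrow> L2" where
  "covariance_operator M W x = (\<integral>\<omega>. tensor (W \<omega>) (W \<omega>) x \<partial>M)"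

definition sample_covariance :: "nat \<Rightarrow> (nat \<Rightarrow> L2) \<Rightarrow> L2 \<Rightarrow> L2" where
  "sample_covariance N x z = (1 / real N) *\<^sub>R (\<Sum>i=1..N. tensor (x i) (x i) z)"

text \<open>
  Sequences of eigenvalues and eigenfunctions are indexed from 1 on; the values at index 0
  are irrelevant. The eigenfunctions form a complete orthonormal system, so that all
  eigenvalues are listed with multiplicity, the eigenvalue 0 included. In particular, if all
  \<open>lam j\<close> are positive then \<open>T\<close> is injective.
\<close>

definition eigensystem :: "(L2 \<Rightarrow> L2) \<Rightarrow> (nat \<Rightarrow> real) \<Rightarrow> (nat \<Rightarrow> L2) \<Rightarrow> bool" where
  "eigensystem T lam v \<longleftrightarrow>
     (\<forall>i\<ge>1. \<forall>j\<ge>1. inner (v i) (v j) = (if i = j then 1 else 0)) \<and>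
     closure (span (v ` {1..})) = UNIV \<and>
     (\<forall>j\<ge>1. T (v j) = lam j *\<^sub>R v j) \<and>
     (\<forall>j\<ge>1. lam (j + 1) \<le> lam j)"

definition eigengap :: "(nat \<Rightarrow> real) \<Rightarrow> nat \<Rightarrow> real" where
  "eigengap lam j =
     (if j = 1 then lam 1 - lam 2 else min (lam j - lam (j + 1)) (lam (j - 1) - lam j))"

definition iid_sequence :: "'w measure \<Rightarrow> (nat \<Rightarrow> 'w \<Rightarrow> L2) \<Rightarrow> bool" where
  "iid_sequence M X \<longleftrightarrow>
     prob_space.indep_vars M (\<lambda>_. borel) X {1..} \<and>
     (\<forall>i\<ge>1. distr M borel (X i) = distr M borel (X 1))"

definition independent_sequences ::
    "'w measure \<Rightarrow> (nat \<Rightarrow> 'w \<Rightarrow> L2) \<Rightarrow> (nat \<Rightarrow> 'w \<Rightarrow> L2) \<Rightarrow> bool" where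
  "independent_sequences M X Z \<longleftrightarrow>
     prob_space.indep_var M
       (\<Pi>\<^sub>M i\<in>{1..}. borel) (\<lambda>\<omega>. \<lambda>i\<in>{1..}. X i \<omega>)
       (\<Pi>\<^sub>M i\<in>{1..}. borel) (\<lambda>\<omega>. \<lambda>i\<in>{1..}. Z i \<omega>)"

definition slowly_varying :: "(real \<Rightarrow> real) \<Rightarrow> bool" where
  "slowly_varying l \<longleftrightarrow> (\<forall>c>0. ((\<lambda>u. l (c * u) / l u) \<longlongrightarrow> 1) at_top)"

definition weakly_converges ::
    "('i \<Rightarrow> 'a::topological_space measure) \<Rightarrow> 'a measure \<Rightarrow> 'i filter \<Rightarrow> bool" where
  "weakly_converges \<mu> \<Gamma> F \<longleftrightarrow>
     (\<forall>f :: 'a \<Rightarrow> real. continuous_on UNIV f \<and> bounded (range f) \<longrightarrow>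
        ((\<lambda>u. \<integral>x. f x \<partial>\<mu> u) \<longlongrightarrow> (\<integral>x. f x \<partial>\<Gamma>)) F)"

text \<open>
  Laws on the unit sphere are represented as Borel measures on the whole space that give the
  (closed) sphere full mass; weak convergence means the same for both.
\<close>

definition angular_law :: "'w measure \<Rightarrow> ('w \<Rightarrow> L2) \<Rightarrow> real \<Rightarrow> L2 measure" where
  "angular_law M W u =
     distr (uniform_measure M {\<omega>\<in>space M. norm (W \<omega>) > u}) borel (\<lambda>\<omega>. W \<omega> /\<^sub>R norm (W \<omega>))"

definition regularly_varying :: "'w measure \<Rightarrow> real \<Rightarrow> ('w \<Rightarrow> L2) \<Rightarrow> bool" where
  "regularly_varying M \<alpha> W \<longleftrightarrow>
     W \<in> borel_measurable M \<and>
     (\<exists>l. slowly_varying l \<and>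
        (\<forall>u>0. measure M {\<omega>\<in>space M. norm (W \<omega>) > u} = u powr (-\<alpha>) * l u)) \<and>
     (\<exists>\<Gamma>. prob_space \<Gamma> \<and> sets \<Gamma> = sets borel \<and> emeasure \<Gamma> (sphere 0 1) = 1 \<and>
        weakly_converges (angular_law M W) \<Gamma> at_top)"

definition condition_RV :: "'w measure \<Rightarrow> real \<Rightarrow> ('w \<Rightarrow> L2) \<Rightarrow> bool" where
  "condition_RV M \<alpha> W \<longleftrightarrow> mean_zero M W \<and> regularly_varying M \<alpha> W"

text \<open>Here \<open>w\<close> is meant to be the sequence of eigenfunctions of the covariance operator of \<open>W\<close>.\<close>

definition tail_energy :: "(nat \<Rightarrow> L2) \<Rightarrow> L2 \<Rightarrow> nat \<Rightarrow> real" where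
  "tail_energy w x n = (\<Sum>\<^sub>\<infinity>j\<in>{n..}. (inner x (w j))\<^sup>2)"

definition condition_Q :: "'w measure \<Rightarrow> ('w \<Rightarrow> L2) \<Rightarrow> (nat \<Rightarrow> L2) \<Rightarrow> bool" where
  "condition_Q M W w \<longleftrightarrow>
     (\<forall>n\<ge>1. \<forall>m\<ge>1. \<exists>c>0.
        ((\<lambda>u. measure M {\<omega>\<in>space M. sqrt (tail_energy w (W \<omega>) n) * sqrt (tail_energy w (W \<omega>) m) > u} /
              measure M {\<omega>\<in>space M. tail_energy w (W \<omega>) 1 > u}) \<longlongrightarrow> c) at_top)"

definition sample_cross_coefficient ::
    "nat \<Rightarrow> (nat \<Rightarrow> L2) \<Rightarrow> (nat \<Rightarrow> L2) \<Rightarrow> L2 \<Rightarrow> L2 \<Rightarrow> real" where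
  "sample_cross_coefficient N x y v u = (1 / real N) * (\<Sum>i=1..N. inner (x i) v * inner (y i) u)"

definition estimated_kernel ::
    "nat \<Rightarrow> nat \<Rightarrow> nat \<Rightarrow> (nat \<Rightarrow> L2) \<Rightarrow> (nat \<Rightarrow> L2) \<Rightarrow> (nat \<Rightarrow> real) \<Rightarrow> (nat \<Rightarrow> L2) \<Rightarrow> (nat \<Rightarrow> L2) \<Rightarrow>
      real \<Rightarrow> real \<Rightarrow> real" where
  "estimated_kernel K L N x y lamh vh uh t s =
     (\<Sum>k=1..K. \<Sum>l=1..L. sample_cross_coefficient N x y (vh l) (uh k) / lamh l
        * rep_L2 (uh k) t * rep_L2 (vh l) s)"

end

theory Submission
  imports Defs
begin

text \<open>
  Let \<open>S\<close> be the sample covariance operator of \<open>X\<close>, let \<open>P\<close> and \<open>Q\<close> be the orthogonal projections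
  onto the spans of the first \<open>L\<close> sample eigenfunctions of \<open>X\<close> and of the first \<open>K\<close> sample
  eigenfunctions of \<open>Y\<close>, and let \<open>R\<close> be the inverse of \<open>S\<close> on the range of \<open>P\<close>, extended by 0 to
  the orthogonal complement. The estimator is \<open>Q D R\<close>, where \<open>D\<close> is the empirical cross covariance
  operator, which maps \<open>z\<close> to the mean of \<open>\<langle>X i, z\<rangle> Y i\<close>. The regression equation gives
  \<open>D = \<Psi> S + E\<close>, where \<open>E z\<close> is the mean of \<open>\<langle>X i, z\<rangle> \<epsilon> i\<close>, and \<open>S R = P\<close>. Therefore

  \<open>Q D R - \<Psi> = Q E R - Q \<Psi> (1 - P) - (1 - Q) \<Psi>\<close>.

  \<^emph>\<open>The noise term.\<close> The norm of \<open>R\<close> is the inverse of the \<open>L\<close>-th sample eigenvalue of \<open>X\<close>. A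
  random operator such as \<open>z \<mapsto> \<langle>X i, z\<rangle> \<epsilon> i\<close> is a random vector for the Hilbert-Schmidt norm, and its
  norm \<open>\<parallel>X i\<parallel> \<parallel>\<epsilon> i\<parallel>\<close> has a moment of some order \<open>p\<close> above \<open>\<gamma>\<close>. The strong law of Marcinkiewicz and
  Zygmund (\<open>marcinkiewicz_zygmund\<close>, \<open>empirical_operator_rate\<close>) therefore bounds \<open>\<parallel>E\<parallel>\<close> and the distance
  from \<open>S\<close> to its expectation by \<open>o(N powr (1 / \<gamma> - 1))\<close>. By the growth condition on \<open>sqrt K\<close> this is
  \<open>o(lam L)\<close>, so Weyl's inequality (\<open>weyl\<close>) makes the \<open>L\<close>-th sample eigenvalue at least
  \<open>lam L / 2\<close>, and \<open>\<parallel>E\<parallel> \<parallel>R\<parallel> \<rightarrow> 0\<close>.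

  \<^emph>\<open>The truncation terms.\<close> The projection \<open>P\<close> commutes with \<open>S\<close>, and \<open>S\<close> is at most its next
  eigenvalue on the range of \<open>1 - P\<close>, whereas a fixed eigenfunction of the covariance of \<open>X\<close> is almost
  an eigenfunction of \<open>S\<close> for a strictly larger value. Hence \<open>1 - P\<close> tends to 0 on every such
  eigenfunction, thus pointwise (\<open>residual_tendsto_zero\<close>); the same holds for \<open>1 - Q\<close>. Composition
  with a Hilbert-Schmidt operator turns pointwise convergence into convergence in norm
  (\<open>uniformly_null_on_hilbert_schmidt\<close>), which applies to \<open>(1 - Q) \<Psi>\<close> and to the adjoint of
  \<open>\<Psi> (1 - P)\<close>.
\<close>

section \<open>Orthonormal sequences and perturbation of eigenvalues\<close>

text \<open>
  Sequences are indexed from 1 on, as in \<^const>\<open>eigensystem\<close>; the value at 0 is arbitrary.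
\<close>

definition orthonormal :: "(nat \<Rightarrow> 'a::real_inner) \<Rightarrow> bool" where
  "orthonormal e \<longleftrightarrow> (\<forall>i\<ge>1. \<forall>j\<ge>1. inner (e i) (e j) = (if i = j then 1 else 0))"

definition complete_orthonormal :: "(nat \<Rightarrow> 'a::real_inner) \<Rightarrow> bool" where
  "complete_orthonormal e \<longleftrightarrow> orthonormal e \<and> closure (span (e ` {1..})) = UNIV"

definition proj :: "(nat \<Rightarrow> 'a::real_inner) \<Rightarrow> nat \<Rightarrow> 'a \<Rightarrow> 'a" where
  "proj e n x = (\<Sum>j=1..n. inner x (e j) *\<^sub>R e j)"

lemma inner_sum_orthonormal:
  assumes "orthonormal e" "finite F" "F \<subseteq> {1..}" "1 \<le> i"
  shows "inner (\<Sum>j\<in>F. c j *\<^sub>R e j) (e i) = (if i \<in> F then c i else 0)"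
proof -
  have "inner (\<Sum>j\<in>F. c j *\<^sub>R e j) (e i) = (\<Sum>j\<in>F. if i = j then c j else 0)"
    unfolding inner_sum_left
  proof (rule sum.cong)
    fix j assume "j \<in> F"
    then have "1 \<le> j" using assms(3) by auto
    then show "inner (c j *\<^sub>R e j) (e i) = (if i = j then c j else 0)"
      using assms(1,4) unfolding orthonormal_def by auto
  qed simp
  then show ?thesis using assms(2) by (simp add: sum.delta)
qed

lemma norm_sum_orthonormal:
  assumes "orthonormal e" "finite F" "F \<subseteq> {1..}"
  shows "(norm (\<Sum>j\<in>F. c j *\<^sub>R e j))\<^sup>2 = (\<Sum>j\<in>F. (c j)\<^sup>2)"
proof -
  have "inner s (\<Sum>j\<in>F. c j *\<^sub>R e j) = (\<Sum>i\<in>F. c i * inner s (e i))" for s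
    by (simp add: inner_sum_right)
  then have "(norm (\<Sum>j\<in>F. c j *\<^sub>R e j))\<^sup>2 = (\<Sum>i\<in>F. c i * inner (\<Sum>j\<in>F. c j *\<^sub>R e j) (e i))"
    unfolding power2_norm_eq_inner .
  also have "\<dots> = (\<Sum>i\<in>F. (c i)\<^sup>2)"
  proof (rule sum.cong)
    fix i assume "i \<in> F"
    then show "c i * inner (\<Sum>j\<in>F. c j *\<^sub>R e j) (e i) = (c i)\<^sup>2"
      using assms(3) by (subst inner_sum_orthonormal[OF assms]) (auto simp: power2_eq_square)
  qed simp
  finally show ?thesis .
qed

lemma bessel:
  assumes "orthonormal e" "finite F" "F \<subseteq> {1..}"
  shows "(\<Sum>j\<in>F. (inner x (e j))\<^sup>2) \<le> (norm x)\<^sup>2"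
proof -
  define p where "p = (\<Sum>j\<in>F. inner x (e j) *\<^sub>R e j)"
  have "inner x p = (\<Sum>j\<in>F. (inner x (e j))\<^sup>2)"
    unfolding p_def by (simp add: inner_sum_right power2_eq_square)
  moreover have "(norm p)\<^sup>2 = (\<Sum>j\<in>F. (inner x (e j))\<^sup>2)"
    unfolding p_def by (rule norm_sum_orthonormal[OF assms])
  moreover have "0 \<le> (norm (x - p))\<^sup>2" by simp
  moreover have "(norm (x - p))\<^sup>2 = (norm x)\<^sup>2 - 2 * inner x p + (norm p)\<^sup>2"
    by (simp add: power2_norm_eq_inner inner_diff inner_commute)
  ultimately show ?thesis by linarith
qed

lemma linear_proj: "linear (proj e n)"
  unfolding proj_def
  by (intro linearI) (simp_all add: algebra_simps sum.distrib scaleR_sum_right)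

lemma bounded_linear_proj: "bounded_linear (proj e n)"
  unfolding proj_def
  by (intro bounded_linear_sum bounded_linear_scaleR_const bounded_linear_inner_left)

lemma inner_proj_commute: "inner (proj e n x) y = inner x (proj e n y)"
  unfolding proj_def by (simp add: inner_sum_left inner_sum_right mult.commute inner_commute)

lemma inner_proj_basis:
  assumes "orthonormal e" "1 \<le> i"
  shows "inner (proj e n x) (e i) = (if i \<le> n then inner x (e i) else 0)"
  unfolding proj_def using inner_sum_orthonormal[OF assms(1), of "{1..n}" i] assms(2) by auto

lemma norm_proj_sq:
  assumes "orthonormal e"
  shows "(norm (proj e n x))\<^sup>2 = (\<Sum>j=1..n. (inner x (e j))\<^sup>2)"
  unfolding proj_def by (rule norm_sum_orthonormal[OF assms]) auto

lemma norm_proj_le: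
  assumes "orthonormal e"
  shows "norm (proj e n x) \<le> norm x"
  using bessel[OF assms, of "{1..n}" x] unfolding norm_proj_sq[OF assms, symmetric]
  by (rule power2_le_imp_le) auto

lemma norm_residual_le:
  assumes "orthonormal e"
  shows "norm (x - proj e n x) \<le> norm x"
proof (rule power2_le_imp_le)
  have "inner x (proj e n x) = (norm (proj e n x))\<^sup>2"
    unfolding norm_proj_sq[OF assms] by (simp add: proj_def inner_sum_right power2_eq_square)
  then have "(norm (x - proj e n x))\<^sup>2 = (norm x)\<^sup>2 - (norm (proj e n x))\<^sup>2"
    by (simp add: power2_norm_eq_inner inner_diff inner_commute)
  then show "(norm (x - proj e n x))\<^sup>2 \<le> (norm x)\<^sup>2" by simp
qed simp

text \<open>
  A finite linear combination involves finitely many \<open>e j\<close> and is fixed by all later projections.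
\<close>

lemma proj_span:
  assumes "orthonormal e" "y \<in> span (e ` {1..})"
  shows "\<exists>n. \<forall>m\<ge>n. proj e m y = y"
  using assms(2)
proof (induction rule: span_induct_alt)
  case base
  show ?case using linear_0[OF linear_proj] by auto
next
  case (step c x y)
  then obtain j n where j: "x = e j" "1 \<le> j" and n: "\<And>m. m \<ge> n \<Longrightarrow> proj e m y = y" by auto
  have "proj e m (c *\<^sub>R x + y) = c *\<^sub>R x + y" if "m \<ge> max j n" for m
  proof -
    have "proj e m (e j) = (\<Sum>i=1..m. if i = j then e i else 0)"
      unfolding proj_def
      using assms(1) j(2) by (intro sum.cong) (auto simp: orthonormal_def)
    also have "\<dots> = e j" using j(2) that by simp
    finally show ?thesis
      using n[of m] that j(1) by (simp add: linear_add[OF linear_proj] linear_scale[OF linear_proj])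
  qed
  then show ?case by blast
qed

text \<open>
  Density suffices because the residual maps are contractions that eventually vanish at any given
  element of the span.
\<close>

lemma proj_tendsto:
  assumes "complete_orthonormal e"
  shows "(\<lambda>n. proj e n x) \<longlonglongrightarrow> x"
proof (rule metric_LIMSEQ_I)
  fix r :: real assume "0 < r"
  have o: "orthonormal e" and "x \<in> closure (span (e ` {1..}))"
    using assms by (auto simp: complete_orthonormal_def)
  then obtain y where y: "y \<in> span (e ` {1..})" "dist y x < r"
    using \<open>0 < r\<close> unfolding closure_approachable by blast
  obtain n where n: "\<And>m. m \<ge> n \<Longrightarrow> proj e m y = y" using proj_span[OF o y(1)] by auto
  have "dist (proj e m x) x < r" if "m \<ge> n" for m
  proof -
    have eq: "x - proj e m x = (x - y) - proj e m (x - y)"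
      using n[OF that] by (simp add: linear_diff[OF linear_proj])
    have "norm (x - proj e m x) \<le> norm (x - y)"
      unfolding eq by (rule norm_residual_le[OF o])
    then show ?thesis using y(2) by (simp add: dist_norm norm_minus_commute)
  qed
  then show "\<exists>no. \<forall>m\<ge>no. dist (proj e m x) x < r" by blast
qed

lemma parseval:
  assumes "complete_orthonormal e"
  shows "(\<lambda>n. \<Sum>j=1..n. (inner x (e j))\<^sup>2) \<longlonglongrightarrow> (norm x)\<^sup>2"
proof -
  have "orthonormal e" using assms by (simp add: complete_orthonormal_def)
  then show ?thesis
    using tendsto_power[OF tendsto_norm[OF proj_tendsto[OF assms, of x]], of 2]
    by (simp add: norm_proj_sq)
qed

text \<open>
  The operator norm is at most the Hilbert-Schmidt norm, by the Cauchy-Schwarz inequality for the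
  coordinates of \<open>x\<close>.
\<close>

lemma norm_le_hilbert_schmidt:
  fixes A :: "'a::real_inner \<Rightarrow> 'b::real_normed_vector"
  assumes e: "complete_orthonormal e" and A: "bounded_linear A" and "0 \<le> B"
    and B: "\<And>n. (\<Sum>j=1..n. (norm (A (e j)))\<^sup>2) \<le> B\<^sup>2"
  shows "norm (A x) \<le> B * norm x"
proof -
  have o: "orthonormal e" using e by (simp add: complete_orthonormal_def)
  have "norm (A (proj e n x)) \<le> B * norm x" for n
  proof -
    have "norm (A (proj e n x)) = norm (\<Sum>j=1..n. inner x (e j) *\<^sub>R A (e j))"
      unfolding proj_def
      by (simp add: linear_sum[OF bounded_linear.linear[OF A]] linear_scale[OF bounded_linear.linear[OF A]])
    also have "\<dots> \<le> (\<Sum>j=1..n. \<bar>inner x (e j)\<bar> * \<bar>norm (A (e j))\<bar>)"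
      by (rule order_trans[OF norm_sum]) simp
    also have "\<dots> \<le> L2_set (\<lambda>j. inner x (e j)) {1..n} * L2_set (\<lambda>j. norm (A (e j))) {1..n}"
      by (rule L2_set_mult_ineq)
    also have "\<dots> \<le> norm x * B"
    proof (rule mult_mono)
      have "L2_set (\<lambda>j. inner x (e j)) {1..n} \<le> sqrt ((norm x)\<^sup>2)"
        unfolding L2_set_def by (intro real_sqrt_le_mono bessel[OF o]) auto
      then show "L2_set (\<lambda>j. inner x (e j)) {1..n} \<le> norm x" by simp
      have "L2_set (\<lambda>j. norm (A (e j))) {1..n} \<le> sqrt (B\<^sup>2)"
        unfolding L2_set_def by (intro real_sqrt_le_mono B)
      then show "L2_set (\<lambda>j. norm (A (e j))) {1..n} \<le> B" using \<open>0 \<le> B\<close> by simp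
    qed (auto simp: L2_set_nonneg)
    finally show ?thesis by (simp add: mult.commute)
  qed
  moreover have "(\<lambda>n. norm (A (proj e n x))) \<longlonglongrightarrow> norm (A x)"
    by (intro tendsto_norm bounded_linear.tendsto[OF A] proj_tendsto[OF e])
  ultimately show ?thesis
    by (intro LIMSEQ_le_const2) auto
qed

text \<open>
  The counterpart of \<^const>\<open>eigensystem\<close> in an arbitrary inner product space.
\<close>

definition eigenbasis :: "('a::real_inner \<Rightarrow> 'a) \<Rightarrow> (nat \<Rightarrow> real) \<Rightarrow> (nat \<Rightarrow> 'a) \<Rightarrow> bool" where
  "eigenbasis T lam e \<longleftrightarrow> complete_orthonormal e \<and> (\<forall>j\<ge>1. T (e j) = lam j *\<^sub>R e j)
     \<and> (\<forall>j\<ge>1. lam (j + 1) \<le> lam j)"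

lemma eigenbasis_antimono:
  assumes "eigenbasis T lam e" "1 \<le> i" "i \<le> j"
  shows "lam j \<le> lam i"
  using assms(3,2)
proof (induction j rule: dec_induct)
  case (step n)
  then show ?case using assms(1) unfolding eigenbasis_def by (metis Suc_eq_plus1 order_trans)
qed simp

lemma inner_eigen_sum:
  assumes "eigenbasis T lam e" "linear T" "finite F" "F \<subseteq> {1..}"
  shows "inner (T (\<Sum>j\<in>F. c j *\<^sub>R e j)) (\<Sum>j\<in>F. c j *\<^sub>R e j) = (\<Sum>j\<in>F. lam j * (c j)\<^sup>2)"
proof -
  have o: "orthonormal e" using assms(1) by (simp add: eigenbasis_def complete_orthonormal_def)
  have "T (\<Sum>j\<in>F. c j *\<^sub>R e j) = (\<Sum>j\<in>F. (c j * lam j) *\<^sub>R e j)"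
    using assms(1,4) unfolding linear_sum[OF assms(2)] linear_scale[OF assms(2)] eigenbasis_def
    by (intro sum.cong) auto
  then have "inner (T (\<Sum>j\<in>F. c j *\<^sub>R e j)) (\<Sum>j\<in>F. c j *\<^sub>R e j)
      = (\<Sum>i\<in>F. c i * inner (\<Sum>j\<in>F. (c j * lam j) *\<^sub>R e j) (e i))"
    by (simp add: inner_sum_right)
  also have "\<dots> = (\<Sum>j\<in>F. lam j * (c j)\<^sup>2)"
  proof (rule sum.cong)
    fix i assume "i \<in> F"
    then show "c i * inner (\<Sum>j\<in>F. (c j * lam j) *\<^sub>R e j) (e i) = lam i * (c i)\<^sup>2"
      using assms(4) by (subst inner_sum_orthonormal[OF o assms(3,4)]) (auto simp: power2_eq_square)
  qed simp
  finally show ?thesis .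
qed

lemma rayleigh_upper:
  assumes eig: "eigenbasis T lam e" and T: "bounded_linear T" and "1 \<le> L"
    and perp: "\<And>j. 1 \<le> j \<Longrightarrow> j < L \<Longrightarrow> inner x (e j) = 0"
  shows "inner (T x) x \<le> lam L * (norm x)\<^sup>2"
proof -
  have c: "complete_orthonormal e" using eig by (simp add: eigenbasis_def)
  then have o: "orthonormal e" by (simp add: complete_orthonormal_def)
  have "inner (T (proj e n x)) (proj e n x) \<le> lam L * (norm (proj e n x))\<^sup>2" for n
  proof -
    have "inner (T (proj e n x)) (proj e n x) = (\<Sum>j=1..n. lam j * (inner x (e j))\<^sup>2)"
      unfolding proj_def by (rule inner_eigen_sum[OF eig bounded_linear.linear[OF T]]) auto
    also have "\<dots> \<le> (\<Sum>j=1..n. lam L * (inner x (e j))\<^sup>2)"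
    proof (rule sum_mono)
      fix j assume "j \<in> {1..n}"
      then show "lam j * (inner x (e j))\<^sup>2 \<le> lam L * (inner x (e j))\<^sup>2"
        using perp[of j] eigenbasis_antimono[OF eig \<open>1 \<le> L\<close>, of j]
        by (cases "j < L") (auto intro: mult_right_mono)
    qed
    also have "\<dots> = lam L * (norm (proj e n x))\<^sup>2"
      by (simp add: norm_proj_sq[OF o] sum_distrib_left)
    finally show ?thesis .
  qed
  moreover have "(\<lambda>n. inner (T (proj e n x)) (proj e n x)) \<longlonglongrightarrow> inner (T x) x"
    by (intro tendsto_inner bounded_linear.tendsto[OF T] proj_tendsto[OF c])
  moreover have "(\<lambda>n. lam L * (norm (proj e n x))\<^sup>2) \<longlonglongrightarrow> lam L * (norm x)\<^sup>2"
    by (intro tendsto_intros proj_tendsto[OF c])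
  ultimately show ?thesis by (intro LIMSEQ_le) auto
qed

lemma rayleigh_lower:
  assumes eig: "eigenbasis T lam e" and T: "linear T"
    and x: "x = (\<Sum>j=1..L. c j *\<^sub>R e j)"
  shows "lam L * (norm x)\<^sup>2 \<le> inner (T x) x"
proof -
  have o: "orthonormal e" using eig by (simp add: eigenbasis_def complete_orthonormal_def)
  have "lam L * (norm x)\<^sup>2 = (\<Sum>j=1..L. lam L * (c j)\<^sup>2)"
    unfolding x by (subst norm_sum_orthonormal[OF o]) (auto simp: sum_distrib_left)
  also have "\<dots> \<le> (\<Sum>j=1..L. lam j * (c j)\<^sup>2)"
    by (intro sum_mono mult_right_mono eigenbasis_antimono[OF eig]) auto
  also have "\<dots> = inner (T x) x"
    unfolding x by (rule inner_eigen_sum[OF eig T, symmetric]) auto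
  finally show ?thesis .
qed

text \<open>
  There are \<open>L\<close> unknown coefficients and \<open>L - 1\<close> linear conditions. In terms of independence: if the
  conditions only had the trivial solution, then \<open>x \<mapsto> (\<Sum>i<L. \<langle>x, f i\<rangle> f i)\<close> would be injective on the span
  of the \<open>e j\<close> and would map it into a space spanned by \<open>L - 1\<close> vectors.
\<close>

lemma exists_orthogonal_combination:
  fixes e f :: "nat \<Rightarrow> 'a::real_inner"
  assumes "orthonormal e" "1 \<le> L"
  shows "\<exists>c. (\<Sum>j=1..L. c j *\<^sub>R e j) \<noteq> 0 \<and> (\<forall>i. 1 \<le> i \<longrightarrow> i < L \<longrightarrow> inner (\<Sum>j=1..L. c j *\<^sub>R e j) (f i) = 0)"
proof (rule ccontr)
  assume neg: "\<not> ?thesis"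
  define g where "g x = (\<Sum>i\<in>{1..<L}. inner x (f i) *\<^sub>R f i)" for x
  have lin: "linear g"
    unfolding g_def by (intro linearI) (simp_all add: algebra_simps sum.distrib scaleR_sum_right)
  have inj: "x = 0" if x: "x = (\<Sum>j=1..L. c j *\<^sub>R e j)" and "g x = 0" for x c
  proof -
    have "(\<Sum>i\<in>{1..<L}. (inner x (f i))\<^sup>2) = inner x (g x)"
      by (simp add: g_def inner_sum_right power2_eq_square)
    then have "\<forall>i\<in>{1..<L}. (inner x (f i))\<^sup>2 = 0"
      using that(2) by (subst sum_nonneg_eq_0_iff[symmetric]) auto
    then show ?thesis using neg x by fastforce
  qed
  let ?h = "\<lambda>j. g (e j)"
  have zero: "\<forall>j\<in>{1..L}. c j = 0" if "(\<Sum>j=1..L. c j *\<^sub>R ?h j) = 0" for c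
  proof -
    have "g (\<Sum>j=1..L. c j *\<^sub>R e j) = 0"
      using that by (simp add: linear_sum[OF lin] linear_scale[OF lin])
    from inj[OF refl this] have "(\<Sum>j=1..L. (c j)\<^sup>2) = 0"
      using norm_sum_orthonormal[OF assms(1), of "{1..L}" c] by auto
    then show ?thesis by (subst (asm) sum_nonneg_eq_0_iff) auto
  qed
  have injh: "inj_on ?h {1..L}"
  proof (rule inj_onI, rule ccontr)
    fix i j assume ij: "i \<in> {1..L}" "j \<in> {1..L}" "?h i = ?h j" "i \<noteq> j"
    let ?c = "\<lambda>k. if k = i then 1 else if k = j then -1 else (0::real)"
    \<comment> \<open>Equal images would give the nontrivial relation with coefficients 1 and -1.\<close>
    have "(\<Sum>k=1..L. ?c k *\<^sub>R ?h k) = (\<Sum>k=1..L. (if k = i then ?h i else 0) + (if k = j then - ?h i else 0))"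
      using ij(3,4) by (intro sum.cong) auto
    also have "\<dots> = 0" using ij by (simp add: sum.distrib)
    finally have "?c i = 0" using zero[of ?c] ij(1) by blast
    then show False by simp
  qed
  have ind: "independent (?h ` {1..L})"
    unfolding independent_explicit_finite_subsets
  proof (intro allI impI ballI)
    fix A u v assume A: "A \<subseteq> ?h ` {1..L}" "finite A" and s: "(\<Sum>v\<in>A. u v *\<^sub>R v) = 0" and v: "v \<in> A"
    let ?c = "\<lambda>j. if ?h j \<in> A then u (?h j) else 0"
    have "(\<Sum>w\<in>?h ` {1..L}. (if w \<in> A then u w else 0) *\<^sub>R w) = (\<Sum>w\<in>A. u w *\<^sub>R w)"
      using A by (intro sum.mono_neutral_cong_right) auto
    then have "(\<Sum>j=1..L. ?c j *\<^sub>R ?h j) = 0"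
      unfolding s sum.reindex[OF injh] o_def .
    then have all0: "\<forall>j\<in>{1..L}. ?c j = 0" by (rule zero)
    obtain j where "j \<in> {1..L}" "v = ?h j" using A(1) v by blast
    with bspec[OF all0, of j] v show "u v = 0" by (simp only: if_True)
  qed
  have "?h ` {1..L} \<subseteq> span (f ` {1..<L})"
    by (auto simp: g_def intro!: span_sum span_scale intro: span_base)
  from independent_span_bound[OF _ ind this]
  have "card (?h ` {1..L}) \<le> card (f ` {1..<L})" by simp
  also have "\<dots> \<le> L - 1" using card_image_le[of "{1..<L}" f] by simp
  finally show False using card_image[OF injh] assms(2) by simp
qed

text \<open>
  Courant-Fischer: a nonzero combination of the first \<open>L\<close> eigenvectors of \<open>T\<close> that is orthogonal to
  the first \<open>L - 1\<close> eigenvectors of \<open>S\<close> has Rayleigh quotient at least \<open>lam L\<close> for \<open>T\<close> and at most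
  \<open>mu L\<close> for \<open>S\<close>.
\<close>

lemma weyl:
  assumes T: "eigenbasis T lam e" "linear T" and S: "eigenbasis S mu f" "bounded_linear S"
    and "1 \<le> L" and d: "\<And>x. norm (S x - T x) \<le> d * norm x"
  shows "lam L - d \<le> mu L"
proof -
  obtain c where "(\<Sum>j=1..L. c j *\<^sub>R e j) \<noteq> 0"
      and perp: "\<And>i. 1 \<le> i \<Longrightarrow> i < L \<Longrightarrow> inner (\<Sum>j=1..L. c j *\<^sub>R e j) (f i) = 0"
    using exists_orthogonal_combination[of e L f] T(1) \<open>1 \<le> L\<close>
    unfolding eigenbasis_def complete_orthonormal_def by blast
  then obtain x where x: "x = (\<Sum>j=1..L. c j *\<^sub>R e j)" "x \<noteq> 0" by blast
  have "lam L * (norm x)\<^sup>2 \<le> inner (T x) x" by (rule rayleigh_lower[OF T x(1)])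
  also have "\<dots> = inner (S x) x - inner (S x - T x) x" by (simp add: inner_diff_left)
  also have "\<dots> \<le> mu L * (norm x)\<^sup>2 + d * (norm x)\<^sup>2"
  proof -
    have "- inner (S x - T x) x \<le> norm (S x - T x) * norm x"
      using Cauchy_Schwarz_ineq2[of "S x - T x" x] by linarith
    also have "\<dots> \<le> d * norm x * norm x" by (intro mult_right_mono d) simp
    finally have "- inner (S x - T x) x \<le> d * (norm x)\<^sup>2" by (simp add: power2_eq_square)
    moreover have "inner (S x) x \<le> mu L * (norm x)\<^sup>2"
      using rayleigh_upper[OF S \<open>1 \<le> L\<close>, of x] perp x(1) by simp
    ultimately show ?thesis by linarith
  qed
  finally have "lam L * (norm x)\<^sup>2 \<le> (mu L + d) * (norm x)\<^sup>2" by (simp add: algebra_simps)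
  then show ?thesis using x(2) by simp
qed

text \<open>
  Let \<open>z\<close> be the residual of \<open>e j\<close>. Since the projection commutes with \<open>S\<close>, up to an error of size \<open>d\<close>
  the quadratic form of \<open>S\<close> at \<open>z\<close> is \<open>lam j * \<parallel>z\<parallel>\<^sup>2\<close>. It is also at most \<open>mu (n + 1) * \<parallel>z\<parallel>\<^sup>2\<close>, and
  \<open>mu (n + 1) \<le> lam (j + 1) + d\<close> by Weyl's inequality and \<open>j \<le> n\<close>. Only the gap next to the fixed index
  \<open>j\<close> enters, so the bound is uniform in \<open>n\<close>.
\<close>

lemma residual_eigenvector_bound:
  assumes T: "eigenbasis T lam e" "bounded_linear T" and S: "eigenbasis S mu f" "bounded_linear S"
    and sym: "\<And>x y. inner (S x) y = inner x (S y)"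
    and d: "\<And>x. norm (S x - T x) \<le> d * norm x"
    and "1 \<le> j" "j \<le> n"
  shows "(lam j - lam (j + 1) - d) * norm (e j - proj f n (e j)) \<le> d"
proof -
  have of: "orthonormal f" and oe: "orthonormal e" 
    using T S by (auto simp: eigenbasis_def complete_orthonormal_def)
  define z where "z = e j - proj f n (e j)"
  have n1: "norm (e j) = 1" using oe \<open>1 \<le> j\<close> by (simp add: orthonormal_def norm_eq_sqrt_inner)
  note linS = bounded_linear.linear[OF S(2)]
  have perp: "inner z (f i) = 0" if "1 \<le> i" "i \<le> n" for i
    unfolding z_def using inner_proj_basis[OF of that(1), of n "e j"] that by (simp add: inner_diff_left)
  have pz: "inner (proj f n y) z = 0" for y
    unfolding proj_def inner_sum_left using perp by (intro sum.neutral) (auto simp: inner_commute[of _ z])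
  have comm: "S (proj f n (e j)) = proj f n (S (e j))"
  proof -
    have "S (proj f n (e j)) = (\<Sum>i=1..n. inner (e j) (f i) *\<^sub>R S (f i))"
      unfolding proj_def by (simp add: linear_sum[OF linS] linear_scale[OF linS])
    also have "\<dots> = (\<Sum>i=1..n. inner (e j) (S (f i)) *\<^sub>R f i)"
      using S(1) by (intro sum.cong) (auto simp: eigenbasis_def)
    finally show ?thesis by (simp add: proj_def sym)
  qed
  have "inner (S z) z = inner (S (e j)) z"
    using pz[of "S (e j)"]
    by (subst (1) z_def) (simp add: linear_diff[OF linS] comm inner_diff_left)
  also have "\<dots> = lam j * inner (e j) z + inner (S (e j) - T (e j)) z"
    using T(1) \<open>1 \<le> j\<close> by (simp add: eigenbasis_def inner_diff_left)
  also have "inner (e j) z = (norm z)\<^sup>2"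
    using pz[of "e j"] unfolding power2_norm_eq_inner by (subst (2) z_def) (simp add: inner_diff_left)
  finally have eq: "inner (S z) z = lam j * (norm z)\<^sup>2 + inner (S (e j) - T (e j)) z" .
  have "mu (n + 1) \<le> lam (j + 1) + d"
    using weyl[OF S(1) linS T, of "n + 1" d] d
      eigenbasis_antimono[OF T(1), of "j + 1" "n + 1"] \<open>j \<le> n\<close> by (simp add: norm_minus_commute)
  then have "mu (n + 1) * (norm z)\<^sup>2 \<le> (lam (j + 1) + d) * (norm z)\<^sup>2"
    by (rule mult_right_mono) simp
  moreover have "inner (S z) z \<le> mu (n + 1) * (norm z)\<^sup>2"
    using perp by (intro rayleigh_upper[OF S]) auto
  moreover have "- inner (S (e j) - T (e j)) z \<le> d * norm z"
    using Cauchy_Schwarz_ineq2[of "S (e j) - T (e j)" z] mult_right_mono[OF d[of "e j"], of "norm z"] n1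
    by simp
  ultimately have "(lam j - lam (j + 1) - d) * norm z * norm z \<le> d * norm z"
    using eq by (simp add: algebra_simps power2_eq_square)
  then have "z \<noteq> 0 \<Longrightarrow> (lam j - lam (j + 1) - d) * norm z \<le> d"
    using mult_right_le_imp_le[of "(lam j - lam (j + 1) - d) * norm z" "norm z" d] by simp
  moreover have "0 \<le> d" using order_trans[OF norm_ge_zero d[of "e j"]] n1 by simp
  ultimately show ?thesis unfolding z_def[symmetric] by (cases "z = 0") auto
qed

section \<open>The Marcinkiewicz--Zygmund strong law in Hilbert space\<close>

text \<open>
  A measurable bound for the squared norms of all partial sums of a block of \<open>2 ^ k\<close> terms that starts
  at \<open>a\<close>. The recursion is the bisection argument of Rademacher and Menshov: a partial sum that
  reaches into the second half of the block is the sum of the first half plus a partial sum of the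
  second half. The weights come from \<open>(x + y)\<^sup>2 \<le> (1 + c) x\<^sup>2 + (1 + 1 / c) y\<^sup>2\<close> with \<open>c = k + 1\<close>.
\<close>

fun dyadic_majorant :: "(nat \<Rightarrow> 'a::real_inner) \<Rightarrow> nat \<Rightarrow> nat \<Rightarrow> real" where
  "dyadic_majorant t a 0 = (norm (t a))\<^sup>2"
| "dyadic_majorant t a (Suc k) = real (k + 2) * (norm (\<Sum>i<2^k. t (a + i)))\<^sup>2
     + real (k + 2) / real (k + 1) * (dyadic_majorant t a k + dyadic_majorant t (a + 2^k) k)"

lemma dyadic_majorant_nonneg: "0 \<le> dyadic_majorant t a k"
  by (induction k arbitrary: a) simp_all

lemma square_add_le_weighted:
  fixes x y c :: real
  assumes "0 < c"
  shows "(x + y)\<^sup>2 \<le> (1 + c) * x\<^sup>2 + (1 + c) / c * y\<^sup>2"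
proof -
  have "(1 + c) * x\<^sup>2 + (1 + c) / c * y\<^sup>2 - (x + y)\<^sup>2 = (c * x - y)\<^sup>2 / c"
    using assms by (simp add: field_simps power2_eq_square)
  also have "\<dots> \<ge> 0" using assms by simp
  finally show ?thesis by simp
qed

lemma norm_partial_sum_le_majorant:
  assumes "n \<le> 2^k"
  shows "(norm (\<Sum>i<n. t (a + i)))\<^sup>2 \<le> dyadic_majorant t a k"
  using assms
proof (induction k arbitrary: a n)
  case 0
  then have "n = 0 \<or> n = 1" by auto
  then show ?case by auto
next
  case (Suc k)
  let ?A = "dyadic_majorant t a k" and ?B = "dyadic_majorant t (a + 2^k) k"
  let ?q = "real (k + 2) / real (k + 1)"
  have q: "1 \<le> ?q" by simp
  have nn: "0 \<le> ?A" "0 \<le> ?B" by (rule dyadic_majorant_nonneg)+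
  show ?case
  proof (cases "n \<le> 2^k")
    case True
    have "(norm (\<Sum>i<n. t (a + i)))\<^sup>2 \<le> 1 * ?A" using Suc.IH[OF True] by simp
    also have "\<dots> \<le> ?q * (?A + ?B)" using q nn by (intro mult_mono) auto
    also have "\<dots> \<le> dyadic_majorant t a (Suc k)" by simp
    finally show ?thesis .
  next
    case False
    then obtain m where m: "n = 2^k + m" "m \<le> 2^k"
      using Suc.prems by (metis add_le_cancel_left le_add_diff_inverse mult_2 nat_le_linear power_Suc)
    let ?D = "\<Sum>i<2^k. t (a + i)" and ?R = "\<Sum>i<m. t (a + 2^k + i)"
    have "(\<Sum>i<n. t (a + i)) = ?D + ?R"
      unfolding m(1) by (induction m) (simp_all add: add.assoc)
    then have "(norm (\<Sum>i<n. t (a + i)))\<^sup>2 \<le> (norm ?D + norm ?R)\<^sup>2"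
      by (simp add: norm_triangle_ineq power_mono)
    also have "\<dots> \<le> (1 + real (k + 1)) * (norm ?D)\<^sup>2 + (1 + real (k + 1)) / real (k + 1) * (norm ?R)\<^sup>2"
      by (rule square_add_le_weighted) simp
    also have "(1 + real (k + 1)) = real (k + 2)" by simp
    also have "real (k + 2) * (norm ?D)\<^sup>2 + ?q * (norm ?R)\<^sup>2
        \<le> real (k + 2) * (norm ?D)\<^sup>2 + ?q * (?A + ?B)"
      using Suc.IH[OF m(2), of "a + 2^k"] nn by (intro add_left_mono mult_left_mono) auto
    finally show ?thesis by simp
  qed
qed

lemma integral_norm_sum_orthogonal:
  fixes T :: "'i \<Rightarrow> 'w \<Rightarrow> 'b::real_inner"
  assumes int: "\<And>i j. integrable M (\<lambda>\<omega>. inner (T i \<omega>) (T j \<omega>))"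
    and orth: "\<And>i j. i \<noteq> j \<Longrightarrow> (\<integral>\<omega>. inner (T i \<omega>) (T j \<omega>) \<partial>M) = 0"
    and "finite F"
  shows "integrable M (\<lambda>\<omega>. (norm (\<Sum>i\<in>F. T i \<omega>))\<^sup>2)"
    and "(\<integral>\<omega>. (norm (\<Sum>i\<in>F. T i \<omega>))\<^sup>2 \<partial>M) = (\<Sum>i\<in>F. \<integral>\<omega>. (norm (T i \<omega>))\<^sup>2 \<partial>M)"
proof -
  have eq: "(norm (\<Sum>i\<in>F. T i \<omega>))\<^sup>2 = (\<Sum>i\<in>F. \<Sum>j\<in>F. inner (T i \<omega>) (T j \<omega>))" for \<omega>
    by (simp only: power2_norm_eq_inner inner_sum_left inner_sum_right) (rule sum.swap)
  show "integrable M (\<lambda>\<omega>. (norm (\<Sum>i\<in>F. T i \<omega>))\<^sup>2)"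
    unfolding eq by (intro Bochner_Integration.integrable_sum int)
  have "(\<integral>\<omega>. (norm (\<Sum>i\<in>F. T i \<omega>))\<^sup>2 \<partial>M) = (\<Sum>i\<in>F. \<Sum>j\<in>F. \<integral>\<omega>. inner (T i \<omega>) (T j \<omega>) \<partial>M)"
    unfolding eq using int by (simp add: Bochner_Integration.integrable_sum)
  also have "\<dots> = (\<Sum>i\<in>F. \<Sum>j\<in>F. if i = j then \<integral>\<omega>. inner (T i \<omega>) (T i \<omega>) \<partial>M else 0)"
    using orth by (intro sum.cong) auto
  finally show "(\<integral>\<omega>. (norm (\<Sum>i\<in>F. T i \<omega>))\<^sup>2 \<partial>M) = (\<Sum>i\<in>F. \<integral>\<omega>. (norm (T i \<omega>))\<^sup>2 \<partial>M)"
    using \<open>finite F\<close> by (simp add: sum.delta power2_norm_eq_inner)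
qed

text \<open>
  The Rademacher-Menshov inequality. Orthogonality is enough, at the price of the factor
  \<open>(k + 1)\<^sup>2\<close>. The induction closes because \<open>(k + 2) + (k + 2) / (k + 1) * (k + 1)\<^sup>2 = (k + 2)\<^sup>2\<close>.
\<close>

lemma integral_dyadic_majorant:
  fixes T :: "nat \<Rightarrow> 'w \<Rightarrow> 'b::real_inner"
  assumes int: "\<And>i j. integrable M (\<lambda>\<omega>. inner (T i \<omega>) (T j \<omega>))"
    and orth: "\<And>i j. i \<noteq> j \<Longrightarrow> (\<integral>\<omega>. inner (T i \<omega>) (T j \<omega>) \<partial>M) = 0"
  shows "integrable M (\<lambda>\<omega>. dyadic_majorant (\<lambda>i. T i \<omega>) a k)
    \<and> (\<integral>\<omega>. dyadic_majorant (\<lambda>i. T i \<omega>) a k \<partial>M)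
      \<le> (real k + 1)\<^sup>2 * (\<Sum>i<2^k. \<integral>\<omega>. (norm (T (a + i) \<omega>))\<^sup>2 \<partial>M)"
proof (induction k arbitrary: a)
  case 0
  show ?case using int[of a a] by (simp add: power2_norm_eq_inner)
next
  case (Suc k)
  have D: "integrable M (\<lambda>\<omega>. (norm (\<Sum>i<2^k. T (a + i) \<omega>))\<^sup>2)"
    "(\<integral>\<omega>. (norm (\<Sum>i<2^k. T (a + i) \<omega>))\<^sup>2 \<partial>M) = (\<Sum>i<2^k. \<integral>\<omega>. (norm (T (a + i) \<omega>))\<^sup>2 \<partial>M)"
    using integral_norm_sum_orthogonal[of M "\<lambda>i. T (a + i)" "{..<2^k}"] int orth by auto
  let ?V = "\<lambda>b. \<Sum>i<2^k. \<integral>\<omega>. (norm (T (b + i) \<omega>))\<^sup>2 \<partial>M"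
  have split: "(\<Sum>i<2^Suc k. \<integral>\<omega>. (norm (T (a + i) \<omega>))\<^sup>2 \<partial>M) = ?V a + ?V (a + 2^k)"
  proof -
    have "(\<Sum>i<n + m. f (a + i)) = (\<Sum>i<n. f (a + i)) + (\<Sum>i<m. f (a + n + i))"
      for n m and f :: "nat \<Rightarrow> real"
      by (induction m) (simp_all add: add.assoc)
    from this[of "\<lambda>i. \<integral>\<omega>. (norm (T i \<omega>))\<^sup>2 \<partial>M" "2^k" "2^k"] show ?thesis by (simp add: mult_2)
  qed
  have Vnn: "0 \<le> ?V b" for b by (intro sum_nonneg Bochner_Integration.integral_nonneg) simp
  have "(\<integral>\<omega>. dyadic_majorant (\<lambda>i. T i \<omega>) a (Suc k) \<partial>M)
      = real (k + 2) * ?V a + real (k + 2) / real (k + 1) *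
        ((\<integral>\<omega>. dyadic_majorant (\<lambda>i. T i \<omega>) a k \<partial>M) + (\<integral>\<omega>. dyadic_majorant (\<lambda>i. T i \<omega>) (a + 2^k) k \<partial>M))"
    using D Suc.IH by simp
  also have "\<dots> \<le> real (k + 2) * (?V a + ?V (a + 2^k)) + real (k + 2) / real (k + 1) *
        ((real k + 1)\<^sup>2 * ?V a + (real k + 1)\<^sup>2 * ?V (a + 2^k))"
    using Suc.IH Vnn by (intro add_mono mult_left_mono) auto
  also have "\<dots> = (real (Suc k) + 1)\<^sup>2 * (?V a + ?V (a + 2^k))"
  proof -
    have "real (k + 2) / real (k + 1) * ((real k + 1)\<^sup>2 * s + (real k + 1)\<^sup>2 * t)
        = (real k + 2) * (real k + 1) * (s + t)" for s t
      by (simp add: power2_eq_square field_simps)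
    then show ?thesis by (simp only:) (simp add: power2_eq_square algebra_simps)
  qed
  finally show ?case using D Suc.IH unfolding split by simp
qed

lemma AE_tendsto_zero_if_summable_integral:
  fixes f :: "nat \<Rightarrow> 'w \<Rightarrow> real"
  assumes f: "\<And>k. integrable M (f k)" "\<And>k \<omega>. 0 \<le> f k \<omega>"
    and s: "\<And>k. (\<integral>\<omega>. f k \<omega> \<partial>M) \<le> s k" "summable s"
  shows "AE \<omega> in M. (\<lambda>k. f k \<omega>) \<longlonglongrightarrow> 0"
proof -
  have [measurable]: "f k \<in> borel_measurable M" for k using f(1) by auto
  have nn: "0 \<le> s k" for k using s(1)[of k] Bochner_Integration.integral_nonneg[of M "f k"] f(2) by (meson order_trans)
  have "(\<integral>\<^sup>+\<omega>. (\<Sum>k. ennreal (f k \<omega>)) \<partial>M) = (\<Sum>k. \<integral>\<^sup>+\<omega>. f k \<omega> \<partial>M)"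
    by (intro nn_integral_suminf) measurable
  also have "\<dots> \<le> (\<Sum>k. ennreal (s k))"
  proof (intro suminf_le summableI)
    fix k
    have "(\<integral>\<^sup>+\<omega>. f k \<omega> \<partial>M) = ennreal (\<integral>\<omega>. f k \<omega> \<partial>M)"
      using f by (intro nn_integral_eq_integral) auto
    then show "(\<integral>\<^sup>+\<omega>. f k \<omega> \<partial>M) \<le> ennreal (s k)" using s(1) by (simp add: ennreal_leI)
  qed
  also have "\<dots> < \<infinity>" using nn s(2) by (subst suminf_ennreal2) auto
  finally have "AE \<omega> in M. (\<Sum>k. ennreal (f k \<omega>)) \<noteq> \<infinity>"
    by (intro nn_integral_noteq_infinite) auto
  then show ?thesis
  proof eventually_elim
    case (elim \<omega>)
    then have "summable (\<lambda>k. f k \<omega>)" using f(2) by (intro summable_suminf_not_top) auto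
    then show ?case by (rule summable_LIMSEQ_zero)
  qed
qed

lemma (in prob_space) indep_var_integral_inner:
  fixes A B :: "'a \<Rightarrow> 'b::{real_inner,banach,second_countable_topology}"
  assumes ind: "indep_var borel A borel B" and A: "integrable M A" and B: "integrable M B"
    and AB: "integrable M (\<lambda>\<omega>. inner (A \<omega>) (B \<omega>))"
  shows "(\<integral>\<omega>. inner (A \<omega>) (B \<omega>) \<partial>M) = inner (expectation A) (expectation B)"
proof -
  have [measurable]: "A \<in> borel_measurable M" "B \<in> borel_measurable M" using A B by auto
  have eq: "distr M borel A \<Otimes>\<^sub>M distr M borel B = distr M (borel \<Otimes>\<^sub>M borel) (\<lambda>x. (A x, B x))"
    using ind by (simp add: indep_var_distribution_eq)
  interpret DA: prob_space "distr M borel A" by (rule prob_space_distr) simp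
  interpret DB: prob_space "distr M borel B" by (rule prob_space_distr) simp
  interpret pair_prob_space "distr M borel A" "distr M borel B" ..
  have [measurable]: "(\<lambda>p. inner (fst p) (snd p)) \<in> borel_measurable (borel \<Otimes>\<^sub>M (borel :: 'b measure))"
    by measurable
  have int: "integrable (distr M borel A \<Otimes>\<^sub>M distr M borel B) (\<lambda>p. inner (fst p) (snd p))"
    unfolding eq using AB by (subst integrable_distr_eq) auto
  have iB: "integrable (distr M borel B) (\<lambda>y. y)" "(\<integral>y. y \<partial>distr M borel B) = integral\<^sup>L M B"
    using B by (auto simp: integrable_distr_eq integral_distr)
  have iA: "integrable (distr M borel A) (\<lambda>y. y)" "(\<integral>y. y \<partial>distr M borel A) = integral\<^sup>L M A"
    using A by (auto simp: integrable_distr_eq integral_distr)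
  have "(\<integral>\<omega>. inner (A \<omega>) (B \<omega>) \<partial>M) = (\<integral>p. inner (fst p) (snd p) \<partial>(distr M borel A \<Otimes>\<^sub>M distr M borel B))"
    unfolding eq by (subst integral_distr) auto
  also have "\<dots> = (\<integral>x. \<integral>y. inner x y \<partial>distr M borel B \<partial>distr M borel A)"
    using integral_fst'[OF int] by simp
  also have "\<dots> = (\<integral>x. inner x (integral\<^sup>L M B) \<partial>distr M borel A)"
    using iB by simp
  also have "\<dots> = inner (integral\<^sup>L M A) (integral\<^sup>L M B)" using iA by simp
  finally show ?thesis .
qed


text \<open>
  The next three estimates compare a function of \<open>\<parallel>Z\<parallel>\<close> with a multiple of \<open>\<parallel>Z\<parallel> powr p\<close>, separately
  below and above the truncation level \<open>b\<close>.
\<close>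

lemma (in prob_space) truncated_second_moment:
  fixes Z :: "'a \<Rightarrow> 'b::{real_inner,banach,second_countable_topology}"
  assumes [measurable]: "Z \<in> borel_measurable M" and Zp: "integrable M (\<lambda>\<omega>. norm (Z \<omega>) powr p)"
    and b: "0 < b" and p: "p \<le> 2"
  shows "(\<integral>\<omega>. (norm (if norm (Z \<omega>) \<le> b then Z \<omega> else 0))\<^sup>2 \<partial>M)
    \<le> b powr (2 - p) * (\<integral>\<omega>. norm (Z \<omega>) powr p \<partial>M)"
proof -
  have "(\<integral>\<omega>. (norm (if norm (Z \<omega>) \<le> b then Z \<omega> else 0))\<^sup>2 \<partial>M)
      \<le> (\<integral>\<omega>. b powr (2 - p) * norm (Z \<omega>) powr p \<partial>M)"
  proof (rule integral_mono)
    show "integrable M (\<lambda>\<omega>. (norm (if norm (Z \<omega>) \<le> b then Z \<omega> else 0))\<^sup>2)"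
      using b by (intro integrable_const_bound[where B = "b\<^sup>2"]) (auto intro: power_mono)
    fix \<omega>
    show "(norm (if norm (Z \<omega>) \<le> b then Z \<omega> else 0))\<^sup>2 \<le> b powr (2 - p) * norm (Z \<omega>) powr p"
    proof (cases "norm (Z \<omega>) \<le> b \<and> Z \<omega> \<noteq> 0")
      case True
      then have "(norm (Z \<omega>))\<^sup>2 = norm (Z \<omega>) powr (2 - p) * norm (Z \<omega>) powr p"
        by (simp flip: powr_add powr_numeral)
      also have "\<dots> \<le> b powr (2 - p) * norm (Z \<omega>) powr p"
        using True p by (intro mult_right_mono powr_mono2) auto
      finally show ?thesis using True by simp
    qed auto
  qed (use Zp in auto)
  then show ?thesis by simp
qed

lemma (in prob_space) truncated_mean:
  fixes Z :: "'a \<Rightarrow> 'b::{real_inner,banach,second_countable_topology}"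
  assumes Z: "integrable M Z" "expectation Z = 0" and Zp: "integrable M (\<lambda>\<omega>. norm (Z \<omega>) powr p)"
    and b: "0 < b" and p: "1 \<le> p"
  shows "norm (\<integral>\<omega>. (if norm (Z \<omega>) \<le> b then Z \<omega> else 0) \<partial>M)
    \<le> b powr (1 - p) * (\<integral>\<omega>. norm (Z \<omega>) powr p \<partial>M)"
proof -
  have [measurable]: "Z \<in> borel_measurable M" using Z by auto
  have tr: "integrable M (\<lambda>\<omega>. if norm (Z \<omega>) \<le> b then Z \<omega> else 0)"
    using b by (intro integrable_const_bound[where B = b]) auto
  have rest: "norm (Z \<omega> - (if norm (Z \<omega>) \<le> b then Z \<omega> else 0)) \<le> b powr (1 - p) * norm (Z \<omega>) powr p" for \<omega>
  proof (cases "norm (Z \<omega>) \<le> b")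
    case False
    then have pos: "0 < norm (Z \<omega>)" using b by linarith
    then have "norm (Z \<omega>) = norm (Z \<omega>) powr (1 - p) * norm (Z \<omega>) powr p"
      by (simp flip: powr_add)
    also have "\<dots> \<le> b powr (1 - p) * norm (Z \<omega>) powr p"
      using False p b by (intro mult_right_mono powr_mono2') auto
    finally show ?thesis using False by simp
  qed simp
  have "norm (\<integral>\<omega>. (if norm (Z \<omega>) \<le> b then Z \<omega> else 0) \<partial>M)
      = norm (\<integral>\<omega>. Z \<omega> - (if norm (Z \<omega>) \<le> b then Z \<omega> else 0) \<partial>M)"
    using Z tr by simp
  also have "\<dots> \<le> (\<integral>\<omega>. norm (Z \<omega> - (if norm (Z \<omega>) \<le> b then Z \<omega> else 0)) \<partial>M)"
    by (rule integral_norm_bound)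
  also have "\<dots> \<le> (\<integral>\<omega>. b powr (1 - p) * norm (Z \<omega>) powr p \<partial>M)"
    using rest Z tr Zp by (intro integral_mono) auto
  finally show ?thesis by simp
qed

lemma (in prob_space) tail_probability_le:
  fixes Z :: "'a \<Rightarrow> 'b::{real_normed_vector,second_countable_topology}"
  assumes [measurable]: "Z \<in> borel_measurable M" and Zp: "integrable M (\<lambda>\<omega>. norm (Z \<omega>) powr p)"
    and b: "0 < b" and p: "0 < p"
  shows "(\<integral>\<omega>. indicator {z. b < norm z} (Z \<omega>) \<partial>M) \<le> b powr (- p) * (\<integral>\<omega>. norm (Z \<omega>) powr p \<partial>M)"
proof -
  have "(\<integral>\<omega>. indicator {z. b < norm z} (Z \<omega>) \<partial>M) \<le> (\<integral>\<omega>. b powr (- p) * norm (Z \<omega>) powr p \<partial>M)"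
  proof (rule integral_mono)
    show "integrable M (\<lambda>\<omega>. indicator {z. b < norm z} (Z \<omega>) :: real)"
      by (intro integrable_const_bound[where B = 1]) (auto simp: indicator_def)
    fix \<omega>
    show "indicator {z. b < norm z} (Z \<omega>) \<le> b powr (- p) * norm (Z \<omega>) powr p"
    proof (cases "b < norm (Z \<omega>)")
      case True
      have "1 = b powr (- p) * b powr p" using b by (simp flip: powr_add)
      also have "\<dots> \<le> b powr (- p) * norm (Z \<omega>) powr p"
        using True b p by (intro mult_left_mono powr_mono2) auto
      finally show ?thesis using True by simp
    qed simp
  qed (use Zp in auto)
  then show ?thesis by simp
qed

lemma summable_square_times_power:
  fixes r :: real
  assumes "0 \<le> r" "r < 1"
  shows "summable (\<lambda>k. (real k + 1)\<^sup>2 * r ^ k)"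
proof (cases "r = 0")
  case False
  have "(\<lambda>k. norm ((real (Suc k) + 1)\<^sup>2 * r ^ Suc k) / norm ((real k + 1)\<^sup>2 * r ^ k)) \<longlonglongrightarrow> r"
  proof -
    have "(\<lambda>k. ((1 + 1 / real (Suc k))\<^sup>2) * r) \<longlonglongrightarrow> (1 + 0)\<^sup>2 * r"
      by (intro tendsto_intros tendsto_add[OF tendsto_const] LIMSEQ_Suc[OF lim_1_over_n])
    moreover have "norm ((real (Suc k) + 1)\<^sup>2 * r ^ Suc k) / norm ((real k + 1)\<^sup>2 * r ^ k)
        = ((1 + 1 / real (Suc k))\<^sup>2) * r" for k
    proof -
      have "1 + 1 / real (Suc k) = (real (Suc k) + 1) / (real k + 1)" by (simp add: field_simps)
      then show ?thesis using assms False by (simp add: power_divide abs_mult)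
    qed
    ultimately show ?thesis by simp
  qed
  then have "\<forall>\<^sub>F k in sequentially. norm ((real (Suc k) + 1)\<^sup>2 * r ^ Suc k) / norm ((real k + 1)\<^sup>2 * r ^ k) < (1 + r) / 2"
    using assms(2) by (intro order_tendstoD) auto
  then obtain N where N: "norm ((real (Suc k) + 1)\<^sup>2 * r ^ Suc k) / norm ((real k + 1)\<^sup>2 * r ^ k) < (1 + r) / 2"
      if "k \<ge> N" for k
    unfolding eventually_sequentially by blast
  show ?thesis
  proof (rule summable_ratio_test)
    show "(1 + r) / 2 < 1" using assms(2) by simp
    fix k assume "N \<le> k"
    have "0 < norm ((real k + 1)\<^sup>2 * r ^ k)"
      using False by simp
    with N[OF \<open>N \<le> k\<close>] show "norm ((real (Suc k) + 1)\<^sup>2 * r ^ Suc k) \<le> (1 + r) / 2 * norm ((real k + 1)\<^sup>2 * r ^ k)"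
      by (simp only: pos_divide_less_eq less_imp_le)
  qed
qed (simp add: summable_power_series)


text \<open>
  For \<open>N \<le> 2 ^ k\<close> truncate at \<open>b k = 2 powr (k / \<gamma>)\<close>. With \<open>r = 2 powr (1 - p / \<gamma>) < 1\<close> and up to the
  constant \<open>E \<parallel>Z 0\<parallel> powr p\<close>, three quantities are controlled: the expected number of truncated terms is
  at most \<open>r ^ k\<close>; the truncated means add up to at most \<open>b k * r ^ k\<close>; and, by the Rademacher-Menshov
  inequality, the second moment of the largest centred partial sum is at most
  \<open>(k + 1)\<^sup>2 * r ^ k * (b k)\<^sup>2\<close>. All of these are summable relative to \<open>b k\<close>, which leaves room for the
  factor \<open>(k + 1)\<^sup>2\<close>, and so pairwise independence is enough.
\<close>

theorem (in prob_space) marcinkiewicz_zygmund: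
  fixes Z :: "nat \<Rightarrow> 'a \<Rightarrow> 'b::{real_inner,banach,second_countable_topology}"
  assumes indep: "\<And>i j. i \<noteq> j \<Longrightarrow> indep_var borel (Z i) borel (Z j)"
    and distr: "\<And>i. distr M borel (Z i) = distr M borel (Z 0)"
    and Z0: "integrable M (Z 0)" "expectation (Z 0) = 0"
    and Zp: "integrable M (\<lambda>\<omega>. norm (Z 0 \<omega>) powr p)"
    and p: "1 < \<gamma>" "\<gamma> < p" "p \<le> 2"
  shows "AE \<omega> in M. (\<lambda>N. real N powr (- (1 / \<gamma>)) * norm (\<Sum>i<N. Z i \<omega>)) \<longlonglongrightarrow> 0"
proof -
  have meas [measurable]: "Z i \<in> borel_measurable M" for i
    using indep[of i "Suc i"] by (auto dest: indep_var_rv1)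
  define m where "m = (\<integral>\<omega>. norm (Z 0 \<omega>) powr p \<partial>M)"
  have m: "0 \<le> m" unfolding m_def by simp
  define b where "b k = 2 powr (real k / \<gamma>)" for k :: nat
  have b: "0 < b k" for k by (simp add: b_def)
  define r where "r = (2::real) powr (1 - p / \<gamma>)"
  have "1 - p / \<gamma> < 0" using p by simp
  then have r: "0 < r" "r < 1"
    using powr_less_mono[of "1 - p / \<gamma>" 0 2] by (simp_all add: r_def)
  have rk: "2 ^ k * b k powr (- p) = r ^ k" for k
  proof -
    have "2 ^ k * b k powr (- p) = 2 powr (real k) * 2 powr (real k / \<gamma> * (- p))"
      by (simp add: b_def powr_powr powr_realpow)
    also have "\<dots> = r powr (real k)"
      using p by (simp add: r_def powr_powr flip: powr_add) (simp add: field_simps)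
    finally show ?thesis using r by (simp add: powr_realpow)
  qed
  have same: "(\<integral>\<omega>. f (Z i \<omega>) \<partial>M) = (\<integral>\<omega>. f (Z 0 \<omega>) \<partial>M)"
    if [measurable]: "f \<in> borel_measurable borel" for f :: "'b \<Rightarrow> 'c::{banach,second_countable_topology}" and i
  proof -
    have "(\<integral>\<omega>. f (Z i \<omega>) \<partial>M) = (\<integral>z. f z \<partial>distr M borel (Z i))"
      by (rule integral_distr[symmetric]) auto
    also have "\<dots> = (\<integral>\<omega>. f (Z 0 \<omega>) \<partial>M)"
      unfolding distr[of i] by (rule integral_distr) auto
    finally show ?thesis .
  qed
  define tr where "tr k z = (if norm z \<le> b k then z else 0)" for k and z :: 'b
  have tr_meas [measurable]: "tr k \<in> borel_measurable borel" for k
    unfolding tr_def by measurable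
  define c where "c k = (\<integral>\<omega>. tr k (Z 0 \<omega>) \<partial>M)" for k
  define U where "U k i \<omega> = tr k (Z i \<omega>) - c k" for k i \<omega>
  have trb: "norm (tr k z) \<le> b k" for k z using b[of k] by (simp add: tr_def)
  have tr_int: "integrable M (\<lambda>\<omega>. tr k (Z i \<omega>))" for k i
    by (rule integrable_const_bound[where B = "b k"]) (auto simp: trb)
  have U_int: "integrable M (U k i)" "expectation (U k i) = 0" for k i
    using tr_int[of k i] same[of "tr k" i] unfolding U_def[abs_def]
    by (auto simp: c_def[symmetric] prob_space)
  have Ub: "norm (U k i \<omega>) \<le> b k + norm (c k)" for k i \<omega>
    using norm_triangle_ineq4[of "tr k (Z i \<omega>)" "c k"] trb[of k "Z i \<omega>"] by (simp add: U_def)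
  have U_meas [measurable]: "U k i \<in> borel_measurable M" for k i
    using U_int by auto
  have UU_int: "integrable M (\<lambda>\<omega>. inner (U k i \<omega>) (U k j \<omega>))" for k i j
  proof (rule integrable_const_bound)
    have "\<bar>inner (U k i \<omega>) (U k j \<omega>)\<bar> \<le> (b k + norm (c k)) * (b k + norm (c k))" for \<omega>
      using b[of k] by (intro order_trans[OF Cauchy_Schwarz_ineq2] mult_mono Ub) auto
    then show "AE \<omega> in M. norm (inner (U k i \<omega>) (U k j \<omega>)) \<le> (b k + norm (c k)) * (b k + norm (c k))"
      by simp
  qed measurable
  have orth: "(\<integral>\<omega>. inner (U k i \<omega>) (U k j \<omega>) \<partial>M) = 0" if "i \<noteq> j" for k i j
  proof -
    have "indep_var borel ((\<lambda>z. tr k z - c k) \<circ> Z i) borel ((\<lambda>z. tr k z - c k) \<circ> Z j)"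
      by (rule indep_var_compose[OF indep[OF that]]) measurable
    then have "indep_var borel (U k i) borel (U k j)" by (simp add: U_def[abs_def] o_def)
    from indep_var_integral_inner[OF this U_int(1) U_int(1) UU_int] show ?thesis
      by (simp add: U_int)
  qed
  have var: "(\<integral>\<omega>. (norm (U k i \<omega>))\<^sup>2 \<partial>M) \<le> b k powr (2 - p) * m" for k i
  proof -
    have sq_int: "integrable M (\<lambda>\<omega>. (norm (tr k (Z i \<omega>)))\<^sup>2)"
      by (rule integrable_const_bound[where B = "(b k)\<^sup>2"]) (auto simp: trb intro!: power_mono)
    have "(norm (U k i \<omega>))\<^sup>2 = (norm (tr k (Z i \<omega>)))\<^sup>2 - 2 * inner (tr k (Z i \<omega>)) (c k) + (norm (c k))\<^sup>2" for \<omega>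
      by (simp add: U_def power2_norm_eq_inner inner_diff inner_commute)
    then have "(\<integral>\<omega>. (norm (U k i \<omega>))\<^sup>2 \<partial>M)
        = (\<integral>\<omega>. (norm (tr k (Z i \<omega>)))\<^sup>2 \<partial>M) - 2 * inner (\<integral>\<omega>. tr k (Z i \<omega>) \<partial>M) (c k) + (norm (c k))\<^sup>2"
      using sq_int tr_int[of k i] by (simp add: prob_space)
    also have "\<dots> = (\<integral>\<omega>. (norm (tr k (Z 0 \<omega>)))\<^sup>2 \<partial>M) - (norm (c k))\<^sup>2"
      using same[of "tr k" i] same[of "\<lambda>z. (norm (tr k z))\<^sup>2" i]
      by (simp add: c_def[symmetric] power2_norm_eq_inner)
    also have "\<dots> \<le> (\<integral>\<omega>. (norm (tr k (Z 0 \<omega>)))\<^sup>2 \<partial>M)" by simp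
    also have "\<dots> \<le> b k powr (2 - p) * m"
      unfolding tr_def m_def by (rule truncated_second_moment[OF _ Zp b p(3)]) measurable
    finally show ?thesis .
  qed
  \<comment> \<open>The squared size, relative to \<open>b k\<close>, of the centred truncated partial sums up to \<open>2 ^ k\<close>.\<close>
  define D where "D k \<omega> = dyadic_majorant (\<lambda>i. U k i \<omega>) 0 k / (b k)\<^sup>2" for k \<omega>
  have AE_D: "AE \<omega> in M. (\<lambda>k. D k \<omega>) \<longlonglongrightarrow> 0"
  proof (rule AE_tendsto_zero_if_summable_integral)
    fix k
    have maj: "integrable M (\<lambda>\<omega>. dyadic_majorant (\<lambda>i. U k i \<omega>) 0 k)"
      "(\<integral>\<omega>. dyadic_majorant (\<lambda>i. U k i \<omega>) 0 k \<partial>M) \<le> (real k + 1)\<^sup>2 * (\<Sum>i<2^k. \<integral>\<omega>. (norm (U k (0 + i) \<omega>))\<^sup>2 \<partial>M)"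
      using integral_dyadic_majorant[of M "U k" 0 k] UU_int orth by auto
    show "integrable M (D k)" unfolding D_def[abs_def] using maj(1) by simp
    have "(\<integral>\<omega>. D k \<omega> \<partial>M) = (\<integral>\<omega>. dyadic_majorant (\<lambda>i. U k i \<omega>) 0 k \<partial>M) / (b k)\<^sup>2"
      unfolding D_def by simp
    also have "\<dots> \<le> (real k + 1)\<^sup>2 * (\<Sum>i<2^k. \<integral>\<omega>. (norm (U k (0 + i) \<omega>))\<^sup>2 \<partial>M) / (b k)\<^sup>2"
      by (intro divide_right_mono maj(2)) simp
    also have "\<dots> \<le> (real k + 1)\<^sup>2 * (\<Sum>i<(2::nat)^k. b k powr (2 - p) * m) / (b k)\<^sup>2"
      by (intro divide_right_mono mult_left_mono sum_mono var) simp_all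
    also have "\<dots> = (real k + 1)\<^sup>2 * r ^ k * m"
    proof -
      have "(b k)\<^sup>2 = b k powr 2" using b[of k] by simp
      then have "b k powr (2 - p) = b k powr (- p) * (b k)\<^sup>2" by (simp flip: powr_add)
      then show ?thesis using b[of k] by (simp flip: rk)
    qed
    finally show "(\<integral>\<omega>. D k \<omega> \<partial>M) \<le> (real k + 1)\<^sup>2 * r ^ k * m" .
  next
    show "0 \<le> D k \<omega>" for k \<omega> unfolding D_def by (simp add: dyadic_majorant_nonneg)
    show "summable (\<lambda>k. (real k + 1)\<^sup>2 * r ^ k * m)"
      using r by (intro summable_mult2 summable_square_times_power) auto
  qed
  \<comment> \<open>The number of terms changed by the truncation; once it is below 1, there are none.\<close>
  define E where "E k \<omega> = (\<Sum>i<2^k. indicator {z. b k < norm z} (Z i \<omega>) :: real)" for k :: nat and \<omega>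
  have AE_E: "AE \<omega> in M. (\<lambda>k. E k \<omega>) \<longlonglongrightarrow> 0"
  proof (rule AE_tendsto_zero_if_summable_integral)
    fix k
    have int: "integrable M (\<lambda>\<omega>. indicator {z. b k < norm z} (Z i \<omega>) :: real)" for i
      by (intro integrable_const_bound[where B = 1]) (auto simp: indicator_def)
    show "integrable M (E k)" unfolding E_def[abs_def] using int by simp
    have "(\<integral>\<omega>. E k \<omega> \<partial>M) = (\<Sum>i<2^k. \<integral>\<omega>. indicator {z. b k < norm z} (Z i \<omega>) \<partial>M)"
      unfolding E_def using int by simp
    also have "\<dots> = (\<Sum>i<(2::nat)^k. \<integral>\<omega>. indicator {z. b k < norm z} (Z 0 \<omega>) \<partial>M)"
      by (intro sum.cong refl same) measurable
    also have "\<dots> \<le> (\<Sum>i<(2::nat)^k. b k powr (- p) * m)"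
      unfolding m_def using p by (intro sum_mono tail_probability_le b Zp) auto
    also have "\<dots> = r ^ k * m" by (simp flip: rk)
    finally show "(\<integral>\<omega>. E k \<omega> \<partial>M) \<le> r ^ k * m" .
  next
    show "0 \<le> E k \<omega>" for k \<omega> unfolding E_def by (simp add: sum_nonneg)
    show "summable (\<lambda>k. r ^ k * m)" using r by (intro summable_mult2 summable_geometric) auto
  qed
  have c: "norm (c k) * 2 ^ k \<le> b k * (m * r ^ k)" for k
  proof -
    have "norm (c k) \<le> b k powr (1 - p) * m"
      unfolding c_def tr_def m_def using p by (intro truncated_mean Z0 Zp b) auto
    also have "b k powr (1 - p) = b k * b k powr (- p)"
      using b[of k] by (simp add: powr_diff powr_minus divide_inverse)
    finally show ?thesis
      by (simp add: mult_right_mono mult_ac flip: rk)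
  qed
  show ?thesis
    using AE_D AE_E
  proof eventually_elim
    case (elim \<omega>)
    define g where "g k = sqrt (D k \<omega>) + m * r ^ k" for k
    have "g \<longlonglongrightarrow> sqrt 0 + m * 0"
      unfolding g_def using r by (intro tendsto_intros elim LIMSEQ_power_zero) auto
    then have g0: "g \<longlonglongrightarrow> 0" by simp
    have g: "norm (\<Sum>i<N. Z i \<omega>) \<le> b k * g k" if "N \<le> 2 ^ k" "E k \<omega> < 1" for N k
    proof -
      have "Z i \<omega> = U k i \<omega> + c k" if "i < N" for i
      proof -
        have "indicator {z. b k < norm z} (Z i \<omega>) \<le> E k \<omega>"
          unfolding E_def using that \<open>N \<le> 2^k\<close> by (intro member_le_sum) auto
        then have "norm (Z i \<omega>) \<le> b k"
          using \<open>E k \<omega> < 1\<close> by (cases "b k < norm (Z i \<omega>)") auto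
        then show ?thesis by (simp add: U_def tr_def)
      qed
      then have "(\<Sum>i<N. Z i \<omega>) = (\<Sum>i<N. U k i \<omega>) + real N *\<^sub>R c k"
        by (simp add: sum.distrib sum_constant_scaleR)
      then have "norm (\<Sum>i<N. Z i \<omega>) \<le> norm (\<Sum>i<N. U k i \<omega>) + real N * norm (c k)"
        by (metis abs_of_nat norm_scaleR norm_triangle_ineq)
      also have "norm (\<Sum>i<N. U k i \<omega>) \<le> b k * sqrt (D k \<omega>)"
      proof (rule power2_le_imp_le)
        have "(norm (\<Sum>i<N. U k i \<omega>))\<^sup>2 \<le> dyadic_majorant (\<lambda>i. U k i \<omega>) 0 k"
          using norm_partial_sum_le_majorant[OF \<open>N \<le> 2^k\<close>, of "\<lambda>i. U k i \<omega>" 0] by simp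
        also have "\<dots> = (b k * sqrt (D k \<omega>))\<^sup>2"
          using b[of k] by (simp add: D_def power_mult_distrib dyadic_majorant_nonneg)
        finally show "(norm (\<Sum>i<N. U k i \<omega>))\<^sup>2 \<le> (b k * sqrt (D k \<omega>))\<^sup>2" .
        show "0 \<le> b k * sqrt (D k \<omega>)"
          using b[of k] by (simp add: D_def dyadic_majorant_nonneg)
      qed
      also have "real N * norm (c k) \<le> b k * (m * r ^ k)"
      proof -
        have "real N \<le> 2 ^ k" using \<open>N \<le> 2^k\<close> by (metis of_nat_le_iff of_nat_numeral of_nat_power)
        then have "real N * norm (c k) \<le> 2 ^ k * norm (c k)" by (rule mult_right_mono) simp
        then show ?thesis using c[of k] by (simp add: mult.commute)
      qed
      finally show ?thesis by (simp add: g_def algebra_simps)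
    qed
    show ?case
    proof (rule LIMSEQ_I)
      fix e :: real assume "0 < e"
      have "\<forall>\<^sub>F k in sequentially. E k \<omega> < 1 \<and> 2 powr (1 / \<gamma>) * g k < e"
      proof (rule eventually_conj)
        show "\<forall>\<^sub>F k in sequentially. E k \<omega> < 1" using elim by (intro order_tendstoD) auto
        have "(\<lambda>k. 2 powr (1 / \<gamma>) * g k) \<longlonglongrightarrow> 2 powr (1 / \<gamma>) * 0"
          by (intro tendsto_intros g0)
        then show "\<forall>\<^sub>F k in sequentially. 2 powr (1 / \<gamma>) * g k < e"
          using \<open>0 < e\<close> by (intro order_tendstoD) auto
      qed
      then obtain k0 where k0: "E k \<omega> < 1" "2 powr (1 / \<gamma>) * g k < e" if "k \<ge> k0" for k
        unfolding eventually_sequentially by blast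
      have "norm (real N powr (- (1 / \<gamma>)) * norm (\<Sum>i<N. Z i \<omega>) - 0) < e" if "N \<ge> 2 ^ k0" for N
      proof -
        have "1 \<le> N" using that by (metis one_le_numeral one_le_power order_trans)
        \<comment> \<open>The level \<open>k + 1\<close> covers \<open>N\<close>, and \<open>b (k + 1)\<close> exceeds \<open>N powr (1 / \<gamma>)\<close> at most by the factor
          \<open>2 powr (1 / \<gamma>)\<close>.\<close>
        from ex_power_ivl1[OF order_refl this] obtain k where k: "2 ^ k \<le> N" "N < 2 ^ (k + 1)" by auto
        have "k0 \<le> k"
        proof (rule ccontr)
          assume "\<not> k0 \<le> k"
          then have "(2::nat) ^ (k + 1) \<le> 2 ^ k0" by (intro power_increasing) auto
          then show False using that k by linarith
        qed
        have "real N powr (- (1 / \<gamma>)) \<le> (2 ^ k) powr (- (1 / \<gamma>))"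
        proof (rule powr_mono2')
          show "(2::real) ^ k \<le> real N" using k(1) by (metis of_nat_le_iff of_nat_numeral of_nat_power)
        qed (use p in auto)
        also have "(2 ^ k) powr (- (1 / \<gamma>)) = 2 powr (1 / \<gamma>) / b (k + 1)"
        proof -
          have "b (k + 1) = 2 powr (1 / \<gamma>) * b k"
            by (simp add: b_def add_divide_distrib powr_add)
          moreover have "(2 ^ k) powr (- (1 / \<gamma>)) = 1 / b k"
            by (simp add: b_def powr_powr powr_minus_divide flip: powr_realpow)
          ultimately show ?thesis by simp
        qed
        finally have "real N powr (- (1 / \<gamma>)) * norm (\<Sum>i<N. Z i \<omega>)
            \<le> 2 powr (1 / \<gamma>) / b (k + 1) * (b (k + 1) * g (k + 1))"
          using k(2) k0(1)[of "k + 1"] \<open>k0 \<le> k\<close> b[of "k + 1"] by (intro mult_mono g) auto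
        also have "\<dots> < e" using k0(2)[of "k + 1"] \<open>k0 \<le> k\<close> b[of "k + 1"] by simp
        finally show ?thesis by simp
      qed
      then show "\<exists>no. \<forall>N\<ge>no. norm (real N powr (- (1 / \<gamma>)) * norm (\<Sum>i<N. Z i \<omega>) - 0) < e" by blast
    qed
  qed
qed

section \<open>Rates for empirical operators\<close>

lemma summable_orthonormal_series:
  fixes e :: "nat \<Rightarrow> 'a::{real_inner,banach}"
  assumes e: "orthonormal e" and c: "\<And>n. (\<Sum>i<n. (c i)\<^sup>2) \<le> B"
  shows "summable (\<lambda>n. c n *\<^sub>R e (Suc n))"
  unfolding summable_Cauchy
proof (intro allI impI)
  fix r :: real assume "0 < r"
  have "summable (\<lambda>n. (c n)\<^sup>2)"
  proof (rule bounded_imp_summable)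
    show "(\<Sum>i\<le>n. (c i)\<^sup>2) \<le> B" for n using c[of "Suc n"] by (simp add: lessThan_Suc_atMost)
  qed simp
  then obtain N where N: "norm (\<Sum>i\<in>{m..<n}. (c i)\<^sup>2) < r\<^sup>2" if "m \<ge> N" for m n
    using \<open>0 < r\<close> unfolding summable_Cauchy by (metis zero_less_power)
  have "norm (\<Sum>i\<in>{m..<n}. c i *\<^sub>R e (Suc i)) < r" if "m \<ge> N" for m n
  proof (rule power_less_imp_less_base)
    have "(norm (\<Sum>i\<in>{m..<n}. c i *\<^sub>R e (Suc i)))\<^sup>2 = (norm (\<Sum>j\<in>Suc ` {m..<n}. c (j - 1) *\<^sub>R e j))\<^sup>2"
      by (subst sum.reindex) auto
    also have "\<dots> = (\<Sum>j\<in>Suc ` {m..<n}. (c (j - 1))\<^sup>2)"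
      by (rule norm_sum_orthonormal[OF e]) auto
    also have "\<dots> = (\<Sum>i\<in>{m..<n}. (c i)\<^sup>2)"
      by (subst sum.reindex) auto
    also have "\<dots> < r\<^sup>2" using N[OF that, of n] by simp
    finally show "(norm (\<Sum>i\<in>{m..<n}. c i *\<^sub>R e (Suc i)))\<^sup>2 < r\<^sup>2" .
  qed (use \<open>0 < r\<close> in simp)
  then show "\<exists>N. \<forall>m\<ge>N. \<forall>n. norm (\<Sum>i\<in>{m..<n}. c i *\<^sub>R e (Suc i)) < r" by blast
qed

text \<open>
  The operator \<open>z \<mapsto> \<langle>x, z\<rangle> y\<close> has the matrix \<open>\<langle>x, e a\<rangle> \<langle>y, e b\<rangle>\<close>. An enumeration of the index pairs makes
  this matrix the coordinate sequence of a vector of the same Hilbert space, whose norm is the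
  Hilbert-Schmidt norm of the operator. Limit theorems for random vectors then apply to random
  operators. The shift by \<open>Suc\<close> reconciles \<^const>\<open>prod_decode\<close>, which starts at 0, with orthonormal
  sequences, which start at 1.
\<close>

definition tensor_coordinate :: "(nat \<Rightarrow> 'a::real_inner) \<Rightarrow> 'a \<Rightarrow> 'a \<Rightarrow> nat \<Rightarrow> real" where
  "tensor_coordinate e x y n =
     inner x (e (Suc (fst (prod_decode n)))) * inner y (e (Suc (snd (prod_decode n))))"

definition tensor_embedding :: "(nat \<Rightarrow> 'a::{real_inner,banach}) \<Rightarrow> 'a \<Rightarrow> 'a \<Rightarrow> 'a" where
  "tensor_embedding e x y = (\<Sum>n. tensor_coordinate e x y n *\<^sub>R e (Suc n))"

lemma sum_tensor_coordinate_le: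
  assumes e: "orthonormal e" and "finite F"
  shows "(\<Sum>n\<in>F. (tensor_coordinate e x y n)\<^sup>2) \<le> (norm x * norm y)\<^sup>2"
proof -
  let ?A = "fst ` prod_decode ` F" and ?B = "snd ` prod_decode ` F"
  let ?f = "\<lambda>p. (inner x (e (Suc (fst p))))\<^sup>2 * (inner y (e (Suc (snd p))))\<^sup>2"
  have bes: "(\<Sum>a\<in>A. (inner z (e (Suc a)))\<^sup>2) \<le> (norm z)\<^sup>2" if "finite A" for z A
    using bessel[OF e, of "Suc ` A" z] that by (auto simp: sum.reindex)
  have "(\<Sum>n\<in>F. (tensor_coordinate e x y n)\<^sup>2) = (\<Sum>p\<in>prod_decode ` F. ?f p)"
    by (subst sum.reindex) (auto simp: tensor_coordinate_def power_mult_distrib inj_prod_decode inj_on_def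
        dest: inj_prod_decode[THEN injD])
  also have "\<dots> \<le> (\<Sum>p\<in>?A \<times> ?B. ?f p)"
    using \<open>finite F\<close> by (intro sum_mono2 subset_fst_snd) auto
  also have "\<dots> = (\<Sum>a\<in>?A. (inner x (e (Suc a)))\<^sup>2) * (\<Sum>b\<in>?B. (inner y (e (Suc b)))\<^sup>2)"
    by (simp add: sum_product sum.cartesian_product split_def)
  also have "\<dots> \<le> (norm x)\<^sup>2 * (norm y)\<^sup>2"
    using \<open>finite F\<close> by (intro mult_mono bes) (auto intro: sum_nonneg)
  finally show ?thesis by (simp add: power_mult_distrib)
qed

lemma summable_tensor_embedding:
  fixes e :: "nat \<Rightarrow> 'a::{real_inner,banach}"
  assumes "orthonormal e"
  shows "summable (\<lambda>n. tensor_coordinate e x y n *\<^sub>R e (Suc n))"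
  using sum_tensor_coordinate_le[OF assms finite_lessThan]
  by (rule summable_orthonormal_series[OF assms, where c = "tensor_coordinate e x y"])

lemma inner_tensor_embedding:
  assumes "orthonormal e"
  shows "inner (tensor_embedding e x y) (e (Suc n)) = tensor_coordinate e x y n"
proof -
  have "(\<lambda>m. inner (tensor_coordinate e x y m *\<^sub>R e (Suc m)) (e (Suc n)))
      sums inner (tensor_embedding e x y) (e (Suc n))"
    unfolding tensor_embedding_def
    by (intro bounded_linear.sums[OF bounded_linear_inner_left] summable_sums summable_tensor_embedding assms)
  moreover have "inner (tensor_coordinate e x y m *\<^sub>R e (Suc m)) (e (Suc n))
      = (if m = n then tensor_coordinate e x y n else 0)" for m
    using assms by (auto simp: orthonormal_def)
  ultimately show ?thesis
    using sums_single[of n "\<lambda>_. tensor_coordinate e x y n"] by (simp add: sums_unique2)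
qed

lemma norm_tensor_embedding_le:
  assumes "orthonormal e"
  shows "norm (tensor_embedding e x y) \<le> norm x * norm y"
proof (rule LIMSEQ_le_const2)
  show "(\<lambda>n. norm (\<Sum>i<n. tensor_coordinate e x y i *\<^sub>R e (Suc i))) \<longlonglongrightarrow> norm (tensor_embedding e x y)"
    unfolding tensor_embedding_def
    by (intro tendsto_norm summable_LIMSEQ summable_tensor_embedding assms)
  have "norm (\<Sum>i<n. tensor_coordinate e x y i *\<^sub>R e (Suc i)) \<le> norm x * norm y" for n
  proof (rule power2_le_imp_le)
    have "(norm (\<Sum>i<n. tensor_coordinate e x y i *\<^sub>R e (Suc i)))\<^sup>2
        = (norm (\<Sum>j\<in>Suc ` {..<n}. tensor_coordinate e x y (j - 1) *\<^sub>R e j))\<^sup>2"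
      by (subst sum.reindex) auto
    also have "\<dots> = (\<Sum>j\<in>Suc ` {..<n}. (tensor_coordinate e x y (j - 1))\<^sup>2)"
      by (rule norm_sum_orthonormal[OF assms]) auto
    also have "\<dots> = (\<Sum>i<n. (tensor_coordinate e x y i)\<^sup>2)"
      by (subst sum.reindex) auto
    also have "\<dots> \<le> (norm x * norm y)\<^sup>2" by (rule sum_tensor_coordinate_le[OF assms]) simp
    finally show "(norm (\<Sum>i<n. tensor_coordinate e x y i *\<^sub>R e (Suc i)))\<^sup>2 \<le> (norm x * norm y)\<^sup>2" .
  qed simp
  then show "\<exists>N. \<forall>n\<ge>N. norm (\<Sum>i<n. tensor_coordinate e x y i *\<^sub>R e (Suc i)) \<le> norm x * norm y" by blast
qed

lemma bounded_bilinear_tensor_embedding: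
  assumes "orthonormal e"
  shows "bounded_bilinear (tensor_embedding e)"
proof
  note s = summable_tensor_embedding[OF assms]
  fix x x' y y' and r :: real
  show "tensor_embedding e (x + x') y = tensor_embedding e x y + tensor_embedding e x' y"
    unfolding tensor_embedding_def suminf_add[OF s s]
    by (simp add: tensor_coordinate_def algebra_simps)
  show "tensor_embedding e x (y + y') = tensor_embedding e x y + tensor_embedding e x y'"
    unfolding tensor_embedding_def suminf_add[OF s s]
    by (simp add: tensor_coordinate_def algebra_simps)
  show "tensor_embedding e (r *\<^sub>R x) y = r *\<^sub>R tensor_embedding e x y"
    unfolding tensor_embedding_def suminf_scaleR_right[OF s]
    by (simp add: tensor_coordinate_def mult_ac)
  show "tensor_embedding e x (r *\<^sub>R y) = r *\<^sub>R tensor_embedding e x y"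
    unfolding tensor_embedding_def suminf_scaleR_right[OF s]
    by (simp add: tensor_coordinate_def mult_ac)
next
  show "\<exists>K. \<forall>x y. norm (tensor_embedding e x y) \<le> norm x * norm y * K"
    using norm_tensor_embedding_le[OF assms] by (intro exI[of _ 1]) simp
qed

lemma measurable_tensor_embedding:
  fixes e :: "nat \<Rightarrow> 'a::{real_inner,banach,second_countable_topology}"
  assumes "orthonormal e"
  shows "(\<lambda>p. tensor_embedding e (fst p) (snd p)) \<in> borel_measurable borel"
  by (intro borel_measurable_continuous_onI
      bounded_bilinear.continuous_on[OF bounded_bilinear_tensor_embedding[OF assms]] continuous_intros)

text \<open>
  The way back from vectors to operators: \<open>z\<close> holds the matrix of \<open>A\<close>, and the operator norm is at
  most the Hilbert-Schmidt norm.
\<close>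

lemma norm_le_embedded_matrix:
  fixes e :: "nat \<Rightarrow> 'a::real_inner"
  assumes e: "complete_orthonormal e" and A: "bounded_linear A"
    and z: "\<And>a b. inner (A (e (Suc a))) (e (Suc b)) = inner z (e (Suc (prod_encode (a, b))))"
  shows "norm (A x) \<le> norm z * norm x"
proof (rule norm_le_hilbert_schmidt[OF e A])
  have o: "orthonormal e" using e by (simp add: complete_orthonormal_def)
  fix n
  have "(\<Sum>a=1..n. \<Sum>b=1..m. (inner (A (e a)) (e b))\<^sup>2) \<le> (norm z)\<^sup>2" for m
  proof -
    let ?g = "\<lambda>p. Suc (prod_encode (fst p - 1, snd p - 1))"
    have "(\<Sum>a=1..n. \<Sum>b=1..m. (inner (A (e a)) (e b))\<^sup>2)
        = (\<Sum>p\<in>{1..n}\<times>{1..m}. (inner (A (e (fst p))) (e (snd p)))\<^sup>2)"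
      by (simp add: sum.cartesian_product split_def)
    also have "\<dots> = (\<Sum>p\<in>{1..n}\<times>{1..m}. (inner z (e (?g p)))\<^sup>2)"
    proof (rule sum.cong[OF refl])
      fix p assume "p \<in> {1..n}\<times>{1..m}"
      then show "(inner (A (e (fst p))) (e (snd p)))\<^sup>2 = (inner z (e (?g p)))\<^sup>2"
        using z[of "fst p - 1" "snd p - 1"] by auto
    qed
    also have "\<dots> = (\<Sum>k\<in>?g ` ({1..n}\<times>{1..m}). (inner z (e k))\<^sup>2)"
      by (subst sum.reindex) (auto simp: inj_on_def)
    also have "\<dots> \<le> (norm z)\<^sup>2" by (rule bessel[OF o]) auto
    finally show ?thesis .
  qed
  moreover have "(\<lambda>m. \<Sum>a=1..n. \<Sum>b=1..m. (inner (A (e a)) (e b))\<^sup>2) \<longlonglongrightarrow> (\<Sum>a=1..n. (norm (A (e a)))\<^sup>2)"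
    by (intro tendsto_sum parseval[OF e])
  ultimately show "(\<Sum>a=1..n. (norm (A (e a)))\<^sup>2) \<le> (norm z)\<^sup>2"
    by (intro LIMSEQ_le_const2) auto
qed simp

lemma (in prob_space) bounded_linear_integral_tensor:
  fixes U V :: "'a \<Rightarrow> 'b::{real_inner,banach,second_countable_topology}"
  assumes [measurable]: "U \<in> borel_measurable M" "V \<in> borel_measurable M"
    and UV: "integrable M (\<lambda>\<omega>. norm (U \<omega>) * norm (V \<omega>))"
  shows "integrable M (\<lambda>\<omega>. inner (U \<omega>) x *\<^sub>R V \<omega>)"
    and "bounded_linear (\<lambda>x. \<integral>\<omega>. inner (U \<omega>) x *\<^sub>R V \<omega> \<partial>M)"
proof -
  have bd: "norm (inner (U \<omega>) x *\<^sub>R V \<omega>) \<le> norm (U \<omega>) * norm (V \<omega>) * norm x" for \<omega> x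
    using mult_right_mono[OF Cauchy_Schwarz_ineq2[of "U \<omega>" x], of "norm (V \<omega>)"] by (simp add: mult_ac)
  show int: "integrable M (\<lambda>\<omega>. inner (U \<omega>) x *\<^sub>R V \<omega>)" for x
  proof (rule Bochner_Integration.integrable_bound)
    show "integrable M (\<lambda>\<omega>. norm (U \<omega>) * norm (V \<omega>) * norm x)" using UV by simp
    show "AE \<omega> in M. norm (inner (U \<omega>) x *\<^sub>R V \<omega>) \<le> norm (norm (U \<omega>) * norm (V \<omega>) * norm x)"
      using bd by simp
  qed measurable
  show "bounded_linear (\<lambda>x. \<integral>\<omega>. inner (U \<omega>) x *\<^sub>R V \<omega> \<partial>M)"
  proof (rule bounded_linear_intro[where K = "\<integral>\<omega>. norm (U \<omega>) * norm (V \<omega>) \<partial>M"])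
    fix x y and r :: real
    show "(\<integral>\<omega>. inner (U \<omega>) (x + y) *\<^sub>R V \<omega> \<partial>M) = (\<integral>\<omega>. inner (U \<omega>) x *\<^sub>R V \<omega> \<partial>M) + (\<integral>\<omega>. inner (U \<omega>) y *\<^sub>R V \<omega> \<partial>M)"
      using int by (simp add: inner_add_right scaleR_add_left)
    show "(\<integral>\<omega>. inner (U \<omega>) (r *\<^sub>R x) *\<^sub>R V \<omega> \<partial>M) = r *\<^sub>R (\<integral>\<omega>. inner (U \<omega>) x *\<^sub>R V \<omega> \<partial>M)"
      by (simp flip: integral_scaleR_right)
    have "norm (\<integral>\<omega>. inner (U \<omega>) x *\<^sub>R V \<omega> \<partial>M) \<le> (\<integral>\<omega>. norm (inner (U \<omega>) x *\<^sub>R V \<omega>) \<partial>M)"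
      by (rule integral_norm_bound)
    also have "\<dots> \<le> (\<integral>\<omega>. norm (U \<omega>) * norm (V \<omega>) * norm x \<partial>M)"
      using int[THEN integrable_norm] bd UV by (intro integral_mono) auto
    finally show "norm (\<integral>\<omega>. inner (U \<omega>) x *\<^sub>R V \<omega> \<partial>M) \<le> norm x * (\<integral>\<omega>. norm (U \<omega>) * norm (V \<omega>) \<partial>M)"
      by (simp add: mult.commute)
  qed
qed

lemma powr_add_le:
  fixes a b p :: real
  assumes "0 \<le> a" "0 \<le> b" "0 \<le> p"
  shows "(a + b) powr p \<le> 2 powr p * (a powr p + b powr p)"
proof -
  have "(a + b) powr p \<le> (2 * max a b) powr p" using assms by (intro powr_mono2) auto
  also have "\<dots> = 2 powr p * (max a b powr p)" using assms by (simp add: powr_mult)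
  also have "\<dots> \<le> 2 powr p * (a powr p + b powr p)"
    by (intro mult_left_mono) (auto simp: max_def)
  finally show ?thesis .
qed

lemma (in finite_measure) integrable_powr_less:
  fixes f :: "'a \<Rightarrow> real"
  assumes f: "integrable M (\<lambda>\<omega>. f \<omega> powr p)" and [measurable]: "f \<in> borel_measurable M"
    and "\<And>\<omega>. 0 \<le> f \<omega>" "0 \<le> q" "q \<le> p"
  shows "integrable M (\<lambda>\<omega>. f \<omega> powr q)"
proof (rule Bochner_Integration.integrable_bound)
  show "integrable M (\<lambda>\<omega>. 1 + f \<omega> powr p)" using f by simp
  have "f \<omega> powr q \<le> 1 + f \<omega> powr p" for \<omega>
  proof (cases "1 \<le> f \<omega>")
    case True
    then have "f \<omega> powr q \<le> f \<omega> powr p" using assms(5) by (intro powr_mono) auto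
    then show ?thesis by simp
  next
    case False
    then have "f \<omega> powr q \<le> 1" using assms(3)[of \<omega>] assms(4) by (intro powr_le1) auto
    moreover have "0 \<le> f \<omega> powr p" by simp
    ultimately show ?thesis by linarith
  qed
  then show "AE \<omega> in M. norm (f \<omega> powr q) \<le> norm (1 + f \<omega> powr p)" by simp
qed measurable

text \<open>
  The strong law for the embedded operators \<open>z \<mapsto> \<langle>U i, z\<rangle> V i\<close>, read in the operator norm.
\<close>

theorem (in prob_space) empirical_operator_rate:
  fixes U V :: "nat \<Rightarrow> 'a \<Rightarrow> 'b::{real_inner,banach,second_countable_topology}" and e :: "nat \<Rightarrow> 'b"
  assumes e: "complete_orthonormal e"
    and indep: "\<And>i j. 1 \<le> i \<Longrightarrow> 1 \<le> j \<Longrightarrow> i \<noteq> j \<Longrightarrow>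
      indep_var borel (\<lambda>\<omega>. (U i \<omega>, V i \<omega>)) borel (\<lambda>\<omega>. (U j \<omega>, V j \<omega>))"
    and distr: "\<And>i. 1 \<le> i \<Longrightarrow> distr M borel (\<lambda>\<omega>. (U i \<omega>, V i \<omega>)) = distr M borel (\<lambda>\<omega>. (U 1 \<omega>, V 1 \<omega>))"
    and mom: "integrable M (\<lambda>\<omega>. (norm (U 1 \<omega>) * norm (V 1 \<omega>)) powr p)"
    and p: "1 < \<gamma>" "\<gamma> < p" "p \<le> 2"
  shows "\<exists>\<delta>. (\<forall>N \<omega>. 0 \<le> \<delta> N \<omega>) \<and> (AE \<omega> in M. (\<lambda>N. real N powr (1 - 1 / \<gamma>) * \<delta> N \<omega>) \<longlonglongrightarrow> 0) \<and>
     (\<forall>N\<ge>1. \<forall>\<omega> x. norm ((1 / real N) *\<^sub>R (\<Sum>i=1..N. inner (U i \<omega>) x *\<^sub>R V i \<omega>)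
        - (\<integral>\<omega>. inner (U 1 \<omega>) x *\<^sub>R V 1 \<omega> \<partial>M)) \<le> \<delta> N \<omega> * norm x)"
proof -
  have o: "orthonormal e" using e by (simp add: complete_orthonormal_def)
  let ?J = "tensor_embedding e"
  note [measurable] = measurable_tensor_embedding[OF o]
  have W [measurable]: "(\<lambda>\<omega>. (U i \<omega>, V i \<omega>)) \<in> borel_measurable M" if "1 \<le> i" for i
    using indep[of i "Suc i"] that by (auto dest: indep_var_rv1)
  have UV [measurable]: "U i \<in> borel_measurable M" "V i \<in> borel_measurable M" if "1 \<le> i" for i
    using measurable_compose[OF W[OF that], of fst borel] measurable_compose[OF W[OF that], of snd borel]
    by (auto simp flip: borel_prod)
  have J [measurable]: "(\<lambda>\<omega>. ?J (U i \<omega>) (V i \<omega>)) \<in> borel_measurable M" if "1 \<le> i" for i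
    using measurable_compose[OF W[OF that] measurable_tensor_embedding[OF o]] by simp
  note UVm = UV(1)[OF order_refl] UV(2)[OF order_refl]
  have UV1: "integrable M (\<lambda>\<omega>. norm (U 1 \<omega>) * norm (V 1 \<omega>))"
    using integrable_powr_less[OF mom, of 1] p by simp
  have J1: "integrable M (\<lambda>\<omega>. ?J (U 1 \<omega>) (V 1 \<omega>))"
    by (rule Bochner_Integration.integrable_bound[OF UV1]) (auto simp: norm_tensor_embedding_le[OF o])
  define \<mu> where "\<mu> = (\<integral>\<omega>. ?J (U 1 \<omega>) (V 1 \<omega>) \<partial>M)"
  define h where "h q = ?J (fst q) (snd q) - \<mu>" for q
  have h [measurable]: "h \<in> borel_measurable borel" unfolding h_def[abs_def] by measurable
  define Z where "Z i \<omega> = h (U (Suc i) \<omega>, V (Suc i) \<omega>)" for i \<omega>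
  have Z0p: "integrable M (\<lambda>\<omega>. norm (Z 0 \<omega>) powr p)"
  proof (rule Bochner_Integration.integrable_bound)
    show "integrable M (\<lambda>\<omega>. 2 powr p * ((norm (U 1 \<omega>) * norm (V 1 \<omega>)) powr p + norm \<mu> powr p))"
      using mom by simp
    have "norm (Z 0 \<omega>) powr p \<le> 2 powr p * ((norm (U 1 \<omega>) * norm (V 1 \<omega>)) powr p + norm \<mu> powr p)" for \<omega>
    proof -
      have "norm (Z 0 \<omega>) \<le> norm (U 1 \<omega>) * norm (V 1 \<omega>) + norm \<mu>"
        using norm_triangle_ineq4[of "?J (U 1 \<omega>) (V 1 \<omega>)" \<mu>] norm_tensor_embedding_le[OF o, of "U 1 \<omega>" "V 1 \<omega>"]
        by (simp add: Z_def h_def)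
      then have "norm (Z 0 \<omega>) powr p \<le> (norm (U 1 \<omega>) * norm (V 1 \<omega>) + norm \<mu>) powr p"
        using p by (intro powr_mono2) auto
      also have "\<dots> \<le> 2 powr p * ((norm (U 1 \<omega>) * norm (V 1 \<omega>)) powr p + norm \<mu> powr p)"
        using p by (intro powr_add_le) auto
      finally show ?thesis .
    qed
    then show "AE \<omega> in M. norm (norm (Z 0 \<omega>) powr p) \<le> norm (2 powr p * ((norm (U 1 \<omega>) * norm (V 1 \<omega>)) powr p + norm \<mu> powr p))"
      by (intro AE_I2) (simp add: order_trans[OF _ abs_ge_self])
    show "(\<lambda>\<omega>. norm (Z 0 \<omega>) powr p) \<in> borel_measurable M"
      unfolding Z_def using measurable_compose[OF W[of 1] h] by simp
  qed
  have lln: "AE \<omega> in M. (\<lambda>N. real N powr (- (1 / \<gamma>)) * norm (\<Sum>i<N. Z i \<omega>)) \<longlonglongrightarrow> 0"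
  proof (rule marcinkiewicz_zygmund[where Z = Z, OF _ _ _ _ Z0p p])
    show "indep_var borel (Z i) borel (Z j)" if "i \<noteq> j" for i j
      using indep_var_compose[OF indep[of "Suc i" "Suc j"] h h] that by (simp add: o_def Z_def[abs_def])
    show "distr M borel (Z i) = distr M borel (Z 0)" for i
    proof -
      have "distr M borel (Z i) = distr (distr M borel (\<lambda>\<omega>. (U (Suc i) \<omega>, V (Suc i) \<omega>))) borel h" for i
        by (subst distr_distr) (auto simp: W o_def Z_def[abs_def])
      then show ?thesis using distr[of "Suc i"] by simp
    qed
    show "integrable M (Z 0)" using J1 by (simp add: Z_def[abs_def] h_def)
    show "expectation (Z 0) = 0" using J1 by (simp add: Z_def[abs_def] h_def \<mu>_def prob_space)
  qed
  define \<delta> where "\<delta> N \<omega> = norm ((1 / real N) *\<^sub>R (\<Sum>i<N. Z i \<omega>))" for N \<omega>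
  have "real N powr (1 - 1 / \<gamma>) * \<delta> N \<omega> = real N powr (- (1 / \<gamma>)) * norm (\<Sum>i<N. Z i \<omega>)" for N \<omega>
    by (cases "N = 0") (simp_all add: \<delta>_def powr_diff powr_minus divide_inverse)
  with lln have "AE \<omega> in M. (\<lambda>N. real N powr (1 - 1 / \<gamma>) * \<delta> N \<omega>) \<longlonglongrightarrow> 0" by simp
  moreover have "norm ((1 / real N) *\<^sub>R (\<Sum>i=1..N. inner (U i \<omega>) x *\<^sub>R V i \<omega>)
        - (\<integral>\<omega>. inner (U 1 \<omega>) x *\<^sub>R V 1 \<omega> \<partial>M)) \<le> \<delta> N \<omega> * norm x" if "1 \<le> N" for N \<omega> x
    unfolding \<delta>_def
  proof (rule norm_le_embedded_matrix[OF e])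
    show "bounded_linear (\<lambda>x. (1 / real N) *\<^sub>R (\<Sum>i=1..N. inner (U i \<omega>) x *\<^sub>R V i \<omega>)
        - (\<integral>\<omega>. inner (U 1 \<omega>) x *\<^sub>R V 1 \<omega> \<partial>M))"
      by (intro bounded_linear_sub bounded_linear_sum bounded_linear_compose[OF bounded_linear_scaleR_right]
          bounded_linear_scaleR_const bounded_linear_inner_right bounded_linear_integral_tensor UVm UV1)
    fix a b
    let ?n = "Suc (prod_encode (a, b))"
    have c: "inner (?J x y) (e ?n) = inner x (e (Suc a)) * inner y (e (Suc b))" for x y
      by (simp add: inner_tensor_embedding[OF o] tensor_coordinate_def)
    have "inner \<mu> (e ?n) = (\<integral>\<omega>. inner (U 1 \<omega>) (e (Suc a)) * inner (V 1 \<omega>) (e (Suc b)) \<partial>M)"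
      unfolding \<mu>_def using J1 by (subst integral_inner_left[symmetric]) (auto simp: c)
    also have "\<dots> = inner (\<integral>\<omega>. inner (U 1 \<omega>) (e (Suc a)) *\<^sub>R V 1 \<omega> \<partial>M) (e (Suc b))"
      using bounded_linear_integral_tensor(1)[OF UVm UV1, of "e (Suc a)"]
      by (subst integral_inner_left[symmetric]) auto
    finally have mu: "inner \<mu> (e ?n) = inner (\<integral>\<omega>. inner (U 1 \<omega>) (e (Suc a)) *\<^sub>R V 1 \<omega> \<partial>M) (e (Suc b))" .
    have "(\<Sum>i<N. Z i \<omega>) = (\<Sum>i=1..N. ?J (U i \<omega>) (V i \<omega>)) - real N *\<^sub>R \<mu>"
      unfolding Z_def h_def by (simp add: sum_subtractf sum_constant_scaleR lessThan_Suc_atMost sum.atLeast1_atMost_eq)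
    then have "(1 / real N) *\<^sub>R (\<Sum>i<N. Z i \<omega>) = (1 / real N) *\<^sub>R (\<Sum>i=1..N. ?J (U i \<omega>) (V i \<omega>)) - \<mu>"
      using that by (simp add: scaleR_diff_right)
    then show "inner ((1 / real N) *\<^sub>R (\<Sum>i=1..N. inner (U i \<omega>) (e (Suc a)) *\<^sub>R V i \<omega>)
        - (\<integral>\<omega>. inner (U 1 \<omega>) (e (Suc a)) *\<^sub>R V 1 \<omega> \<partial>M)) (e (Suc b))
      = inner ((1 / real N) *\<^sub>R (\<Sum>i<N. Z i \<omega>)) (e ?n)"
      by (simp add: inner_diff_left inner_sum_left c mu)
  qed
  moreover have "0 \<le> \<delta> N \<omega>" for N \<omega> by (simp add: \<delta>_def)
  ultimately show ?thesis by blast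
qed

section \<open>Consistency of spectrally truncated inversion\<close>

text \<open>
  As the \<open>Q N\<close> are contractions, convergence to 0 passes from the span of the basis to its closure.
\<close>

lemma strongly_null_if_null_on_basis:
  fixes Q :: "nat \<Rightarrow> 'a::real_inner \<Rightarrow> 'a"
  assumes e: "complete_orthonormal e"
    and Q: "\<And>N. 1 \<le> N \<Longrightarrow> linear (Q N)" "\<And>N x. 1 \<le> N \<Longrightarrow> norm (Q N x) \<le> norm x"
    and lim: "\<And>j. 1 \<le> j \<Longrightarrow> (\<lambda>N. Q N (e j)) \<longlonglongrightarrow> 0"
  shows "(\<lambda>N. Q N y) \<longlonglongrightarrow> 0"
proof (rule LIMSEQ_I)
  fix r :: real assume "0 < r"
  have sp: "(\<lambda>N. Q N z) \<longlonglongrightarrow> 0" if "z \<in> span (e ` {1..})" for z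
    using that
  proof (induction rule: span_induct_alt)
    case base
    have "\<forall>\<^sub>F N in sequentially. Q N 0 = 0"
      using eventually_ge_at_top[of 1] by eventually_elim (rule linear_0[OF Q(1)])
    then show ?case by (rule tendsto_eventually)
  next
    case (step c x y)
    have "(\<lambda>N. c *\<^sub>R Q N x + Q N y) \<longlonglongrightarrow> c *\<^sub>R 0 + 0"
      using step lim by (intro tendsto_intros) auto
    moreover have "\<forall>\<^sub>F N in sequentially. c *\<^sub>R Q N x + Q N y = Q N (c *\<^sub>R x + y)"
      using eventually_ge_at_top[of 1]
      by eventually_elim (simp add: linear_add[OF Q(1)] linear_scale[OF Q(1)])
    ultimately show ?case by (simp add: Lim_transform_eventually)
  qed
  have "y \<in> closure (span (e ` {1..}))" using e by (auto simp: complete_orthonormal_def)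
  then obtain z where z: "z \<in> span (e ` {1..})" "dist z y < r / 2"
    using \<open>0 < r\<close> unfolding closure_approachable by (metis half_gt_zero)
  obtain N0 where N0: "norm (Q N z - 0) < r / 2" if "N \<ge> N0" for N
    using LIMSEQ_D[OF sp[OF z(1)], of "r / 2"] \<open>0 < r\<close> by auto
  have "norm (Q N y - 0) < r" if "N \<ge> max 1 N0" for N
  proof -
    have N: "1 \<le> N" "N0 \<le> N" using that by auto
    have "Q N y = Q N (y - z) + Q N z" by (simp add: linear_diff[OF Q(1)[OF N(1)]])
    then have "norm (Q N y) \<le> norm (Q N (y - z)) + norm (Q N z)" by (simp add: norm_triangle_ineq)
    also have "\<dots> < r / 2 + r / 2"
      using Q(2)[OF N(1), of "y - z"] z(2) N0[OF N(2)] by (intro add_strict_mono) (auto simp: dist_norm norm_minus_commute)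
    finally show ?thesis by simp
  qed
  then show "\<exists>no. \<forall>N\<ge>no. norm (Q N y - 0) < r" by blast
qed

text \<open>
  The squared Hilbert-Schmidt norm of \<open>Q N \<circ> A\<close> is \<open>\<Sum>j. \<parallel>Q N (A (e j))\<parallel>\<^sup>2\<close>. Each term tends to 0 and is
  dominated by the summable \<open>\<parallel>A (e j)\<parallel>\<^sup>2\<close>, so the sum tends to 0 by Tannery's theorem.
\<close>

lemma uniformly_null_on_hilbert_schmidt:
  fixes Q :: "nat \<Rightarrow> 'a::real_inner \<Rightarrow> 'a" and A :: "'a \<Rightarrow> 'a"
  assumes e: "complete_orthonormal e"
    and Q: "\<And>N. 1 \<le> N \<Longrightarrow> bounded_linear (Q N)" "\<And>N x. 1 \<le> N \<Longrightarrow> norm (Q N x) \<le> norm x"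
    and lim: "\<And>y. (\<lambda>N. Q N y) \<longlonglongrightarrow> 0"
    and A: "bounded_linear A" and H: "\<And>n. (\<Sum>j=1..n. (norm (A (e j)))\<^sup>2) \<le> H"
  shows "\<exists>b. b \<longlonglongrightarrow> 0 \<and> (\<forall>N\<ge>1. \<forall>x. norm (Q N (A x)) \<le> b N * norm x)"
proof -
  have sumA: "summable (\<lambda>k. (norm (A (e (Suc k))))\<^sup>2)"
  proof (rule bounded_imp_summable)
    fix n
    have "(\<Sum>k\<le>n. (norm (A (e (Suc k))))\<^sup>2) = (\<Sum>j=1..Suc n. (norm (A (e j)))\<^sup>2)"
      unfolding One_nat_def sum.atLeast1_atMost_eq lessThan_Suc_atMost by (rule refl)
    then show "(\<Sum>k\<le>n. (norm (A (e (Suc k))))\<^sup>2) \<le> H" using H[of "Suc n"] by simp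
  qed simp
  let ?a = "\<lambda>k N. (norm (Q N (A (e (Suc k)))))\<^sup>2"
  have le: "?a k N \<le> (norm (A (e (Suc k))))\<^sup>2" if "1 \<le> N" for k N
    using Q(2)[OF that] by (intro power_mono) auto
  have "(\<lambda>N. \<Sum>k. ?a k N) \<longlonglongrightarrow> (\<Sum>k. 0)"
  proof (rule tannerys_theorem[THEN conjunct2, THEN conjunct2])
    show "(\<lambda>N. ?a k N) \<longlonglongrightarrow> 0" for k
      using tendsto_power[OF tendsto_norm[OF lim[of "A (e (Suc k))"]], of 2] by simp
    have "\<forall>\<^sub>F (k :: nat, N) in at_top \<times>\<^sub>F sequentially. 1 \<le> N"
      using eventually_prod2[of "sequentially" "\<lambda>N. 1 \<le> N" sequentially] eventually_ge_at_top[of "1::nat"]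
      by (simp add: split_def)
    then show "\<forall>\<^sub>F (k, N) in at_top \<times>\<^sub>F sequentially. norm (?a k N) \<le> (norm (A (e (Suc k))))\<^sup>2"
      by (rule eventually_mono) (use le in auto)
  qed (use sumA in auto)
  then have "(\<lambda>N. sqrt (\<Sum>k. ?a k N)) \<longlonglongrightarrow> sqrt 0" by (intro tendsto_real_sqrt) simp
  moreover have "norm (Q N (A x)) \<le> sqrt (\<Sum>k. ?a k N) * norm x" if "1 \<le> N" for N x
  proof (rule norm_le_hilbert_schmidt[OF e])
    show "bounded_linear (\<lambda>x. Q N (A x))" by (rule bounded_linear_compose[OF Q(1)[OF that] A])
    have sm: "summable (\<lambda>k. ?a k N)"
      using le[OF that] by (intro summable_comparison_test'[OF sumA]) auto
    show "0 \<le> sqrt (\<Sum>k. ?a k N)" using sm by (simp add: suminf_nonneg)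
    fix n
    have "(\<Sum>j=1..n. (norm (Q N (A (e j))))\<^sup>2) = (\<Sum>k<n. ?a k N)"
      by (simp add: sum.atLeast1_atMost_eq)
    also have "\<dots> \<le> (\<Sum>k. ?a k N)" using sm by (intro sum_le_suminf) auto
    also have "\<dots> = (sqrt (\<Sum>k. ?a k N))\<^sup>2" using sm by (simp add: suminf_nonneg)
    finally show "(\<Sum>j=1..n. (norm (Q N (A (e j))))\<^sup>2) \<le> (sqrt (\<Sum>k. ?a k N))\<^sup>2" .
  qed
  ultimately show ?thesis by (intro exI[of _ "\<lambda>N. sqrt (\<Sum>k. ?a k N)"]) simp
qed

text \<open>
  For self-adjoint \<open>Q\<close> the operators \<open>A \<circ> Q\<close> and \<open>Q \<circ> A'\<close> are adjoint to each other and have the same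
  norm.
\<close>

lemma norm_le_by_adjoint:
  fixes A A' Q :: "'a::real_inner \<Rightarrow> 'a"
  assumes A: "\<And>x y. inner (A x) y = inner x (A' y)" and Q: "\<And>x y. inner (Q x) y = inner x (Q y)"
    and b: "\<And>y. norm (Q (A' y)) \<le> b * norm y"
  shows "norm (A (Q x)) \<le> b * norm x"
proof (cases "A (Q x) = 0")
  case True
  have "0 \<le> b * norm x" using b[of x] norm_ge_zero order_trans by blast
  then show ?thesis using True by simp
next
  case False
  have "norm (A (Q x)) * norm (A (Q x)) = inner x (Q (A' (A (Q x))))"
    using A[of "Q x" "A (Q x)"] Q[of x "A' (A (Q x))"] by (simp add: power2_norm_eq_inner flip: power2_eq_square)
  also have "\<dots> \<le> norm x * norm (Q (A' (A (Q x))))" by (rule norm_cauchy_schwarz)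
  also have "\<dots> \<le> norm x * (b * norm (A (Q x)))" by (intro mult_left_mono b) simp
  finally have "norm (A (Q x)) * norm (A (Q x)) \<le> (b * norm x) * norm (A (Q x))" by (simp add: mult_ac)
  then show ?thesis using False by (simp add: mult_le_cancel_right)
qed

lemma residual_tendsto_zero:
  fixes S :: "nat \<Rightarrow> 'a::real_inner \<Rightarrow> 'a"
  assumes T: "eigenbasis T lam e" "bounded_linear T" and gap: "\<And>j. 1 \<le> j \<Longrightarrow> lam (j + 1) < lam j"
    and S: "\<And>N. 1 \<le> N \<Longrightarrow> eigenbasis (S N) (mu N) (f N)" "\<And>N. 1 \<le> N \<Longrightarrow> bounded_linear (S N)"
    and sym: "\<And>N x y. 1 \<le> N \<Longrightarrow> inner (S N x) y = inner x (S N y)"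
    and d: "\<And>N x. 1 \<le> N \<Longrightarrow> norm (S N x - T x) \<le> d N * norm x" "d \<longlonglongrightarrow> 0"
    and n: "filterlim n at_top sequentially"
  shows "(\<lambda>N. y - proj (f N) (n N) y) \<longlonglongrightarrow> 0"
proof (rule strongly_null_if_null_on_basis)
  have of: "orthonormal (f N)" if "1 \<le> N" for N
    using S(1)[OF that] by (simp add: eigenbasis_def complete_orthonormal_def)
  show "complete_orthonormal e" using T(1) by (simp add: eigenbasis_def)
  show "linear (\<lambda>y. y - proj (f N) (n N) y)" for N
    by (intro linear_compose_sub linear_proj) (simp add: linear_iff)
  show "norm (y - proj (f N) (n N) y) \<le> norm y" if "1 \<le> N" for N y
    by (rule norm_residual_le[OF of[OF that]])
  fix j :: nat assume j: "1 \<le> j"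
  let ?g = "lam j - lam (j + 1)"
  have g: "0 < ?g" using gap[OF j] by simp
  show "(\<lambda>N. e j - proj (f N) (n N) (e j)) \<longlonglongrightarrow> 0"
  proof (rule Lim_null_comparison)
    have "\<forall>\<^sub>F N in sequentially. d N < ?g / 2" using d(2) g by (intro order_tendstoD) auto
    moreover have "\<forall>\<^sub>F N in sequentially. j \<le> n N" using n by (simp add: filterlim_at_top)
    ultimately show "\<forall>\<^sub>F N in sequentially. norm (e j - proj (f N) (n N) (e j)) \<le> 2 / ?g * d N"
      using eventually_ge_at_top[of 1]
    proof eventually_elim
      case (elim N)
      let ?z = "norm (e j - proj (f N) (n N) (e j))"
      have "(?g - d N) * ?z \<le> d N"
        by (rule residual_eigenvector_bound[OF T S(1)[OF elim(3)] S(2)[OF elim(3)]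
              sym[OF elim(3)] d(1)[OF elim(3)] j elim(2)])
      moreover have "?g / 2 * ?z \<le> (?g - d N) * ?z" using elim(1) by (intro mult_right_mono) auto
      ultimately have "?g / 2 * ?z \<le> d N" by linarith
      then show ?case using g by (simp add: field_simps)
    qed
    show "(\<lambda>N. 2 / ?g * d N) \<longlonglongrightarrow> 0" using tendsto_mult_right_zero[OF d(2)] by blast
  qed
qed

definition spectral_cutoff_inverse :: "(nat \<Rightarrow> real) \<Rightarrow> (nat \<Rightarrow> 'a::real_inner) \<Rightarrow> nat \<Rightarrow> 'a \<Rightarrow> 'a" where
  "spectral_cutoff_inverse mu f n x = (\<Sum>l=1..n. (inner x (f l) / mu l) *\<^sub>R f l)"

lemma norm_spectral_cutoff_inverse_le:
  assumes S: "eigenbasis S mu f" and "1 \<le> n" "0 < c" "c \<le> mu n"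
  shows "norm (spectral_cutoff_inverse mu f n x) \<le> norm x / c"
proof (rule power2_le_imp_le)
  have o: "orthonormal f" using S by (simp add: eigenbasis_def complete_orthonormal_def)
  have "(norm (spectral_cutoff_inverse mu f n x))\<^sup>2 = (\<Sum>l=1..n. (inner x (f l) / mu l)\<^sup>2)"
    unfolding spectral_cutoff_inverse_def by (rule norm_sum_orthonormal[OF o]) auto
  also have "\<dots> \<le> (\<Sum>l=1..n. (inner x (f l))\<^sup>2 / c\<^sup>2)"
  proof (rule sum_mono)
    fix l assume "l \<in> {1..n}"
    then have "c \<le> mu l" using eigenbasis_antimono[OF S, of l n] assms(4) by auto
    then show "(inner x (f l) / mu l)\<^sup>2 \<le> (inner x (f l))\<^sup>2 / c\<^sup>2"
      using \<open>0 < c\<close> by (simp add: power_divide divide_left_mono power_mono)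
  qed
  also have "\<dots> \<le> (norm x)\<^sup>2 / c\<^sup>2"
    using bessel[OF o, of "{1..n}" x] by (simp add: divide_right_mono flip: sum_divide_distrib)
  finally show "(norm (spectral_cutoff_inverse mu f n x))\<^sup>2 \<le> (norm x / c)\<^sup>2" by (simp add: power_divide)
qed (use \<open>0 < c\<close> in simp)

lemma eigen_spectral_cutoff_inverse:
  assumes S: "eigenbasis S mu f" "linear S" and "\<And>l. 1 \<le> l \<Longrightarrow> l \<le> n \<Longrightarrow> mu l \<noteq> 0"
  shows "S (spectral_cutoff_inverse mu f n x) = proj f n x"
  unfolding spectral_cutoff_inverse_def proj_def linear_sum[OF S(2)] linear_scale[OF S(2)]
  using S(1) assms(3) by (intro sum.cong) (auto simp: eigenbasis_def)

text \<open>
  Brings the double sum of the estimator into the form \<open>Q D R\<close>.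
\<close>

lemma proj_spectral_cutoff_inverse:
  assumes D: "linear D"
  shows "proj g m (D (spectral_cutoff_inverse mu f n x))
    = (\<Sum>k=1..m. \<Sum>l=1..n. (inner (D (f l)) (g k) / mu l * inner (f l) x) *\<^sub>R g k)"
proof -
  have "inner (D (spectral_cutoff_inverse mu f n x)) z = (\<Sum>l=1..n. inner (D (f l)) z / mu l * inner (f l) x)" for z
    unfolding spectral_cutoff_inverse_def linear_sum[OF D] linear_scale[OF D]
    by (simp add: inner_sum_left inner_commute[of x] mult_ac)
  then show ?thesis by (simp add: proj_def scaleR_sum_left)
qed

text \<open>
  The deterministic core: for one realisation, with \<open>S\<close>, \<open>SY\<close> the sample covariance operators, \<open>D\<close> the
  cross covariance operator and \<open>E\<close> its noise part. The perturbations \<open>d\<close> and \<open>h\<close> have to be small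
  relative to the eigenvalue \<open>lam (L N)\<close> that is inverted; of \<open>dY\<close> mere convergence to 0 is required,
  since \<open>Y\<close> only enters through a projection.
\<close>

theorem regularized_inverse_consistent:
  fixes A A' C CY :: "'a::real_inner \<Rightarrow> 'a" and S SY E D :: "nat \<Rightarrow> 'a \<Rightarrow> 'a"
  assumes A: "bounded_linear A" "bounded_linear A'" and adj: "\<And>x y. inner (A x) y = inner x (A' y)"
    and HS: "\<And>n. (\<Sum>j=1..n. (norm (A (v j)))\<^sup>2) \<le> H" "\<And>n. (\<Sum>j=1..n. (norm (A' (v j)))\<^sup>2) \<le> H'"
    and C: "eigenbasis C lam v" "bounded_linear C" "\<And>j. 1 \<le> j \<Longrightarrow> lam (j + 1) < lam j" "\<And>j. 1 \<le> j \<Longrightarrow> 0 < lam j"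
    and CY: "eigenbasis CY gam u" "bounded_linear CY" "\<And>j. 1 \<le> j \<Longrightarrow> gam (j + 1) < gam j"
    and S: "\<And>N. 1 \<le> N \<Longrightarrow> eigenbasis (S N) (lamh N) (vh N)" "\<And>N. 1 \<le> N \<Longrightarrow> bounded_linear (S N)"
      "\<And>N x y. 1 \<le> N \<Longrightarrow> inner (S N x) y = inner x (S N y)"
    and SY: "\<And>N. 1 \<le> N \<Longrightarrow> eigenbasis (SY N) (gamh N) (uh N)" "\<And>N. 1 \<le> N \<Longrightarrow> bounded_linear (SY N)"
      "\<And>N x y. 1 \<le> N \<Longrightarrow> inner (SY N x) y = inner x (SY N y)"
    and D: "\<And>N. 1 \<le> N \<Longrightarrow> linear (D N)" "\<And>N x. 1 \<le> N \<Longrightarrow> D N x = A (S N x) + E N x"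
    and d: "\<And>N x. 1 \<le> N \<Longrightarrow> norm (S N x - C x) \<le> d N * norm x" "d \<longlonglongrightarrow> 0" "(\<lambda>N. d N / lam (L N)) \<longlonglongrightarrow> 0"
    and dY: "\<And>N x. 1 \<le> N \<Longrightarrow> norm (SY N x - CY x) \<le> dY N * norm x" "dY \<longlonglongrightarrow> 0"
    and h: "\<And>N x. 1 \<le> N \<Longrightarrow> norm (E N x) \<le> h N * norm x" "(\<lambda>N. h N / lam (L N)) \<longlonglongrightarrow> 0"
    and K: "filterlim K at_top sequentially" and L: "filterlim L at_top sequentially"
  shows "\<exists>b. b \<longlonglongrightarrow> 0 \<and> (\<forall>\<^sub>F N in sequentially. \<forall>x.
    norm ((\<Sum>k=1..K N. \<Sum>l=1..L N. (inner (D N (vh N l)) (uh N k) / lamh N l * inner (vh N l) x) *\<^sub>R uh N k) - A x)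
      \<le> b N * norm x)"
proof -
  have v: "complete_orthonormal v" using C(1) by (simp add: eigenbasis_def)
  have vh: "orthonormal (vh N)" and uh: "orthonormal (uh N)" if "1 \<le> N" for N
    using S(1)[OF that] SY(1)[OF that] by (auto simp: eigenbasis_def complete_orthonormal_def)
  let ?QX = "\<lambda>N x. x - proj (vh N) (L N) x" and ?QY = "\<lambda>N y. y - proj (uh N) (K N) y"
  have QX: "(\<lambda>N. ?QX N y) \<longlonglongrightarrow> 0" for y
    by (rule residual_tendsto_zero[OF C(1,2,3) S d(1,2) L])
  have QY: "(\<lambda>N. ?QY N y) \<longlonglongrightarrow> 0" for y
    by (rule residual_tendsto_zero[OF CY SY dY K])
  have bl: "bounded_linear (?QX N)" "bounded_linear (?QY N)" for N
    by (intro bounded_linear_sub bounded_linear_ident bounded_linear_proj)+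
  obtain bY where bY: "bY \<longlonglongrightarrow> 0" "\<And>N x. 1 \<le> N \<Longrightarrow> norm (?QY N (A x)) \<le> bY N * norm x"
    using uniformly_null_on_hilbert_schmidt[OF v bl(2) norm_residual_le[OF uh] QY A(1) HS(1)] by blast
  obtain bX where bX: "bX \<longlonglongrightarrow> 0" "\<And>N x. 1 \<le> N \<Longrightarrow> norm (?QX N (A' x)) \<le> bX N * norm x"
    using uniformly_null_on_hilbert_schmidt[OF v bl(1) norm_residual_le[OF vh] QX A(2) HS(2)] by blast
  have bX': "norm (A (?QX N x)) \<le> bX N * norm x" if "1 \<le> N" for N x
    by (rule norm_le_by_adjoint[OF adj _ bX(2)[OF that]]) (simp add: inner_diff inner_proj_commute)
  \<comment> \<open>The factor 2 is the loss in passing from \<open>lamh N (L N)\<close> to \<open>lam (L N) / 2\<close>.\<close>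
  define b where "b N = bX N + bY N + 2 * (h N / lam (L N))" for N
  have "b \<longlonglongrightarrow> 0 + 0 + 2 * 0"
    unfolding b_def by (intro tendsto_intros bX(1) bY(1) h(2))
  moreover have "\<forall>\<^sub>F N in sequentially. \<forall>x.
    norm ((\<Sum>k=1..K N. \<Sum>l=1..L N. (inner (D N (vh N l)) (uh N k) / lamh N l * inner (vh N l) x) *\<^sub>R uh N k) - A x)
      \<le> b N * norm x"
  proof -
    have "\<forall>\<^sub>F N in sequentially. d N / lam (L N) < 1 / 2" using d(3) by (intro order_tendstoD) auto
    moreover have "\<forall>\<^sub>F N in sequentially. 1 \<le> L N" using L by (simp add: filterlim_at_top)
    ultimately show ?thesis
      using eventually_ge_at_top[of 1]
    proof eventually_elim
      case (elim N)
      note N = elim(3)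
      have lam: "0 < lam (L N)" by (rule C(4)[OF elim(2)])
      have "lam (L N) - d N \<le> lamh N (L N)"
        by (rule weyl[OF C(1) bounded_linear.linear[OF C(2)] S(1)[OF N] S(2)[OF N] elim(2) d(1)[OF N]])
      then have half: "lam (L N) / 2 \<le> lamh N (L N)" using elim(1) lam by (simp add: field_simps)
      show ?case
      proof
        fix x
        define w where "w = spectral_cutoff_inverse (lamh N) (vh N) (L N) x"
        have w: "norm w \<le> norm x / (lam (L N) / 2)"
          unfolding w_def using half lam elim(2) by (intro norm_spectral_cutoff_inverse_le[OF S(1)[OF N]]) auto
        have Sw: "S N w = proj (vh N) (L N) x"
          unfolding w_def
        proof (rule eigen_spectral_cutoff_inverse[OF S(1)[OF N] bounded_linear.linear[OF S(2)[OF N]]])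
          fix l assume "1 \<le> l" "l \<le> L N"
          then show "lamh N l \<noteq> 0" using eigenbasis_antimono[OF S(1)[OF N], of l "L N"] half lam by simp
        qed
        let ?P = "proj (uh N) (K N)"
        note lin = linear_diff[OF bounded_linear.linear[OF A(1)]] linear_diff[OF linear_proj] linear_add[OF linear_proj]
        have "(\<Sum>k=1..K N. \<Sum>l=1..L N. (inner (D N (vh N l)) (uh N k) / lamh N l * inner (vh N l) x) *\<^sub>R uh N k)
            = ?P (D N w)"
          unfolding w_def by (rule proj_spectral_cutoff_inverse[OF D(1)[OF N], symmetric])
        also have "\<dots> - A x = ?P (E N w) - ?P (A (?QX N x)) - ?QY N (A x)"
          by (simp add: D(2)[OF N] Sw lin)
        finally have "norm ((\<Sum>k=1..K N. \<Sum>l=1..L N. (inner (D N (vh N l)) (uh N k) / lamh N l * inner (vh N l) x) *\<^sub>R uh N k) - A x)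
            \<le> norm (?P (E N w)) + norm (?P (A (?QX N x))) + norm (?QY N (A x))"
          by (simp only:) (meson norm_triangle_ineq4 add_right_mono order_trans)
        also have "norm (?P (E N w)) \<le> 2 * (h N / lam (L N)) * norm x"
        proof -
          have "0 \<le> h N"
          proof -
            have "norm (v 1) = 1" using v by (simp add: complete_orthonormal_def orthonormal_def norm_eq_sqrt_inner)
            then show ?thesis using order_trans[OF norm_ge_zero h(1)[OF N, of "v 1"]] by simp
          qed
          have "norm (?P (E N w)) \<le> norm (E N w)" by (rule norm_proj_le[OF uh[OF N]])
          also have "\<dots> \<le> h N * norm w" by (rule h(1)[OF N])
          also have "\<dots> \<le> h N * (norm x / (lam (L N) / 2))" using w \<open>0 \<le> h N\<close> by (rule mult_left_mono)
          finally show ?thesis by (simp add: mult_ac)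
        qed
        also have "norm (?P (A (?QX N x))) \<le> bX N * norm x"
          using norm_proj_le[OF uh[OF N]] bX'[OF N] by (rule order_trans)
        also have "norm (?QY N (A x)) \<le> bY N * norm x" by (rule bY(2)[OF N])
        finally show "norm ((\<Sum>k=1..K N. \<Sum>l=1..L N. (inner (D N (vh N l)) (uh N k) / lamh N l * inner (vh N l) x) *\<^sub>R uh N k) - A x)
            \<le> b N * norm x"
          by (simp add: b_def algebra_simps)
      qed
    qed
  qed
  ultimately show ?thesis by (intro exI[of _ b]) simp
qed

section \<open>Hilbert--Schmidt integral operators\<close>

lemma sigma_finite_unit_borel: "sigma_finite_measure unit_borel"
  by (rule unit_borel.sigma_finite_measure_axioms)

interpretation unit_square: pair_sigma_finite unit_borel unit_borel
  by (intro pair_sigma_finite.intro sigma_finite_unit_borel)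

definition hs_norm_sq :: "(real \<Rightarrow> real \<Rightarrow> real) \<Rightarrow> real" where
  "hs_norm_sq \<psi> = (\<integral>p. (\<psi> (fst p) (snd p))\<^sup>2 \<partial>(unit_borel \<Otimes>\<^sub>M unit_borel))"

lemma hs_kernel_measurable:
  assumes "hilbert_schmidt_kernel \<psi>"
  shows "(\<lambda>p. \<psi> (fst p) (snd p)) \<in> borel_measurable (unit_borel \<Otimes>\<^sub>M unit_borel)"
  using assms by (simp add: hilbert_schmidt_kernel_def split_def)

lemma hs_kernel_integrable:
  assumes "hilbert_schmidt_kernel \<psi>"
  shows "integrable (unit_borel \<Otimes>\<^sub>M unit_borel) (\<lambda>p. (\<psi> (fst p) (snd p))\<^sup>2)"
  using assms by (simp add: hilbert_schmidt_kernel_def split_def)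

text \<open>
  Almost every section \<open>\<psi> t\<close> is an element of \<open>L2\<close>, and the operator is \<open>x \<mapsto> (t \<mapsto> \<langle>\<psi> t, x\<rangle>)\<close>. The bounds
  below integrate Bessel's and the Cauchy-Schwarz inequality for \<open>\<psi> t\<close> over \<open>t\<close>.
\<close>

lemma AE_square_integrable_section:
  assumes "hilbert_schmidt_kernel \<psi>"
  shows "AE t in unit_borel. square_integrable (\<psi> t)"
proof -
  have "AE t in unit_borel. integrable unit_borel (\<lambda>s. (\<psi> (fst (t, s)) (snd (t, s)))\<^sup>2)"
    by (rule unit_square.AE_integrable_fst'[OF hs_kernel_integrable[OF assms]])
  moreover have "AE t in unit_borel. \<psi> t \<in> borel_measurable unit_borel"
  proof (rule AE_I2)
    fix t assume "t \<in> space unit_borel"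
    then show "\<psi> t \<in> borel_measurable unit_borel"
      using measurable_compose[OF measurable_Pair1' hs_kernel_measurable[OF assms], of t] by simp
  qed
  ultimately show ?thesis by eventually_elim (simp add: square_integrable_def)
qed

lemma integral_mult_rep_L2:
  assumes "square_integrable f"
  shows "(\<integral>s. f s * rep_L2 x s \<partial>unit_borel) = inner (abs_L2 f) x"
  unfolding inner_L2_def
proof (rule integral_cong_AE)
  have [measurable]: "f \<in> borel_measurable unit_borel"
    using assms by (simp add: square_integrable_def)
  show "(\<lambda>s. f s * rep_L2 x s) \<in> borel_measurable unit_borel" by measurable
  show "AE s in unit_borel. f s * rep_L2 x s = rep_L2 (abs_L2 f) s * rep_L2 x s"
    using rep_abs_L2[OF assms] by eventually_elim simp
qed measurable

lemma norm_abs_L2_sq: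
  assumes "square_integrable f"
  shows "(norm (abs_L2 f))\<^sup>2 = (\<integral>s. (f s)\<^sup>2 \<partial>unit_borel)"
  unfolding power2_norm_eq_inner inner_L2_def
proof (rule integral_cong_AE)
  have [measurable]: "f \<in> borel_measurable unit_borel"
    using assms by (simp add: square_integrable_def)
  show "(\<lambda>s. (f s)\<^sup>2) \<in> borel_measurable unit_borel" by measurable
  show "AE s in unit_borel. rep_L2 (abs_L2 f) s * rep_L2 (abs_L2 f) s = (f s)\<^sup>2"
    using rep_abs_L2[OF assms] by eventually_elim (simp add: power2_eq_square)
qed measurable

lemma section_norm_integrable:
  assumes "hilbert_schmidt_kernel \<psi>"
  shows "integrable unit_borel (\<lambda>t. \<integral>s. (\<psi> t s)\<^sup>2 \<partial>unit_borel)"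
    and "(\<integral>t. \<integral>s. (\<psi> t s)\<^sup>2 \<partial>unit_borel \<partial>unit_borel) = hs_norm_sq \<psi>"
  using unit_square.integrable_fst'[OF hs_kernel_integrable[OF assms]]
    unit_square.integral_fst'[OF hs_kernel_integrable[OF assms]]
  by (simp_all add: hs_norm_sq_def)

lemma measurable_integral_kernel:
  assumes "hilbert_schmidt_kernel \<psi>"
  shows "(\<lambda>t. \<integral>s. \<psi> t s * rep_L2 x s \<partial>unit_borel) \<in> borel_measurable unit_borel"
proof -
  note [measurable] = hs_kernel_measurable[OF assms]
  have "(\<lambda>(t, s). \<psi> t s * rep_L2 x s) \<in> borel_measurable (unit_borel \<Otimes>\<^sub>M unit_borel)"
    unfolding split_def by measurable
  then show ?thesis by (rule unit_borel.borel_measurable_lebesgue_integral)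
qed

lemma sum_sq_integral_kernel:
  assumes \<psi>: "hilbert_schmidt_kernel \<psi>" and e: "orthonormal e" and "finite F" "F \<subseteq> {1..}"
  shows "AE t in unit_borel. (\<Sum>j\<in>F. (\<integral>s. \<psi> t s * rep_L2 (e j) s \<partial>unit_borel)\<^sup>2) \<le> (\<integral>s. (\<psi> t s)\<^sup>2 \<partial>unit_borel)"
  using AE_square_integrable_section[OF \<psi>]
proof eventually_elim
  case (elim t)
  then show ?case
    using bessel[OF e assms(3,4), of "abs_L2 (\<psi> t)"]
    by (simp add: integral_mult_rep_L2 norm_abs_L2_sq)
qed

lemma square_integrable_integral_kernel:
  assumes "hilbert_schmidt_kernel \<psi>"
  shows "square_integrable (\<lambda>t. \<integral>s. \<psi> t s * rep_L2 x s \<partial>unit_borel)"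
  unfolding square_integrable_def
proof
  note [measurable] = measurable_integral_kernel[OF assms, of x]
  show "integrable unit_borel (\<lambda>t. (\<integral>s. \<psi> t s * rep_L2 x s \<partial>unit_borel)\<^sup>2)"
  proof (rule Bochner_Integration.integrable_bound)
    show "integrable unit_borel (\<lambda>t. (norm x)\<^sup>2 * (\<integral>s. (\<psi> t s)\<^sup>2 \<partial>unit_borel))"
      using section_norm_integrable(1)[OF assms] by simp
    show "AE t in unit_borel. norm ((\<integral>s. \<psi> t s * rep_L2 x s \<partial>unit_borel)\<^sup>2)
        \<le> norm ((norm x)\<^sup>2 * (\<integral>s. (\<psi> t s)\<^sup>2 \<partial>unit_borel))"
      using AE_square_integrable_section[OF assms]
    proof eventually_elim
      case (elim t)
      have "\<bar>inner (abs_L2 (\<psi> t)) x\<bar>\<^sup>2 \<le> (norm (abs_L2 (\<psi> t)) * norm x)\<^sup>2"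
        by (intro power_mono Cauchy_Schwarz_ineq2) simp
      then show ?case
        unfolding integral_mult_rep_L2[OF elim] norm_abs_L2_sq[OF elim, symmetric]
        by (simp add: power_mult_distrib mult.commute)
    qed
  qed measurable
qed (rule measurable_integral_kernel[OF assms])

lemma rep_integral_operator:
  assumes "hilbert_schmidt_kernel \<psi>"
  shows "AE t in unit_borel. rep_L2 (integral_operator \<psi> x) t = (\<integral>s. \<psi> t s * rep_L2 x s \<partial>unit_borel)"
  unfolding integral_operator_def
  by (rule rep_abs_L2[OF square_integrable_integral_kernel[OF assms]])

lemma norm_integral_operator_sq:
  assumes "hilbert_schmidt_kernel \<psi>"
  shows "(norm (integral_operator \<psi> x))\<^sup>2 = (\<integral>t. (\<integral>s. \<psi> t s * rep_L2 x s \<partial>unit_borel)\<^sup>2 \<partial>unit_borel)"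
  unfolding power2_norm_eq_inner inner_L2_def
proof (rule integral_cong_AE)
  note [measurable] = measurable_integral_kernel[OF assms, of x]
  show "(\<lambda>t. (\<integral>s. \<psi> t s * rep_L2 x s \<partial>unit_borel)\<^sup>2) \<in> borel_measurable unit_borel" by measurable
  show "AE t in unit_borel. rep_L2 (integral_operator \<psi> x) t * rep_L2 (integral_operator \<psi> x) t
      = (\<integral>s. \<psi> t s * rep_L2 x s \<partial>unit_borel)\<^sup>2"
    using rep_integral_operator[OF assms, of x] by eventually_elim (simp add: power2_eq_square)
qed measurable

lemma sum_norm_integral_operator_le:
  assumes \<psi>: "hilbert_schmidt_kernel \<psi>" and e: "orthonormal e"
  shows "(\<Sum>j=1..n. (norm (integral_operator \<psi> (e j)))\<^sup>2) \<le> hs_norm_sq \<psi>"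
proof -
  let ?g = "\<lambda>j t. (\<integral>s. \<psi> t s * rep_L2 (e j) s \<partial>unit_borel)\<^sup>2"
  have int: "integrable unit_borel (?g j)" for j
    using square_integrable_integral_kernel[OF \<psi>, of "e j"] by (simp add: square_integrable_def)
  have "(\<Sum>j=1..n. (norm (integral_operator \<psi> (e j)))\<^sup>2) = (\<integral>t. (\<Sum>j=1..n. ?g j t) \<partial>unit_borel)"
    unfolding norm_integral_operator_sq[OF \<psi>] using int by simp
  also have "\<dots> \<le> (\<integral>t. \<integral>s. (\<psi> t s)\<^sup>2 \<partial>unit_borel \<partial>unit_borel)"
    using int section_norm_integrable(1)[OF \<psi>]
    by (intro integral_mono_AE sum_sq_integral_kernel[OF \<psi> e]) auto
  finally show ?thesis by (simp add: section_norm_integrable(2)[OF \<psi>])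
qed

lemma integral_operator_add:
  assumes \<psi>: "hilbert_schmidt_kernel \<psi>"
  shows "integral_operator \<psi> (x + y) = integral_operator \<psi> x + integral_operator \<psi> y"
proof (rule l2_eqI)
  show "AE t in unit_borel. rep_L2 (integral_operator \<psi> (x + y)) t = rep_L2 (integral_operator \<psi> x + integral_operator \<psi> y) t"
    using rep_integral_operator[OF \<psi>, of x] rep_integral_operator[OF \<psi>, of y] rep_integral_operator[OF \<psi>, of "x + y"]
      rep_plus[of "integral_operator \<psi> x" "integral_operator \<psi> y"] AE_square_integrable_section[OF \<psi>]
    by eventually_elim (simp add: integral_mult_rep_L2 inner_add_right)
qed

lemma integral_operator_scaleR:
  assumes \<psi>: "hilbert_schmidt_kernel \<psi>"
  shows "integral_operator \<psi> (c *\<^sub>R x) = c *\<^sub>R integral_operator \<psi> x"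
proof (rule l2_eqI)
  show "AE t in unit_borel. rep_L2 (integral_operator \<psi> (c *\<^sub>R x)) t = rep_L2 (c *\<^sub>R integral_operator \<psi> x) t"
    using rep_integral_operator[OF \<psi>, of x] rep_integral_operator[OF \<psi>, of "c *\<^sub>R x"]
      rep_scaleR[of c "integral_operator \<psi> x"] AE_square_integrable_section[OF \<psi>]
    by eventually_elim (simp add: integral_mult_rep_L2)
qed

lemma bounded_linear_integral_operator:
  assumes \<psi>: "hilbert_schmidt_kernel \<psi>"
  shows "bounded_linear (integral_operator \<psi>)"
proof (rule bounded_linear_intro[where K = "sqrt (hs_norm_sq \<psi>)"])
  fix x
  have nn: "0 \<le> hs_norm_sq \<psi>" by (simp add: hs_norm_sq_def)
  show "norm (integral_operator \<psi> x) \<le> norm x * sqrt (hs_norm_sq \<psi>)"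
  proof (cases "x = 0")
    case True
    then show ?thesis using integral_operator_scaleR[OF \<psi>, of 0 0] by simp
  next
    case False
    define B where "B = integral_operator \<psi> (x /\<^sub>R norm x)"
    have "(norm B)\<^sup>2 \<le> hs_norm_sq \<psi>"
    proof -
      have "(norm B)\<^sup>2 \<le> (\<integral>t. \<integral>s. (\<psi> t s)\<^sup>2 \<partial>unit_borel \<partial>unit_borel)"
        unfolding B_def norm_integral_operator_sq[OF \<psi>]
      proof (rule integral_mono_AE)
        show "AE t in unit_borel. (\<integral>s. \<psi> t s * rep_L2 (x /\<^sub>R norm x) s \<partial>unit_borel)\<^sup>2 \<le> (\<integral>s. (\<psi> t s)\<^sup>2 \<partial>unit_borel)"
          using AE_square_integrable_section[OF \<psi>]
        proof eventually_elim
          case (elim t)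
          have "\<bar>inner (abs_L2 (\<psi> t)) (x /\<^sub>R norm x)\<bar>\<^sup>2 \<le> (norm (abs_L2 (\<psi> t)) * norm (x /\<^sub>R norm x))\<^sup>2"
            by (intro power_mono Cauchy_Schwarz_ineq2) simp
          then show ?case using False
            by (simp add: integral_mult_rep_L2[OF elim] norm_abs_L2_sq[OF elim, symmetric])
        qed
      qed (use square_integrable_integral_kernel[OF \<psi>] section_norm_integrable(1)[OF \<psi>] in
            \<open>auto simp: square_integrable_def\<close>)
      then show ?thesis by (simp add: section_norm_integrable(2)[OF \<psi>])
    qed
    then have "norm B \<le> sqrt (hs_norm_sq \<psi>)" by (rule real_le_rsqrt)
    moreover have "norm (integral_operator \<psi> x) = norm x * norm B"
      unfolding B_def using False by (simp add: integral_operator_scaleR[OF \<psi>])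
    ultimately show ?thesis by (simp add: mult_left_mono)
  qed
qed (simp_all add: integral_operator_add[OF \<psi>] integral_operator_scaleR[OF \<psi>])

lemma hilbert_schmidt_kernel_transpose:
  assumes \<psi>: "hilbert_schmidt_kernel \<psi>"
  shows "hilbert_schmidt_kernel (\<lambda>t s. \<psi> s t)"
proof -
  note [measurable] = hs_kernel_measurable[OF \<psi>]
  have "(\<lambda>p. \<psi> (fst (case p of (x, y) \<Rightarrow> (y, x))) (snd (case p of (x, y) \<Rightarrow> (y, x)))) \<in> borel_measurable (unit_borel \<Otimes>\<^sub>M unit_borel)"
    by measurable
  then have "(\<lambda>(t, s). \<psi> s t) \<in> borel_measurable (unit_borel \<Otimes>\<^sub>M unit_borel)"
    by (simp add: split_def)
  moreover have "integrable (unit_borel \<Otimes>\<^sub>M unit_borel) (\<lambda>(t, s). (\<psi> s t)\<^sup>2)"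
    using unit_square.integrable_product_swap[OF hs_kernel_integrable[OF \<psi>]] by (simp add: split_def)
  ultimately show ?thesis by (simp add: hilbert_schmidt_kernel_def)
qed

lemma integral_operator_adjoint:
  assumes \<psi>: "hilbert_schmidt_kernel \<psi>"
  shows "inner (integral_operator \<psi> x) y = inner x (integral_operator (\<lambda>t s. \<psi> s t) y)"
proof -
  let ?f = "\<lambda>p. \<psi> (fst p) (snd p) * (rep_L2 y (fst p) * rep_L2 x (snd p))"
  note hs_kernel_measurable[OF \<psi>, measurable]
  have xy: "integrable (unit_borel \<Otimes>\<^sub>M unit_borel) (\<lambda>p. (rep_L2 y (fst p) * rep_L2 x (snd p))\<^sup>2)"
  proof -
    have sq: "integrable unit_borel (\<lambda>t. (rep_L2 z t)\<^sup>2)" for z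
      using square_integrable_rep[of z] by (simp add: square_integrable_def)
    have "integrable (unit_borel \<Otimes>\<^sub>M unit_borel) (\<lambda>(t, s). (rep_L2 y t)\<^sup>2 * (rep_L2 x s)\<^sup>2)"
    proof (rule unit_square.Fubini_integrable)
      show "(\<lambda>(t, s). (rep_L2 y t)\<^sup>2 * (rep_L2 x s)\<^sup>2) \<in> borel_measurable (unit_borel \<Otimes>\<^sub>M unit_borel)"
        unfolding split_def by measurable
      show "integrable unit_borel (\<lambda>t. \<integral>s. norm (case (t, s) of (t, s) \<Rightarrow> (rep_L2 y t)\<^sup>2 * (rep_L2 x s)\<^sup>2) \<partial>unit_borel)"
        using sq by (simp add: abs_mult)
      show "AE t in unit_borel. integrable unit_borel (\<lambda>s. case (t, s) of (t, s) \<Rightarrow> (rep_L2 y t)\<^sup>2 * (rep_L2 x s)\<^sup>2)"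
        using sq by simp
    qed
    then show ?thesis by (simp add: split_def power_mult_distrib)
  qed
  have int: "integrable (unit_borel \<Otimes>\<^sub>M unit_borel) ?f"
  proof (rule Bochner_Integration.integrable_bound)
    show "integrable (unit_borel \<Otimes>\<^sub>M unit_borel) (\<lambda>p. (\<psi> (fst p) (snd p))\<^sup>2 + (rep_L2 y (fst p) * rep_L2 x (snd p))\<^sup>2)"
      using hs_kernel_integrable[OF \<psi>] xy by simp
    have "\<bar>a * b\<bar> \<le> \<bar>a\<^sup>2 + b\<^sup>2\<bar>" for a b :: real
      using sum_squares_bound[of "\<bar>a\<bar>" "\<bar>b\<bar>"] by (simp add: abs_mult mult.assoc)
        (smt (verit) mult_nonneg_nonneg abs_ge_zero)
    then show "AE p in unit_borel \<Otimes>\<^sub>M unit_borel. norm (?f p)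
        \<le> norm ((\<psi> (fst p) (snd p))\<^sup>2 + (rep_L2 y (fst p) * rep_L2 x (snd p))\<^sup>2)"
      by simp
  qed measurable
  have "inner (integral_operator \<psi> x) y = (\<integral>t. \<integral>s. ?f (t, s) \<partial>unit_borel \<partial>unit_borel)"
    unfolding inner_L2_def
  proof (rule integral_cong_AE)
    show "AE t in unit_borel. rep_L2 (integral_operator \<psi> x) t * rep_L2 y t = (\<integral>s. ?f (t, s) \<partial>unit_borel)"
      using rep_integral_operator[OF \<psi>, of x]
    proof eventually_elim
      case (elim t)
      have "(\<integral>s. ?f (t, s) \<partial>unit_borel) = (\<integral>s. rep_L2 y t * (\<psi> t s * rep_L2 x s) \<partial>unit_borel)"
        by (simp add: mult_ac)
      then show ?case unfolding elim by simp
    qed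
  qed measurable
  also have "\<dots> = (\<integral>s. \<integral>t. ?f (t, s) \<partial>unit_borel \<partial>unit_borel)"
    using unit_square.Fubini_integral[of "\<lambda>t s. ?f (t, s)"] int by (simp add: split_def)
  also have "\<dots> = inner x (integral_operator (\<lambda>t s. \<psi> s t) y)"
    unfolding inner_L2_def
  proof (rule integral_cong_AE)
    show "AE s in unit_borel. (\<integral>t. ?f (t, s) \<partial>unit_borel) = rep_L2 x s * rep_L2 (integral_operator (\<lambda>t s. \<psi> s t) y) s"
      using rep_integral_operator[OF hilbert_schmidt_kernel_transpose[OF \<psi>], of y]
    proof eventually_elim
      case (elim s)
      have "(\<integral>t. ?f (t, s) \<partial>unit_borel) = (\<integral>t. rep_L2 x s * (\<psi> t s * rep_L2 y t) \<partial>unit_borel)"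
        by (simp add: mult_ac)
      then show ?case unfolding elim by simp
    qed
  qed measurable
  finally show ?thesis .
qed

lemma integral_operator_degenerate:
  assumes "finite F"
  shows "integral_operator (\<lambda>t s. \<Sum>i\<in>F. c i * rep_L2 (a i) t * rep_L2 (b i) s) x
    = (\<Sum>i\<in>F. (c i * inner (b i) x) *\<^sub>R a i)"
proof -
  have int: "integrable unit_borel (\<lambda>s. rep_L2 (b i) s * rep_L2 x s)" for i
    by (intro square_integrable_mult square_integrable_rep)
  have eq: "(\<integral>s. (\<Sum>i\<in>F. c i * rep_L2 (a i) t * rep_L2 (b i) s) * rep_L2 x s \<partial>unit_borel)
      = (\<Sum>i\<in>F. c i * inner (b i) x * rep_L2 (a i) t)" for t
  proof -
    have "(\<integral>s. (\<Sum>i\<in>F. c i * rep_L2 (a i) t * rep_L2 (b i) s) * rep_L2 x s \<partial>unit_borel)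
      = (\<integral>s. (\<Sum>i\<in>F. (c i * rep_L2 (a i) t) * (rep_L2 (b i) s * rep_L2 x s)) \<partial>unit_borel)"
      by (simp add: sum_distrib_right sum_distrib_left mult_ac)
    also have "\<dots> = (\<Sum>i\<in>F. (c i * rep_L2 (a i) t) * inner (b i) x)"
      using int by (simp add: inner_L2_def)
    finally show ?thesis by (simp add: mult_ac)
  qed
  have "square_integrable (\<lambda>t. \<Sum>i\<in>F. d i * rep_L2 (a i) t)
      \<and> abs_L2 (\<lambda>t. \<Sum>i\<in>F. d i * rep_L2 (a i) t) = (\<Sum>i\<in>F. d i *\<^sub>R a i)" for d
    using assms
  proof (induction F)
    case empty
    show ?case by (simp add: square_integrable_zero flip: zero_L2_def)
  next
    case (insert i F)
    have sq: "square_integrable (\<lambda>t. d i * rep_L2 (a i) t)"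
      by (intro square_integrable_cmult square_integrable_rep)
    show ?case
      using insert sq
      by (simp add: square_integrable_add abs_L2_add abs_L2_cmult[OF square_integrable_rep] abs_rep_L2)
  qed
  then show ?thesis unfolding integral_operator_def eq by simp
qed

section \<open>Moments of regularly varying elements\<close>

text \<open>
  The ratio of the tails at \<open>2 * u\<close> and \<open>u\<close> tends to \<open>2 powr (- \<alpha>) < 2 powr (- q)\<close>. The slowly varying
  factor is nonzero for large \<open>u\<close> since the ratio \<open>l (2 * u) / l u\<close> would be 0 otherwise.
\<close>

lemma regularly_varying_doubling:
  assumes M: "prob_space M" and W: "regularly_varying M \<alpha> W" and q: "q < \<alpha>"
  shows "\<exists>u0>0. \<forall>u\<ge>u0. measure M {\<omega>\<in>space M. norm (W \<omega>) > 2 * u}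
    \<le> 2 powr (- q) * measure M {\<omega>\<in>space M. norm (W \<omega>) > u}"
proof -
  obtain l where l: "slowly_varying l"
    and T: "\<And>u. 0 < u \<Longrightarrow> measure M {\<omega>\<in>space M. norm (W \<omega>) > u} = u powr (- \<alpha>) * l u"
    using W unfolding regularly_varying_def by blast
  have lim: "((\<lambda>u. l (2 * u) / l u) \<longlongrightarrow> 1) at_top"
    using l unfolding slowly_varying_def by simp
  have "1 < (2::real) powr (\<alpha> - q)"
    using q powr_less_mono[of 0 "\<alpha> - q" 2] by simp
  with lim have "\<forall>\<^sub>F u in at_top. l (2 * u) / l u < 2 powr (\<alpha> - q)"
    by (rule order_tendstoD)
  moreover have "\<forall>\<^sub>F u in at_top. 0 < l (2 * u) / l u"
    using lim by (rule order_tendstoD) simp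
  ultimately have "\<forall>\<^sub>F u in at_top. measure M {\<omega>\<in>space M. norm (W \<omega>) > 2 * u}
    \<le> 2 powr (- q) * measure M {\<omega>\<in>space M. norm (W \<omega>) > u}"
    using eventually_gt_at_top[of 0]
  proof eventually_elim
    case (elim u)
    have "0 \<le> u powr (- \<alpha>) * l u" using T[OF elim(3)] measure_nonneg by metis
    then have "0 \<le> l u" using elim(3) by (simp add: zero_le_mult_iff)
    moreover have "l u \<noteq> 0" using elim(2) by auto
    ultimately have "0 < l u" by simp
    then have "l (2 * u) \<le> 2 powr (\<alpha> - q) * l u" using elim(1) by (simp add: field_simps)
    then have "(2 * u) powr (- \<alpha>) * l (2 * u) \<le> (2 * u) powr (- \<alpha>) * (2 powr (\<alpha> - q) * l u)"
      by (rule mult_left_mono) simp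
    also have "\<dots> = 2 powr (- q) * (u powr (- \<alpha>) * l u)"
      using elim(3) by (simp add: powr_mult powr_diff powr_minus field_simps)
    finally show ?case using T[of "2 * u"] T[of u] elim(3) by simp
  qed
  then obtain u1 where u1: "\<And>u. u \<ge> u1 \<Longrightarrow> measure M {\<omega>\<in>space M. norm (W \<omega>) > 2 * u}
    \<le> 2 powr (- q) * measure M {\<omega>\<in>space M. norm (W \<omega>) > u}"
    unfolding eventually_at_top_linorder by blast
  then show ?thesis by (intro exI[of _ "max u1 1"]) auto
qed

text \<open>
  By doubling, the tail at \<open>2 ^ n * u0\<close> decays like \<open>2 powr (- q * n)\<close> with \<open>r < q < \<alpha>\<close>, so the dyadic
  decomposition of \<open>\<parallel>W\<parallel> powr r\<close> is dominated by a geometric series.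
\<close>

lemma regularly_varying_moment:
  assumes M: "prob_space M" and W: "regularly_varying M \<alpha> W" and r: "0 \<le> r" "r < \<alpha>"
  shows "integrable M (\<lambda>\<omega>. norm (W \<omega>) powr r)"
proof -
  interpret prob_space M by fact
  have [measurable]: "W \<in> borel_measurable M" using W by (simp add: regularly_varying_def)
  define q where "q = (r + \<alpha>) / 2"
  have q: "r < q" "q < \<alpha>" using r by (auto simp: q_def)
  obtain u0 where u0: "0 < u0" and dbl: "\<And>u. u \<ge> u0 \<Longrightarrow> prob {\<omega>\<in>space M. norm (W \<omega>) > 2 * u}
    \<le> 2 powr (- q) * prob {\<omega>\<in>space M. norm (W \<omega>) > u}"
    using regularly_varying_doubling[OF M W q(2)] by blast
  have tail: "prob {\<omega>\<in>space M. norm (W \<omega>) > 2 ^ n * u0} \<le> (2 powr (- q)) ^ n" for n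
  proof (induction n)
    case (Suc n)
    have "u0 \<le> 2 ^ n * u0" using u0 by simp
    from dbl[OF this] have "prob {\<omega>\<in>space M. norm (W \<omega>) > 2 ^ Suc n * u0}
        \<le> 2 powr (- q) * prob {\<omega>\<in>space M. norm (W \<omega>) > 2 ^ n * u0}"
      by (simp add: mult.assoc)
    also have "\<dots> \<le> 2 powr (- q) * (2 powr (- q)) ^ n" by (intro mult_left_mono Suc) simp
    finally show ?case by simp
  qed simp
  let ?c = "\<lambda>n. (2 ^ Suc n * u0) powr r"
  let ?I = "\<lambda>n \<omega>. indicator {\<omega>\<in>space M. norm (W \<omega>) > 2 ^ n * u0} \<omega> :: real"
  have pt: "ennreal (norm (W \<omega>) powr r) \<le> ennreal (u0 powr r) + (\<Sum>n. ennreal (?c n * ?I n \<omega>))" if "\<omega> \<in> space M" for \<omega>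
  proof (cases "norm (W \<omega>) \<le> u0")
    case True
    then have "norm (W \<omega>) powr r \<le> u0 powr r" using r by (intro powr_mono2) auto
    then show ?thesis by (intro add_increasing2 ennreal_leI) auto
  next
    case False
    obtain k where "norm (W \<omega>) / u0 < 2 ^ k" using real_arch_pow[of 2 "norm (W \<omega>) / u0"] by auto
    then have ex: "norm (W \<omega>) \<le> 2 ^ k * u0" using u0 by (simp add: field_simps)
    define m where "m = (LEAST k. norm (W \<omega>) \<le> 2 ^ k * u0)"
    have m: "norm (W \<omega>) \<le> 2 ^ m * u0" unfolding m_def by (rule LeastI[of _ k]) (rule ex)
    have "m \<noteq> 0" using m False by (cases m) auto
    then obtain n where n: "m = Suc n" by (cases m) auto
    have "\<not> norm (W \<omega>) \<le> 2 ^ n * u0" using not_less_Least[of n "\<lambda>k. norm (W \<omega>) \<le> 2 ^ k * u0"] n unfolding m_def by simp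
    then have "?I n \<omega> = 1" using that by simp
    moreover have "norm (W \<omega>) powr r \<le> ?c n" using m n r by (intro powr_mono2) auto
    ultimately have "ennreal (norm (W \<omega>) powr r) \<le> ennreal (?c n * ?I n \<omega>)" by (simp add: ennreal_leI)
    also have "\<dots> = (\<Sum>i\<in>{n}. ennreal (?c i * ?I i \<omega>))"
      by (simp only: sum.insert sum.empty finite.emptyI empty_iff not_False_eq_True add_0_right)
    also have "\<dots> \<le> (\<Sum>i. ennreal (?c i * ?I i \<omega>))" by (rule sum_le_suminf) auto
    finally show ?thesis by (intro add_increasing) auto
  qed
  have "(\<integral>\<^sup>+\<omega>. ennreal (norm (W \<omega>) powr r) \<partial>M) \<le> (\<integral>\<^sup>+\<omega>. ennreal (u0 powr r) + (\<Sum>n. ennreal (?c n * ?I n \<omega>)) \<partial>M)"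
    by (intro nn_integral_mono pt)
  also have "\<dots> = ennreal (u0 powr r) + (\<Sum>n. \<integral>\<^sup>+\<omega>. ennreal (?c n * ?I n \<omega>) \<partial>M)"
    by (simp add: nn_integral_add nn_integral_suminf emeasure_space_1)
  also have "(\<Sum>n. \<integral>\<^sup>+\<omega>. ennreal (?c n * ?I n \<omega>) \<partial>M) \<le> (\<Sum>n. ennreal ((2 * u0) powr r * (2 powr (r - q)) ^ n))"
  proof (intro suminf_le summableI)
    fix n
    have "(\<integral>\<^sup>+\<omega>. ennreal (?c n * ?I n \<omega>) \<partial>M) = ennreal (?c n * prob {\<omega>\<in>space M. norm (W \<omega>) > 2 ^ n * u0})"
      by (simp add: ennreal_mult nn_integral_cmult emeasure_eq_measure ennreal_indicator)
    also have "\<dots> \<le> ennreal (?c n * (2 powr (- q)) ^ n)"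
      by (intro ennreal_leI mult_left_mono tail) simp
    also have "?c n * (2 powr (- q)) ^ n = (2 * u0) powr r * (2 powr (r - q)) ^ n"
    proof -
      have "?c n = (2 ^ n) powr r * (2 * u0) powr r" using u0 by (simp add: powr_mult)
      also have "(2 ^ n) powr r = (2 powr r) ^ n"
        by (simp add: powr_powr mult.commute flip: powr_realpow)
      finally show ?thesis by (simp add: powr_diff powr_minus_divide power_divide)
    qed
    finally show "(\<integral>\<^sup>+\<omega>. ennreal (?c n * ?I n \<omega>) \<partial>M) \<le> ennreal ((2 * u0) powr r * (2 powr (r - q)) ^ n)" .
  qed
  also have "\<dots> < \<infinity>"
  proof -
    have "2 powr (r - q) < (1::real)" using q powr_less_mono[of "r - q" 0 2] by simp
    then have "summable (\<lambda>n. (2 * u0) powr r * (2 powr (r - q)) ^ n)"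
      by (intro summable_mult summable_geometric) simp
    then show ?thesis by (subst suminf_ennreal2) auto
  qed
  finally show ?thesis
    by (intro integrableI_nonneg) (auto simp: less_top[symmetric])
qed

section \<open>Independence of pairs\<close>

text \<open>
  Two independent families, each of them independent, form one independent family, indexed by a tag
  that tells from which family a member is taken. Any regrouping into disjoint blocks, such as pairs
  with the same index, is then independent.
\<close>

lemma (in prob_space) indep_vars_join:
  fixes X Z :: "'b \<Rightarrow> 'a \<Rightarrow> 'c"
  assumes X: "indep_vars (\<lambda>_. N) X I" and Z: "indep_vars (\<lambda>_. N) Z I"
    and XZ: "indep_var (\<Pi>\<^sub>M i\<in>I. N) (\<lambda>\<omega>. \<lambda>i\<in>I. X i \<omega>) (\<Pi>\<^sub>M i\<in>I. N) (\<lambda>\<omega>. \<lambda>i\<in>I. Z i \<omega>)"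
    and V: "\<And>i. V (False, i) = X i" "\<And>i. V (True, i) = Z i"
  shows "indep_vars (\<lambda>_. N) V (UNIV \<times> I)"
  unfolding indep_vars_def2
proof (intro conjI ballI)
  have Xm: "i \<in> I \<Longrightarrow> X i \<in> measurable M N" and Zm: "i \<in> I \<Longrightarrow> Z i \<in> measurable M N" for i
    using X Z by (auto simp: indep_vars_def2)
  show Vm: "V p \<in> measurable M N" if "p \<in> UNIV \<times> I" for p
    using that Xm Zm V by (cases p; cases "fst p") auto
  show "indep_sets (\<lambda>p. {V p -` A \<inter> space M |A. A \<in> sets N}) (UNIV \<times> I)"
  proof (rule indep_setsI)
    show "{V p -` A \<inter> space M |A. A \<in> sets N} \<subseteq> events" if "p \<in> UNIV \<times> I" for p
      using measurable_sets[OF Vm[OF that]] by auto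
    fix A J assume J: "J \<noteq> {}" "J \<subseteq> UNIV \<times> I" "finite J"
      and A: "\<forall>p\<in>J. A p \<in> {V p -` A \<inter> space M |A. A \<in> sets N}"
    from A have "\<forall>p\<in>J. \<exists>B. A p = V p -` B \<inter> space M \<and> B \<in> sets N" by blast
    from bchoice[OF this] obtain B
      where B: "\<And>p. p \<in> J \<Longrightarrow> B p \<in> sets N" "\<And>p. p \<in> J \<Longrightarrow> A p = V p -` B p \<inter> space M"
      by blast
    define Jc where "Jc b = {i. (b, i) \<in> J}" for b
    have Jc: "finite (Jc b)" "Jc b \<subseteq> I" for b
    proof -
      have "Jc b \<subseteq> snd ` J" unfolding Jc_def by force
      then show "finite (Jc b)" using J(3) finite_subset by blast
      show "Jc b \<subseteq> I" using J(2) by (auto simp: Jc_def)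
    qed
    \<comment> \<open>The part of the event that concerns one of the two families, as a cylinder set of sequences.\<close>
    define S where "S b = {f \<in> space (\<Pi>\<^sub>M i\<in>I. N). \<forall>i\<in>Jc b. f i \<in> B (b, i)}" for b
    have S: "S b \<in> sets (\<Pi>\<^sub>M i\<in>I. N)" for b
      unfolding S_def
    proof (intro sets.sets_Collect_finite_All Jc)
      fix i assume "i \<in> Jc b"
      then have "B (b, i) \<in> sets N" "i \<in> I" using B(1) Jc(2) by (auto simp: Jc_def)
      then show "{f \<in> space (\<Pi>\<^sub>M i\<in>I. N). f i \<in> B (b, i)} \<in> sets (\<Pi>\<^sub>M i\<in>I. N)"
        using measurable_sets[OF measurable_component_singleton[of i I "\<lambda>_. N"]] by (simp add: vimage_def Int_def conj_commute)
    qed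
    have half: "prob ((\<lambda>\<omega>. \<lambda>i\<in>I. V i \<omega>) -` S b \<inter> space M) = (\<Prod>i\<in>Jc b. prob (V i -` B (b, i) \<inter> space M))"
      if V: "indep_vars (\<lambda>_. N) V I" for V :: "'b \<Rightarrow> 'a \<Rightarrow> 'c" and b
    proof -
      have Vm: "i \<in> I \<Longrightarrow> V i \<in> measurable M N" for i using V by (auto simp: indep_vars_def2)
      have eq: "(\<lambda>\<omega>. \<lambda>i\<in>I. V i \<omega>) -` S b \<inter> space M = {\<omega>\<in>space M. \<forall>i\<in>Jc b. V i \<omega> \<in> B (b, i)}"
        using Jc(2)[of b] measurable_space[OF Vm]
        by (auto simp: S_def space_PiM restrict_def subset_iff)
      show ?thesis
      proof (cases "Jc b = {}")
        case True
        then show ?thesis unfolding eq by (simp add: prob_space)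
      next
        case False
        have "prob (\<Inter>i\<in>Jc b. V i -` B (b, i) \<inter> space M) = (\<Prod>i\<in>Jc b. prob (V i -` B (b, i) \<inter> space M))"
          using False Jc B(1) by (intro indep_varsD[OF V]) (auto simp: Jc_def)
        moreover have "(\<Inter>i\<in>Jc b. V i -` B (b, i) \<inter> space M) = {\<omega>\<in>space M. \<forall>i\<in>Jc b. V i \<omega> \<in> B (b, i)}"
          using False by auto
        ultimately show ?thesis unfolding eq by simp
      qed
    qed
    have "(\<Inter>p\<in>J. A p) = {\<omega>\<in>space M. \<forall>p\<in>J. V p \<omega> \<in> B p}"
      using J(1) B(2) by auto
    also have "\<dots> = (\<lambda>\<omega>. (\<lambda>i\<in>I. X i \<omega>, \<lambda>i\<in>I. Z i \<omega>)) -` (S False \<times> S True) \<inter> space M"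
    proof -
      have "(\<forall>p\<in>J. V p \<omega> \<in> B p) \<longleftrightarrow> (\<forall>i\<in>Jc False. X i \<omega> \<in> B (False, i)) \<and> (\<forall>i\<in>Jc True. Z i \<omega> \<in> B (True, i))" for \<omega>
        by (simp add: Ball_def split_paired_All all_bool_eq Jc_def conj_commute V)
      then show ?thesis
        using Jc(2) measurable_space[OF Xm] measurable_space[OF Zm]
        by (auto simp: S_def space_PiM restrict_def subset_iff)
    qed
    finally have "prob (\<Inter>p\<in>J. A p) = prob ((\<lambda>\<omega>. \<lambda>i\<in>I. X i \<omega>) -` S False \<inter> space M) * prob ((\<lambda>\<omega>. \<lambda>i\<in>I. Z i \<omega>) -` S True \<inter> space M)"
      using indep_varD[OF XZ S S, of False True] by simp
    also have "\<dots> = (\<Prod>i\<in>Jc False. prob (X i -` B (False, i) \<inter> space M)) * (\<Prod>i\<in>Jc True. prob (Z i -` B (True, i) \<inter> space M))"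
      by (simp add: half[OF X] half[OF Z])
    also have "\<dots> = (\<Prod>p\<in>J. prob (A p))"
    proof -
      have Jeq: "J = Pair False ` Jc False \<union> Pair True ` Jc True"
      proof (rule set_eqI)
        fix p show "p \<in> J \<longleftrightarrow> p \<in> Pair False ` Jc False \<union> Pair True ` Jc True"
          by (cases p; cases "fst p") (auto simp: Jc_def)
      qed
      have "(\<Prod>p\<in>J. prob (A p)) = (\<Prod>p\<in>Pair False ` Jc False. prob (A p)) * (\<Prod>p\<in>Pair True ` Jc True. prob (A p))"
        by (subst Jeq) (rule prod.union_disjoint, auto simp: Jc)
      also have "(\<Prod>p\<in>Pair False ` Jc False. prob (A p)) = (\<Prod>i\<in>Jc False. prob (X i -` B (False, i) \<inter> space M))"
        by (subst prod.reindex) (auto simp: inj_on_def Jc_def B(2) V intro!: prod.cong)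
      also have "(\<Prod>p\<in>Pair True ` Jc True. prob (A p)) = (\<Prod>i\<in>Jc True. prob (Z i -` B (True, i) \<inter> space M))"
        by (subst prod.reindex) (auto simp: inj_on_def Jc_def B(2) V intro!: prod.cong)
      finally show ?thesis by simp
    qed
    finally show "prob (\<Inter>p\<in>J. A p) = (\<Prod>p\<in>J. prob (A p))" .
  qed
qed

context prob_space
begin

context
  fixes X Z :: "nat \<Rightarrow> 'a \<Rightarrow> L2"
  assumes X: "iid_sequence M X" and Z: "iid_sequence M Z" and XZ: "independent_sequences M X Z"
begin

lemma indep_pairs:
  assumes "1 \<le> i" "1 \<le> j" "i \<noteq> j"
  shows "indep_var borel (\<lambda>\<omega>. (X i \<omega>, Z i \<omega>)) borel (\<lambda>\<omega>. (X j \<omega>, Z j \<omega>))"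
proof -
  let ?V = "\<lambda>p. if fst p then Z (snd p) else X (snd p)"
  have fam: "indep_vars (\<lambda>_. borel) ?V (UNIV \<times> {1..})"
    using X Z XZ by (intro indep_vars_join) (auto simp: iid_sequence_def independent_sequences_def)
  let ?A = "\<lambda>i::nat. {(False, i), (True, i)}"
  have ind: "indep_var (PiM (?A i) (\<lambda>_. borel)) (\<lambda>\<omega>. \<lambda>p\<in>?A i. ?V p \<omega>)
      (PiM (?A j) (\<lambda>_. borel)) (\<lambda>\<omega>. \<lambda>p\<in>?A j. ?V p \<omega>)"
    using assms by (intro indep_var_restrict[OF fam]) auto
  have f: "(\<lambda>f. (f (False, i), f (True, i))) \<in> measurable (PiM (?A i) (\<lambda>_. borel)) (borel :: (L2 \<times> L2) measure)" for i
    unfolding borel_prod[symmetric] by (intro measurable_Pair measurable_component_singleton) simp_all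
  show ?thesis
    using indep_var_compose[OF ind f f] by (simp add: o_def restrict_def)
qed

lemma indep_component:
  assumes "1 \<le> i"
  shows "indep_var borel (X i) borel (Z i)"
proof -
  have f: "(\<lambda>f. f i) \<in> measurable (\<Pi>\<^sub>M i\<in>{1..}. borel) (borel :: L2 measure)"
    using assms by (intro measurable_component_singleton) simp
  show ?thesis
    using indep_var_compose[OF XZ[unfolded independent_sequences_def] f f] assms
    by (simp add: o_def)
qed

lemma distr_pairs:
  assumes "1 \<le> i"
  shows "distr M borel (\<lambda>\<omega>. (X i \<omega>, Z i \<omega>)) = distr M borel (\<lambda>\<omega>. (X 1 \<omega>, Z 1 \<omega>))"
proof -
  have prod: "distr M borel (\<lambda>\<omega>. (X i \<omega>, Z i \<omega>)) = distr M borel (X i) \<Otimes>\<^sub>M distr M borel (Z i)" if "1 \<le> i" for i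
    using indep_component[OF that] by (simp add: indep_var_distribution_eq borel_prod)
  have "distr M borel (X i) = distr M borel (X 1)" "distr M borel (Z i) = distr M borel (Z 1)"
    using X Z assms unfolding iid_sequence_def by blast+
  then show ?thesis by (simp only: prod[OF assms] prod[OF order_refl])
qed

end

lemma indep_transformed:
  assumes ind: "indep_var borel V borel W" and [measurable]: "F \<in> borel_measurable borel"
  shows "indep_var borel (\<lambda>\<omega>. F (V \<omega>)) borel (\<lambda>\<omega>. F (W \<omega>))"
  using indep_var_compose[OF ind assms(2) assms(2)] by (simp add: o_def)

end

section \<open>Estimation of the kernel\<close>

lemma eigenbasis_eigensystem: "eigensystem T lam e \<Longrightarrow> eigenbasis T lam e"
  by (simp add: eigensystem_def eigenbasis_def complete_orthonormal_def orthonormal_def)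

lemma bounded_linear_sample_covariance: "bounded_linear (sample_covariance N x)"
  unfolding sample_covariance_def[abs_def] tensor_def
  by (intro bounded_linear_sum bounded_linear_compose[OF bounded_linear_scaleR_right]
      bounded_linear_scaleR_const bounded_linear_inner_right)

lemma sample_covariance_symmetric: "inner (sample_covariance N x y) z = inner y (sample_covariance N x z)"
  unfolding sample_covariance_def tensor_def
  by (simp add: inner_sum_left inner_sum_right inner_commute[of _ z] inner_commute[of _ y] mult.commute)

lemma limsup_finite_imp_eventually_bounded:
  fixes f :: "nat \<Rightarrow> real"
  assumes "limsup (\<lambda>N. ereal (f N)) < \<infinity>"
  shows "\<exists>B. \<forall>\<^sub>F N in sequentially. f N \<le> B"
proof -
  obtain n :: nat where "limsup (\<lambda>N. ereal (f N)) < ereal (real n)"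
    using assms less_PInf_Ex_of_nat[of "limsup (\<lambda>N. ereal (f N))"] by auto
  from Limsup_lessD[OF this] show ?thesis
    by (intro exI[of _ "real n"]) (auto elim: eventually_mono)
qed

lemma tendsto_zero_if_rate:
  fixes d :: "nat \<Rightarrow> real"
  assumes "1 < \<gamma>" "\<And>N. 0 \<le> d N" and rate: "(\<lambda>N. real N powr (1 - 1 / \<gamma>) * d N) \<longlonglongrightarrow> 0"
  shows "d \<longlonglongrightarrow> 0"
proof (rule Lim_null_comparison[OF _ rate])
  show "\<forall>\<^sub>F N in sequentially. norm (d N) \<le> real N powr (1 - 1 / \<gamma>) * d N"
    using eventually_ge_at_top[of 1]
  proof eventually_elim
    case (elim N)
    then have "1 * d N \<le> real N powr (1 - 1 / \<gamma>) * d N"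
      using assms(1,2) by (intro mult_right_mono ge_one_powr_ge_zero) auto
    then show ?case using assms(2)[of N] by simp
  qed
qed

text \<open>
  The growth condition says that \<open>N powr (1 / \<gamma> - 1)\<close> is at most of the order of the eigenvalue.
\<close>

lemma rate_over_eigenvalue_tendsto_zero:
  fixes d lamL :: "nat \<Rightarrow> real"
  assumes d: "\<And>N. 0 \<le> d N" "(\<lambda>N. real N powr (1 - 1 / \<gamma>) * d N) \<longlonglongrightarrow> 0"
    and pos: "\<forall>\<^sub>F N in sequentially. 0 < lamL N"
    and B: "\<forall>\<^sub>F N in sequentially. inverse (lamL N) * real N powr (1 / \<gamma> - 1) \<le> B"
  shows "(\<lambda>N. d N / lamL N) \<longlonglongrightarrow> 0"
proof (rule Lim_null_comparison)
  show "(\<lambda>N. B * (real N powr (1 - 1 / \<gamma>) * d N)) \<longlonglongrightarrow> 0"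
    using tendsto_mult_right_zero[OF d(2)] by blast
  show "\<forall>\<^sub>F N in sequentially. norm (d N / lamL N) \<le> B * (real N powr (1 - 1 / \<gamma>) * d N)"
    using pos B eventually_ge_at_top[of 1]
  proof eventually_elim
    case (elim N)
    have "real N powr (1 / \<gamma> - 1) * real N powr (1 - 1 / \<gamma>) = 1"
      using elim(3) by (simp flip: powr_add)
    then have "d N / lamL N = (inverse (lamL N) * real N powr (1 / \<gamma> - 1)) * (real N powr (1 - 1 / \<gamma>) * d N)"
      by (simp add: divide_inverse mult_ac)
    also have "\<dots> \<le> B * (real N powr (1 - 1 / \<gamma>) * d N)"
      using elim(2) d(1) by (intro mult_right_mono) auto
    finally show ?case using elim(1) d(1)[of N] by simp
  qed
qed

text \<open>
  The operator norm is a supremum of quotients, whose value at 0 is \<open>0 / 0 = 0\<close>; a nonzero vector is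
  needed to see that the bounds \<open>b N\<close> are nonnegative.
\<close>

lemma onorm_tendsto_zero:
  fixes F :: "nat \<Rightarrow> 'a::real_normed_vector \<Rightarrow> 'b::real_normed_vector"
  assumes b: "b \<longlonglongrightarrow> 0" and "\<forall>\<^sub>F N in sequentially. \<forall>x. norm (F N x) \<le> b N * norm x" and ex: "x0 \<noteq> (0 :: 'a)"
  shows "(\<lambda>N. onorm (F N)) \<longlonglongrightarrow> 0"
proof (rule Lim_null_comparison[OF _ b])
  show "\<forall>\<^sub>F N in sequentially. norm (onorm (F N)) \<le> b N"
    using assms(2)
  proof eventually_elim
    case (elim N)
    have nn: "0 \<le> b N"
      using order_trans[OF norm_ge_zero spec[OF elim, of x0]] ex by (simp add: zero_le_mult_iff)
    have "norm (F N x) / norm x \<le> b N" for x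
      using spec[OF elim, of x] nn by (cases "x = 0") (simp_all add: divide_le_eq)
    then have "bdd_above (range (\<lambda>x. norm (F N x) / norm x))" by (intro bdd_aboveI) auto
    then have "norm (F N 0) / norm (0::'a) \<le> onorm (F N)"
      unfolding onorm_def by (rule cSUP_upper[OF UNIV_I])
    moreover have "onorm (F N) \<le> b N" using elim nn by (intro onorm_bound) auto
    ultimately show ?case by simp
  qed
qed

lemma integral_operator_estimated_kernel:
  "integral_operator (estimated_kernel K L N x y lamh vh uh) z
    = (\<Sum>k=1..K. \<Sum>l=1..L. (sample_cross_coefficient N x y (vh l) (uh k) / lamh l * inner (vh l) z) *\<^sub>R uh k)"
proof -
  have eq: "estimated_kernel K L N x y lamh vh uh = (\<lambda>t s. \<Sum>p\<in>{1..K}\<times>{1..L}.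
      (sample_cross_coefficient N x y (vh (snd p)) (uh (fst p)) / lamh (snd p))
        * rep_L2 (uh (fst p)) t * rep_L2 (vh (snd p)) s)"
    by (intro ext) (simp add: estimated_kernel_def sum.cartesian_product split_def)
  show ?thesis
    unfolding eq by (subst integral_operator_degenerate) (simp_all add: sum.cartesian_product split_def)
qed

lemma (in prob_space) integral_independent_tensor_zero:
  fixes U V :: "'a \<Rightarrow> 'b::{real_inner,banach,second_countable_topology}"
  assumes ind: "indep_var borel U borel V" and U: "integrable M U" and V: "integrable M V" "expectation V = 0"
  shows "(\<integral>\<omega>. inner (U \<omega>) x *\<^sub>R V \<omega> \<partial>M) = 0"
proof -
  have [measurable]: "U \<in> borel_measurable M" "V \<in> borel_measurable M" using U V by auto
  have indn: "indep_var borel (\<lambda>\<omega>. norm (U \<omega>)) borel (\<lambda>\<omega>. norm (V \<omega>))"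
    using indep_var_compose[OF ind, of norm borel norm borel] by (simp add: o_def)
  have "integrable M (\<lambda>\<omega>. norm (U \<omega>) * norm (V \<omega>))"
    using U V by (intro indep_var_integrable[OF indn]) auto
  then have int: "integrable M (\<lambda>\<omega>. inner (U \<omega>) x *\<^sub>R V \<omega>)"
    by (intro bounded_linear_integral_tensor(1)) auto
  have "inner (\<integral>\<omega>. inner (U \<omega>) x *\<^sub>R V \<omega> \<partial>M) y = 0" for y
  proof -
    have indr: "indep_var borel (\<lambda>\<omega>. inner (U \<omega>) x) borel (\<lambda>\<omega>. inner (V \<omega>) y)"
      using indep_var_compose[OF ind, of "\<lambda>u. inner u x" borel "\<lambda>v. inner v y" borel] by (simp add: o_def)
    have "inner (\<integral>\<omega>. inner (U \<omega>) x *\<^sub>R V \<omega> \<partial>M) y = (\<integral>\<omega>. inner (U \<omega>) x * inner (V \<omega>) y \<partial>M)"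
      using int by (subst integral_inner_left[symmetric]) auto
    also have "\<dots> = (\<integral>\<omega>. inner (U \<omega>) x \<partial>M) * (\<integral>\<omega>. inner (V \<omega>) y \<partial>M)"
      using U V by (intro indep_var_lebesgue_integral[OF indr]) auto
    also have "(\<integral>\<omega>. inner (V \<omega>) y \<partial>M) = 0" using V by simp
    finally show ?thesis by simp
  qed
  then show ?thesis by (metis inner_eq_zero_iff)
qed

theorem theorem5p1:
  fixes M :: "'w measure"
    and X Y \<epsilon> :: "nat \<Rightarrow> 'w \<Rightarrow> L2"
    and \<psi> :: "real \<Rightarrow> real \<Rightarrow> real"
    and \<alpha> \<gamma> :: real
    and lam gam :: "nat \<Rightarrow> real" and v u :: "nat \<Rightarrow> L2"
    and lamh gamh :: "nat \<Rightarrow> 'w \<Rightarrow> nat \<Rightarrow> real" and vh uh :: "nat \<Rightarrow> 'w \<Rightarrow> nat \<Rightarrow> L2"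
    and K L :: "nat \<Rightarrow> nat"
  assumes "prob_space M"
    and "hilbert_schmidt_kernel \<psi>"
    and "iid_sequence M X" and "mean_zero M (X 1)"
    and "iid_sequence M \<epsilon>" and "mean_zero M (\<epsilon> 1)"
    and "integrable M (\<lambda>\<omega>. (norm (\<epsilon> 1 \<omega>))\<^sup>2)"
    and "independent_sequences M X \<epsilon>"
    and "\<And>i \<omega>. 1 \<le> i \<Longrightarrow> \<omega> \<in> space M \<Longrightarrow> Y i \<omega> = integral_operator \<psi> (X i \<omega>) + \<epsilon> i \<omega>"
    and "2 < \<alpha>" and "\<alpha> < 4"
    and "eigensystem (covariance_operator M (X 1)) lam v"
    and "eigensystem (covariance_operator M (Y 1)) gam u"
    and "condition_RV M \<alpha> (X 1)" and "condition_Q M (X 1) v"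
    and "condition_RV M \<alpha> (Y 1)" and "condition_Q M (Y 1) u"
    and "\<And>j. 1 \<le> j \<Longrightarrow> lam (j + 1) < lam j" and "\<And>j. 1 \<le> j \<Longrightarrow> 0 < lam j"
    and "\<And>j. 1 \<le> j \<Longrightarrow> gam (j + 1) < gam j" and "\<And>j. 1 \<le> j \<Longrightarrow> 0 < gam j"
    and "\<And>N \<omega>. 1 \<le> N \<Longrightarrow> \<omega> \<in> space M \<Longrightarrow>
           eigensystem (sample_covariance N (\<lambda>i. X i \<omega>)) (lamh N \<omega>) (vh N \<omega>)"
    and "\<And>N \<omega>. 1 \<le> N \<Longrightarrow> \<omega> \<in> space M \<Longrightarrow>
           eigensystem (sample_covariance N (\<lambda>i. Y i \<omega>)) (gamh N \<omega>) (uh N \<omega>)"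
    and "filterlim K at_top sequentially" and "filterlim L at_top sequentially"
    and "1 < \<gamma>" and "\<gamma> < \<alpha> / 2"
    and "limsup (\<lambda>N. ereal (lam (L N) powr (-3/2) * sqrt (real (L N))
           * real N powr (1 / \<gamma> - 1))) < \<infinity>"
    and "limsup (\<lambda>N. ereal (inverse (lam (L N)) * (\<Sum>j=1..L N. inverse (eigengap lam j))
           * real N powr (1 / \<gamma> - 1))) < \<infinity>"
    and "limsup (\<lambda>N. ereal (inverse (lam (L N)) * sqrt (real (K N))
           * real N powr (1 / \<gamma> - 1))) < \<infinity>"
    and "limsup (\<lambda>N. ereal (inverse (lam (L N))
           * ((\<Sum>k=1..K N. inverse (eigengap gam k))
              + sqrt (\<Sum>k=1..K N. inverse ((eigengap gam k)\<^sup>2)))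
           * real N powr (1 / \<gamma> - 1))) < \<infinity>"
  shows "AE \<omega> in M.
    (\<lambda>N. onorm (\<lambda>x.
        integral_operator (estimated_kernel (K N) (L N) N (\<lambda>i. X i \<omega>) (\<lambda>i. Y i \<omega>)
          (lamh N \<omega>) (vh N \<omega>) (uh N \<omega>)) x
        - integral_operator \<psi> x)) \<longlonglongrightarrow> 0"
proof -
  note [simp del] = One_nat_def
  interpret prob_space M by fact
  note hs = \<open>hilbert_schmidt_kernel \<psi>\<close> and iidX = \<open>iid_sequence M X\<close> and iide = \<open>iid_sequence M \<epsilon>\<close>
    and seq = \<open>independent_sequences M X \<epsilon>\<close>
    and Y = assms(9) and lam_decr = assms(18) and lam_pos = assms(19) and gam_decr = assms(20)
    and eigh = assms(22,23) and K = assms(24) and L = assms(25) and K_growth = assms(30)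
  define A where "A = integral_operator \<psi>"
  define A' where "A' = integral_operator (\<lambda>t s. \<psi> s t)"
  have A: "bounded_linear A" "bounded_linear A'"
    unfolding A_def A'_def by (intro bounded_linear_integral_operator hs hilbert_schmidt_kernel_transpose)+
  have [measurable]: "A \<in> borel_measurable borel"
    by (intro borel_measurable_continuous_onI linear_continuous_on A)
  \<comment> \<open>The regression equation holds on the space of \<open>M\<close> only, so independence and measurability are
    derived for the right-hand side.\<close>
  define Y' where "Y' i \<omega> = A (X i \<omega>) + \<epsilon> i \<omega>" for i \<omega>
  have YY': "Y i \<omega> = Y' i \<omega>" if "1 \<le> i" "\<omega> \<in> space M" for i \<omega>
    using Y[OF that] by (simp add: Y'_def A_def)
  have X_int: "integrable M (X 1)" and e_int: "integrable M (\<epsilon> 1)" "expectation (\<epsilon> 1) = 0"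
    using assms(4,6) by (simp_all add: mean_zero_def)
  have [measurable]: "X 1 \<in> borel_measurable M" "\<epsilon> 1 \<in> borel_measurable M"
    using X_int e_int by auto
  have e: "complete_orthonormal v"
    using eigenbasis_eigensystem[OF assms(12)] by (simp add: eigenbasis_def)
  have o: "orthonormal v" using e by (simp add: complete_orthonormal_def)

  \<comment> \<open>A moment order strictly between \<open>\<gamma>\<close> and \<open>\<alpha> / 2\<close>; it is below 2 since \<open>\<alpha> < 4\<close>.\<close>
  define p where "p = (\<gamma> + \<alpha> / 2) / 2"
  have p: "1 < \<gamma>" "\<gamma> < p" "p \<le> 2" "p < \<alpha> / 2"
    using assms(10,11,26,27) by (auto simp: p_def)
  have square_powr: "(a * a) powr p = a powr (2 * p)" if "0 \<le> a" for a :: real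
    using that by (simp add: powr_mult flip: powr_add)
  have momX: "integrable M (\<lambda>\<omega>. norm (X 1 \<omega>) powr (2 * p))"
    using p assms(14) by (intro regularly_varying_moment[OF \<open>prob_space M\<close>, of \<alpha>]) (auto simp: condition_RV_def)
  have "integrable M (\<lambda>\<omega>. norm (Y 1 \<omega>) powr (2 * p))"
    using p assms(16) by (intro regularly_varying_moment[OF \<open>prob_space M\<close>, of \<alpha>]) (auto simp: condition_RV_def)
  then have momY: "integrable M (\<lambda>\<omega>. norm (Y' 1 \<omega>) powr (2 * p))"
    by (subst (asm) Bochner_Integration.integrable_cong[OF refl, where g = "\<lambda>\<omega>. norm (Y' 1 \<omega>) powr (2 * p)"])
      (auto simp: YY')
  have mome: "integrable M (\<lambda>\<omega>. (norm (X 1 \<omega>) * norm (\<epsilon> 1 \<omega>)) powr p)"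
  proof -
    have "integrable M (\<lambda>\<omega>. norm (X 1 \<omega>) powr p)"
      using p by (intro integrable_powr_less[OF momX]) auto
    moreover have "integrable M (\<lambda>\<omega>. norm (\<epsilon> 1 \<omega>) powr p)"
    proof (rule integrable_powr_less)
      show "integrable M (\<lambda>\<omega>. norm (\<epsilon> 1 \<omega>) powr 2)" using assms(7) by simp
    qed (use p in auto)
    moreover have "indep_var borel (\<lambda>\<omega>. norm (X 1 \<omega>) powr p) borel (\<lambda>\<omega>. norm (\<epsilon> 1 \<omega>) powr p)"
      using indep_var_compose[OF indep_component[OF iidX iide seq order_refl],
          of "\<lambda>x. norm x powr p" borel "\<lambda>x. norm x powr p" borel] by (simp add: o_def)
    ultimately have "integrable M (\<lambda>\<omega>. norm (X 1 \<omega>) powr p * norm (\<epsilon> 1 \<omega>) powr p)"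
      by (intro indep_var_integrable)
    then show ?thesis by (simp add: powr_mult)
  qed

  note pairs = indep_pairs[OF iidX iide seq] and same = distr_pairs[OF iidX iide seq]
  have W [measurable]: "(\<lambda>\<omega>. (X i \<omega>, \<epsilon> i \<omega>)) \<in> borel_measurable M" if "1 \<le> i" for i
    using pairs[of i "Suc i"] that by (auto dest: indep_var_rv1)
  have transform: "indep_var borel (\<lambda>\<omega>. F (X i \<omega>, \<epsilon> i \<omega>)) borel (\<lambda>\<omega>. F (X j \<omega>, \<epsilon> j \<omega>))"
      if "F \<in> borel_measurable borel" "1 \<le> i" "1 \<le> j" "i \<noteq> j" for F :: "L2 \<times> L2 \<Rightarrow> L2 \<times> L2" and i j
    by (rule indep_transformed[OF pairs[OF that(2-4)] that(1)])
  have transform_distr: "distr M borel (\<lambda>\<omega>. F (X i \<omega>, \<epsilon> i \<omega>)) = distr M borel (\<lambda>\<omega>. F (X 1 \<omega>, \<epsilon> 1 \<omega>))"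
      if F: "F \<in> borel_measurable borel" and i: "1 \<le> i" for F :: "L2 \<times> L2 \<Rightarrow> L2 \<times> L2" and i
  proof -
    have "distr M borel (\<lambda>\<omega>. F (X i \<omega>, \<epsilon> i \<omega>)) = distr (distr M borel (\<lambda>\<omega>. (X i \<omega>, \<epsilon> i \<omega>))) borel F" if "1 \<le> i" for i
      by (subst distr_distr[OF F W[OF that]]) (simp add: o_def)
    then show ?thesis using i by (simp only: same[OF i] order_refl)
  qed
  \<comment> \<open>The pairs \<open>(X i, X i)\<close> and \<open>(Y' i, Y' i)\<close> are continuous functions of the independent \<open>(X i, \<epsilon> i)\<close>.\<close>
  have FX: "(\<lambda>q :: L2 \<times> L2. (fst q, fst q)) \<in> borel_measurable borel"
    by (intro borel_measurable_continuous_onI continuous_intros)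
  have FY: "(\<lambda>q :: L2 \<times> L2. (A (fst q) + snd q, A (fst q) + snd q)) \<in> borel_measurable borel"
    by (intro borel_measurable_continuous_onI continuous_intros
        bounded_linear.continuous_on[OF A(1)])

  obtain dX where dX: "\<And>N \<omega>. 0 \<le> dX N \<omega>" "AE \<omega> in M. (\<lambda>N. real N powr (1 - 1 / \<gamma>) * dX N \<omega>) \<longlonglongrightarrow> 0"
    "\<And>N \<omega> x. 1 \<le> N \<Longrightarrow> norm ((1 / real N) *\<^sub>R (\<Sum>i=1..N. inner (X i \<omega>) x *\<^sub>R X i \<omega>)
        - (\<integral>\<omega>. inner (X 1 \<omega>) x *\<^sub>R X 1 \<omega> \<partial>M)) \<le> dX N \<omega> * norm x"
  proof -
    have "integrable M (\<lambda>\<omega>. (norm (X 1 \<omega>) * norm (X 1 \<omega>)) powr p)" using momX by (simp add: square_powr)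
    note mom = this
    have ind: "indep_var borel (\<lambda>\<omega>. (X i \<omega>, X i \<omega>)) borel (\<lambda>\<omega>. (X j \<omega>, X j \<omega>))"
        if "1 \<le> i" "1 \<le> j" "i \<noteq> j" for i j
      using transform[OF FX that] by (simp)
    have "distr M borel (\<lambda>\<omega>. (X i \<omega>, X i \<omega>)) = distr M borel (\<lambda>\<omega>. (X 1 \<omega>, X 1 \<omega>))"
        if "1 \<le> i" for i
      using transform_distr[OF FX that] by (simp)
    from empirical_operator_rate[where U = X and V = X, OF e ind this mom p(1-3)]
    show ?thesis using that by blast
  qed
  obtain dY where dY: "\<And>N \<omega>. 0 \<le> dY N \<omega>" "AE \<omega> in M. (\<lambda>N. real N powr (1 - 1 / \<gamma>) * dY N \<omega>) \<longlonglongrightarrow> 0"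
    "\<And>N \<omega> x. 1 \<le> N \<Longrightarrow> norm ((1 / real N) *\<^sub>R (\<Sum>i=1..N. inner (Y' i \<omega>) x *\<^sub>R Y' i \<omega>)
        - (\<integral>\<omega>. inner (Y' 1 \<omega>) x *\<^sub>R Y' 1 \<omega> \<partial>M)) \<le> dY N \<omega> * norm x"
  proof -
    have "integrable M (\<lambda>\<omega>. (norm (Y' 1 \<omega>) * norm (Y' 1 \<omega>)) powr p)" using momY by (simp add: square_powr)
    note mom = this
    have ind: "indep_var borel (\<lambda>\<omega>. (Y' i \<omega>, Y' i \<omega>)) borel (\<lambda>\<omega>. (Y' j \<omega>, Y' j \<omega>))"
        if "1 \<le> i" "1 \<le> j" "i \<noteq> j" for i j
      using transform[OF FY that] by (simp add: Y'_def)
    have "distr M borel (\<lambda>\<omega>. (Y' i \<omega>, Y' i \<omega>)) = distr M borel (\<lambda>\<omega>. (Y' 1 \<omega>, Y' 1 \<omega>))"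
        if "1 \<le> i" for i
      using transform_distr[OF FY that] by (simp add: Y'_def)
    from empirical_operator_rate[where U = Y' and V = Y', OF e ind this mom p(1-3)]
    show ?thesis using that by blast
  qed
  obtain h where h: "\<And>N \<omega>. 0 \<le> h N \<omega>" "AE \<omega> in M. (\<lambda>N. real N powr (1 - 1 / \<gamma>) * h N \<omega>) \<longlonglongrightarrow> 0"
    "\<And>N \<omega> x. 1 \<le> N \<Longrightarrow> norm ((1 / real N) *\<^sub>R (\<Sum>i=1..N. inner (X i \<omega>) x *\<^sub>R \<epsilon> i \<omega>)) \<le> h N \<omega> * norm x"
  proof -
    have zero: "(\<integral>\<omega>. inner (X 1 \<omega>) x *\<^sub>R \<epsilon> 1 \<omega> \<partial>M) = 0" for x
      by (rule integral_independent_tensor_zero[OF indep_component[OF iidX iide seq order_refl] X_int e_int])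
    from empirical_operator_rate[where U = X and V = \<epsilon>, OF e pairs same mome p(1-3)]
    show ?thesis using that unfolding zero diff_zero by blast
  qed

  have XX: "integrable M (\<lambda>\<omega>. norm (X 1 \<omega>) * norm (X 1 \<omega>))"
  proof -
    have "integrable M (\<lambda>\<omega>. norm (X 1 \<omega>) powr 2)"
      using p by (intro integrable_powr_less[OF momX]) auto
    then show ?thesis by (simp add: power2_eq_square)
  qed
  have [measurable]: "Y' 1 \<in> borel_measurable M" unfolding Y'_def by measurable
  have YY: "integrable M (\<lambda>\<omega>. norm (Y' 1 \<omega>) * norm (Y' 1 \<omega>))"
  proof -
    have "integrable M (\<lambda>\<omega>. norm (Y' 1 \<omega>) powr 2)"
      using p by (intro integrable_powr_less[OF momY]) auto
    then show ?thesis by (simp add: power2_eq_square)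
  qed
  have CX: "covariance_operator M (X 1) = (\<lambda>x. \<integral>\<omega>. inner (X 1 \<omega>) x *\<^sub>R X 1 \<omega> \<partial>M)"
    by (simp add: fun_eq_iff covariance_operator_def tensor_def)
  have CY: "covariance_operator M (Y 1) = (\<lambda>x. \<integral>\<omega>. inner (Y' 1 \<omega>) x *\<^sub>R Y' 1 \<omega> \<partial>M)"
    unfolding fun_eq_iff covariance_operator_def tensor_def
    by (intro allI Bochner_Integration.integral_cong) (simp_all add: YY')
  have blC: "bounded_linear (covariance_operator M (X 1))" "bounded_linear (covariance_operator M (Y 1))"
    unfolding CX CY using XX YY by (auto intro!: bounded_linear_integral_tensor(2))

  have L1: "\<forall>\<^sub>F N in sequentially. 1 \<le> L N" and K1: "\<forall>\<^sub>F N in sequentially. 1 \<le> K N"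
    using K L by (simp_all add: filterlim_at_top)
  have pos: "\<forall>\<^sub>F N in sequentially. 0 < lam (L N)"
    using L1 by eventually_elim (rule lam_pos)
  \<comment> \<open>From the growth condition on \<open>sqrt (K N)\<close>, as \<open>K N \<ge> 1\<close> eventually.\<close>
  obtain B where B: "\<forall>\<^sub>F N in sequentially. inverse (lam (L N)) * real N powr (1 / \<gamma> - 1) \<le> B"
  proof -
    obtain B where "\<forall>\<^sub>F N in sequentially. inverse (lam (L N)) * sqrt (real (K N)) * real N powr (1 / \<gamma> - 1) \<le> B"
      using limsup_finite_imp_eventually_bounded[OF K_growth] by blast
    then have "\<forall>\<^sub>F N in sequentially. inverse (lam (L N)) * real N powr (1 / \<gamma> - 1) \<le> B"
      using pos K1
    proof eventually_elim
      case (elim N)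
      have "(inverse (lam (L N)) * real N powr (1 / \<gamma> - 1)) * 1
          \<le> (inverse (lam (L N)) * real N powr (1 / \<gamma> - 1)) * sqrt (real (K N))"
        using elim by (intro mult_left_mono) auto
      then show ?case using elim(1) by (simp add: mult_ac)
    qed
    then show ?thesis using that by blast
  qed

  show ?thesis
    using dX(2) dY(2) h(2) AE_space
  proof eventually_elim
    case (elim \<omega>)
    let ?S = "\<lambda>N. sample_covariance N (\<lambda>i. X i \<omega>)" and ?SY = "\<lambda>N. sample_covariance N (\<lambda>i. Y i \<omega>)"
    let ?E = "\<lambda>N x. (1 / real N) *\<^sub>R (\<Sum>i=1..N. inner (X i \<omega>) x *\<^sub>R \<epsilon> i \<omega>)"
    let ?D = "\<lambda>N x. (1 / real N) *\<^sub>R (\<Sum>i=1..N. inner (X i \<omega>) x *\<^sub>R Y i \<omega>)"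
    have lin_D: "linear (?D N)" for N
      by (intro bounded_linear.linear bounded_linear_sum bounded_linear_compose[OF bounded_linear_scaleR_right]
          bounded_linear_scaleR_const bounded_linear_inner_right)
    have D_eq: "?D N x = A (?S N x) + ?E N x" for N x
    proof -
      note lin = linear_sum[OF bounded_linear.linear[OF A(1)]] linear_scale[OF bounded_linear.linear[OF A(1)]]
      have "(\<Sum>i=1..N. inner (X i \<omega>) x *\<^sub>R Y i \<omega>) = (\<Sum>i=1..N. inner (X i \<omega>) x *\<^sub>R A (X i \<omega>) + inner (X i \<omega>) x *\<^sub>R \<epsilon> i \<omega>)"
        using elim(4) by (intro sum.cong) (auto simp: YY' Y'_def scaleR_add_right)
      then show ?thesis
        by (simp add: sample_covariance_def tensor_def lin sum.distrib scaleR_add_right)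
    qed
    have dS: "norm (?S N x - covariance_operator M (X 1) x) \<le> dX N \<omega> * norm x" if "1 \<le> N" for N x
      using dX(3)[OF that, of \<omega> x] by (simp add: sample_covariance_def tensor_def CX)
    have dSY: "norm (?SY N x - covariance_operator M (Y 1) x) \<le> dY N \<omega> * norm x" if "1 \<le> N" for N x
    proof -
      have "(\<Sum>i=1..N. inner (Y i \<omega>) x *\<^sub>R Y i \<omega>) = (\<Sum>i=1..N. inner (Y' i \<omega>) x *\<^sub>R Y' i \<omega>)"
        using elim(4) by (intro sum.cong) (auto simp: YY')
      then show ?thesis using dY(3)[OF that, of \<omega> x] by (simp add: sample_covariance_def tensor_def CY)
    qed
    have cross: "sample_cross_coefficient N (\<lambda>i. X i \<omega>) (\<lambda>i. Y i \<omega>) a b = inner (?D N a) b" for N a b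
      by (simp add: sample_cross_coefficient_def inner_sum_left)
    have "\<exists>b. b \<longlonglongrightarrow> 0 \<and> (\<forall>\<^sub>F N in sequentially. \<forall>x.
      norm ((\<Sum>k=1..K N. \<Sum>l=1..L N. (inner (?D N (vh N \<omega> l)) (uh N \<omega> k) / lamh N \<omega> l * inner (vh N \<omega> l) x) *\<^sub>R uh N \<omega> k) - A x)
        \<le> b N * norm x)"
    proof (rule regularized_inverse_consistent[where A = A and A' = A' and v = v and S = ?S and SY = ?SY and E = ?E and D = ?D
          and C = "covariance_operator M (X 1)" and CY = "covariance_operator M (Y 1)"
          and lam = lam and gam = gam and u = u and lamh = "\<lambda>N. lamh N \<omega>" and vh = "\<lambda>N. vh N \<omega>"
          and gamh = "\<lambda>N. gamh N \<omega>" and uh = "\<lambda>N. uh N \<omega>"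
          and d = "\<lambda>N. dX N \<omega>" and dY = "\<lambda>N. dY N \<omega>" and h = "\<lambda>N. h N \<omega>" and K = K and L = L])
      show "inner (A x) y = inner x (A' y)" for x y
        unfolding A_def A'_def by (rule integral_operator_adjoint[OF hs])
      show "(\<Sum>j=1..n. (norm (A (v j)))\<^sup>2) \<le> hs_norm_sq \<psi>" for n
        unfolding A_def by (rule sum_norm_integral_operator_le[OF hs o])
      show "(\<Sum>j=1..n. (norm (A' (v j)))\<^sup>2) \<le> hs_norm_sq (\<lambda>t s. \<psi> s t)" for n
        unfolding A'_def by (rule sum_norm_integral_operator_le[OF hilbert_schmidt_kernel_transpose[OF hs] o])
      show "(\<lambda>N. dX N \<omega>) \<longlonglongrightarrow> 0" by (rule tendsto_zero_if_rate[OF p(1) dX(1) elim(1)])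
      show "(\<lambda>N. dY N \<omega>) \<longlonglongrightarrow> 0" by (rule tendsto_zero_if_rate[OF p(1) dY(1) elim(2)])
      show "(\<lambda>N. dX N \<omega> / lam (L N)) \<longlonglongrightarrow> 0"
        by (rule rate_over_eigenvalue_tendsto_zero[OF dX(1) elim(1) pos B])
      show "(\<lambda>N. h N \<omega> / lam (L N)) \<longlonglongrightarrow> 0"
        by (rule rate_over_eigenvalue_tendsto_zero[OF h(1) elim(3) pos B])
    qed (assumption | rule A blC lam_decr lam_pos gam_decr eigenbasis_eigensystem[OF assms(12)] eigenbasis_eigensystem[OF assms(13)]
          bounded_linear_sample_covariance sample_covariance_symmetric lin_D D_eq dS dSY h(3) K L
          eigenbasis_eigensystem[OF eigh(1)[OF _ elim(4)]] eigenbasis_eigensystem[OF eigh(2)[OF _ elim(4)]])+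
    then obtain b where b: "b \<longlonglongrightarrow> 0" "\<forall>\<^sub>F N in sequentially. \<forall>x.
      norm ((\<Sum>k=1..K N. \<Sum>l=1..L N. (inner (?D N (vh N \<omega> l)) (uh N \<omega> k) / lamh N \<omega> l * inner (vh N \<omega> l) x) *\<^sub>R uh N \<omega> k) - A x)
        \<le> b N * norm x" by blast
    have "inner (v 1) (v 1) = 1" using o by (simp add: orthonormal_def)
    then have "v 1 \<noteq> 0" by auto
    then show ?case
      unfolding integral_operator_estimated_kernel cross A_def[symmetric]
      by (rule onorm_tendsto_zero[OF b])
  qed
qed

end
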